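(* Let $(X,d,\mu)$ be a complete and separable metric measure space equipped with a non-negative Radon measure $\mu$, let $\Omega\subset X$ be an open set, let $\tau>0$ and $p\in[1,\infty)$, and set $\Omega_\tau:=\Omega\times(0,\tau)$. Let $f\in L^p_{\mathrm{loc}}(0,\tau;N^{1,p}_{\mathrm{loc}}(\Omega))$ and, for $\varepsilon>0$, let $f_\varepsilon$ denote its time mollification $f_\varepsilon(t)=\int_{-\varepsilon}^{\varepsilon}\eta_\varepsilon(s)f(t-s)\,ds$. Then $g_{f_\varepsilon-f}\to 0$ in $L^p_{\mathrm{loc}}(\Omega_\tau)$ as $\varepsilon\to0$. Moreover, as $s\to 0$, $g_{f(t-s)-f(t)}\to 0$ in $L^p_{\mathrm{loc}}(\Omega_\tau)$ uniformly in $t$.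
   Context: Curves and modulus: for a family $\Gamma$ of absolutely continuous curves $\gamma:[0,1]\to X$, $\mathrm{Mod}_p(\Gamma)=\inf\{\int_X\rho^p\,d\mu:\rho:X\to[0,\infty]\text{ Borel},\ \int_\gamma\rho\,ds\ge1\ \forall\gamma\in\Gamma\}$. A Borel $g:X\to[0,\infty]$ is an upper gradient of $u:X\to[-\infty,\infty]$ if $|u(\gamma(1))-u(\gamma(0))|\le\int_\gamma g\,ds$ for every absolutely continuous curve $\gamma$; it is a $p$-weak upper gradient if this holds for all curves outside a family of $p$-modulus zero. The minimal $p$-weak upper gradient $g_u$ is the ($\mu$-a.e. unique) $p$-integrable $p$-weak upper gradient of $u$ with $g_u\le h$ a.e. for every $p$-integrable $p$-weak upper gradient $h$ of $u$. The Newton–Sobolev space $N^{1,p}(\Omega)$ (with $\Omega$ regarded as a metric measure space with the restricted distance and measure) consists of equivalence classes of $u\in L^p(\Omega)$ having a $p$-integrable $p$-weak upper gradient, with norm $\|u\|^p_{N^{1,p}(\Omega)}=\|u\|^p_{L^p(\Omega)}+\|g_u\|^p_{L^p(\Omega)}$ (two functions identified when the norm of their difference is zero). $L^p(0,\tau;N^{1,p}(\Omega))$ is the Bochner space of strongly measurable maps $f:(0,\tau)\to N^{1,p}(\Omega)$ (a.e. limits of simple functions $\sum_i 1_{E_i}(t)v_i$, $E_i$ measurable, $v_i\in N^{1,p}(\Omega)$) with $\int_0^\tau\|f(t)\|^p_{N^{1,p}(\Omega)}dt<\infty$. Such $f$ are regarded as $\mu\otimes\mathcal L^1$-measurable functions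 on $\Omega_\tau$. The parabolic minimal $p$-weak upper gradient of $f$ is $g_f(\cdot,t):=g_{f(t)}$ for a.e. $t\in(0,\tau)$. Notation $U\Subset\Omega$ means $U$ bounded with $\mathrm{dist}(U,\Omega^c)>0$; local spaces ($L^p_{\mathrm{loc}}(0,\tau;N^{1,p}_{\mathrm{loc}}(\Omega))$, $L^p_{\mathrm{loc}}(\Omega_\tau)$) mean membership/convergence on every $U\times I$ with $U\Subset\Omega$ and $I$ compactly contained in $(0,\tau)$. The mollifier is $\eta_\varepsilon(s)=\frac{1}{\varepsilon}\eta(s/\varepsilon)$ with $\eta$ a standard mollifier on $\mathbb R$ (smooth, nonnegative, supported in $[-1,1]$, integral $1$).
   Formalization: "Uniformly in t" is not formalized: the second claim is convergence to 0 in L^p_loc(Ω_τ) as s→0, with t integrated; uniformity over individual t fails, e.g. for f(t)=1_{t>τ/2}v with g_v≠0. *)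

theory Defs
  imports "HOL-Analysis.Analysis"
begin

definition epow :: "ennreal \<Rightarrow> real \<Rightarrow> ennreal" where
  "epow x q = (if x = \<infinity> then \<infinity> else ennreal (enn2real x powr q))"

definition ac_curve :: "'a::metric_space set \<Rightarrow> (real \<Rightarrow> 'a) \<Rightarrow> bool" where
  "ac_curve \<Omega> \<gamma> \<longleftrightarrow> \<gamma> ` {0..1} \<subseteq> \<Omega> \<and>
     (\<forall>\<epsilon>>0. \<exists>\<delta>>0. \<forall>(n::nat) (a::nat \<Rightarrow> real) b.
        (\<forall>i<n. 0 \<le> a i \<and> a i \<le> b i \<and> b i \<le> 1) \<and>
        (\<forall>i<n. \<forall>j<n. i \<noteq> j \<longrightarrow> b i \<le> a j \<or> b j \<le> a i) \<and>
        (\<Sum>i<n. b i - a i) < \<delta> \<longrightarrow> (\<Sum>i<n. dist (\<gamma> (a i)) (\<gamma> (b i))) < \<epsilon>)"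

definition metric_deriv :: "(real \<Rightarrow> 'a::metric_space) \<Rightarrow> real \<Rightarrow> ennreal" where
  "metric_deriv \<gamma> t = Limsup (at t within {0..1}) (\<lambda>s. ennreal (dist (\<gamma> s) (\<gamma> t) / \<bar>s - t\<bar>))"

definition line_integral :: "('a::metric_space \<Rightarrow> ennreal) \<Rightarrow> (real \<Rightarrow> 'a) \<Rightarrow> ennreal" where
  "line_integral \<rho> \<gamma> = (\<integral>\<^sup>+ t\<in>{0..1}. \<rho> (\<gamma> t) * metric_deriv \<gamma> t \<partial>lebesgue)"

definition p_modulus :: "'a::metric_space measure \<Rightarrow> 'a set \<Rightarrow> real \<Rightarrow> (real \<Rightarrow> 'a) set \<Rightarrow> ennreal" where
  "p_modulus \<mu> \<Omega> p \<Gamma> =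
     (INF \<rho> \<in> {\<rho>. \<rho> \<in> borel_measurable borel \<and> (\<forall>\<gamma>\<in>\<Gamma>. 1 \<le> line_integral \<rho> \<gamma>)}.
        \<integral>\<^sup>+ x\<in>\<Omega>. epow (\<rho> x) p \<partial>\<mu>)"

definition p_weak_ug :: "'a::metric_space measure \<Rightarrow> 'a set \<Rightarrow> real \<Rightarrow> ('a \<Rightarrow> real) \<Rightarrow> ('a \<Rightarrow> ennreal) \<Rightarrow> bool" where
  "p_weak_ug \<mu> \<Omega> p u g \<longleftrightarrow> g \<in> borel_measurable borel \<and>
     (\<exists>\<Gamma>. p_modulus \<mu> \<Omega> p \<Gamma> = 0 \<and>
        (\<forall>\<gamma>. ac_curve \<Omega> \<gamma> \<and> \<gamma> \<notin> \<Gamma> \<longrightarrow>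
              ennreal \<bar>u (\<gamma> 1) - u (\<gamma> 0)\<bar> \<le> line_integral g \<gamma>))"

definition in_N1p :: "'a::metric_space measure \<Rightarrow> 'a set \<Rightarrow> real \<Rightarrow> ('a \<Rightarrow> real) \<Rightarrow> bool" where
  "in_N1p \<mu> \<Omega> p u \<longleftrightarrow>
     (\<lambda>x. indicator \<Omega> x * u x) \<in> borel_measurable (completion \<mu>) \<and>
     (\<integral>\<^sup>+ x\<in>\<Omega>. ennreal (\<bar>u x\<bar> powr p) \<partial>completion \<mu>) < \<infinity> \<and>
     (\<exists>g. p_weak_ug \<mu> \<Omega> p u g \<and> (\<integral>\<^sup>+ x\<in>\<Omega>. epow (g x) p \<partial>\<mu>) < \<infinity>)"

definition is_min_wug :: "'a::metric_space measure \<Rightarrow> 'a set \<Rightarrow> real \<Rightarrow> ('a \<Rightarrow> real) \<Rightarrow> ('a \<Rightarrow> ennreal) \<Rightarrow> bool" where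
  "is_min_wug \<mu> \<Omega> p u g \<longleftrightarrow> p_weak_ug \<mu> \<Omega> p u g \<and> (\<integral>\<^sup>+ x\<in>\<Omega>. epow (g x) p \<partial>\<mu>) < \<infinity> \<and>
     (\<forall>h. p_weak_ug \<mu> \<Omega> p u h \<and> (\<integral>\<^sup>+ x\<in>\<Omega>. epow (h x) p \<partial>\<mu>) < \<infinity> \<longrightarrow>
          (AE x in \<mu>. x \<in> \<Omega> \<longrightarrow> g x \<le> h x))"

definition min_wug :: "'a::metric_space measure \<Rightarrow> 'a set \<Rightarrow> real \<Rightarrow> ('a \<Rightarrow> real) \<Rightarrow> 'a \<Rightarrow> ennreal" where
  "min_wug \<mu> \<Omega> p u = (SOME g. is_min_wug \<mu> \<Omega> p u g)"

definition N1p_norm :: "'a::metric_space measure \<Rightarrow> 'a set \<Rightarrow> real \<Rightarrow> ('a \<Rightarrow> real) \<Rightarrow> ennreal" where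
  "N1p_norm \<mu> \<Omega> p u = epow ((\<integral>\<^sup>+ x\<in>\<Omega>. ennreal (\<bar>u x\<bar> powr p) \<partial>completion \<mu>)
                              + (\<integral>\<^sup>+ x\<in>\<Omega>. epow (min_wug \<mu> \<Omega> p u x) p \<partial>\<mu>)) (1 / p)"

definition simple_fn :: "nat \<Rightarrow> (nat \<Rightarrow> real set) \<Rightarrow> (nat \<Rightarrow> 'a \<Rightarrow> real) \<Rightarrow> real \<Rightarrow> 'a \<Rightarrow> real" where
  "simple_fn n E V s x = (\<Sum>i<n. indicator (E i) s * V i x)"

definition N1p_strongly_measurable :: "'a::metric_space measure \<Rightarrow> 'a set \<Rightarrow> real \<Rightarrow> real set \<Rightarrow> (real \<Rightarrow> 'a \<Rightarrow> real) \<Rightarrow> bool" where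
  "N1p_strongly_measurable \<mu> U p S h \<longleftrightarrow>
     (AE s in lebesgue. s \<in> S \<longrightarrow> in_N1p \<mu> U p (h s)) \<and>
     (\<exists>(n::nat \<Rightarrow> nat) E V. (\<forall>k i. i < n k \<longrightarrow> E k i \<in> sets lebesgue \<and> in_N1p \<mu> U p (V k i)) \<and>
        (AE s in lebesgue. s \<in> S \<longrightarrow>
           ((\<lambda>k. N1p_norm \<mu> U p (\<lambda>x. simple_fn (n k) (E k) (V k) s x - h s x)) \<longlonglongrightarrow> 0)))"

definition in_Lp_N1p :: "'a::metric_space measure \<Rightarrow> 'a set \<Rightarrow> real \<Rightarrow> real set \<Rightarrow> (real \<Rightarrow> 'a \<Rightarrow> real) \<Rightarrow> bool" where
  "in_Lp_N1p \<mu> U p S f \<longleftrightarrow> N1p_strongly_measurable \<mu> U p S f \<and>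
     (\<integral>\<^sup>+ t\<in>S. epow (N1p_norm \<mu> U p (f t)) p \<partial>lebesgue) < \<infinity>"

definition N1p_bochner_integral :: "'a::metric_space measure \<Rightarrow> 'a set \<Rightarrow> real \<Rightarrow> real set \<Rightarrow> (real \<Rightarrow> 'a \<Rightarrow> real) \<Rightarrow> ('a \<Rightarrow> real) \<Rightarrow> bool" where
  "N1p_bochner_integral \<mu> U p S h v \<longleftrightarrow> in_N1p \<mu> U p v \<and> N1p_strongly_measurable \<mu> U p S h \<and>
     (\<integral>\<^sup>+ s\<in>S. N1p_norm \<mu> U p (h s) \<partial>lebesgue) < \<infinity> \<and>
     (\<exists>(n::nat \<Rightarrow> nat) E V.
        (\<forall>k i. i < n k \<longrightarrow> E k i \<in> sets lebesgue \<and> E k i \<subseteq> S \<and> emeasure lebesgue (E k i) < \<infinity>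
                             \<and> in_N1p \<mu> U p (V k i)) \<and>
        ((\<lambda>k. \<integral>\<^sup>+ s\<in>S. N1p_norm \<mu> U p (\<lambda>x. simple_fn (n k) (E k) (V k) s x - h s x) \<partial>lebesgue) \<longlonglongrightarrow> 0) \<and>
        ((\<lambda>k. N1p_norm \<mu> U p (\<lambda>x. (\<Sum>i<n k. measure lebesgue (E k i) * V k i x) - v x)) \<longlonglongrightarrow> 0))"

definition compactly_in :: "'a::metric_space set \<Rightarrow> 'a set \<Rightarrow> bool" where
  "compactly_in U \<Omega> \<longleftrightarrow> bounded U \<and> (\<exists>\<delta>>0. \<forall>x\<in>U. \<forall>y. y \<notin> \<Omega> \<longrightarrow> \<delta> \<le> dist x y)"

definition in_Lp_N1p_loc :: "'a::metric_space measure \<Rightarrow> 'a set \<Rightarrow> real \<Rightarrow> real \<Rightarrow> (real \<Rightarrow> 'a \<Rightarrow> real) \<Rightarrow> bool" where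
  "in_Lp_N1p_loc \<mu> \<Omega> p \<tau> f \<longleftrightarrow>
     (\<forall>U a b. open U \<and> compactly_in U \<Omega> \<and> 0 < a \<and> a \<le> b \<and> b < \<tau> \<longrightarrow> in_Lp_N1p \<mu> U p {a..b} f)"

definition std_mollifier :: "(real \<Rightarrow> real) \<Rightarrow> bool" where
  "std_mollifier \<eta> \<longleftrightarrow> (\<forall>k x. ((deriv ^^ k) \<eta>) differentiable (at x)) \<and> (\<forall>x. 0 \<le> \<eta> x) \<and>
     (\<forall>x. 1 < \<bar>x\<bar> \<longrightarrow> \<eta> x = 0) \<and> (\<eta> has_integral 1) UNIV"

definition moll_kernel :: "(real \<Rightarrow> real) \<Rightarrow> real \<Rightarrow> real \<Rightarrow> real" where
  "moll_kernel \<eta> \<epsilon> s = \<eta> (s / \<epsilon>) / \<epsilon>"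

end

theory Submission
  imports Defs
begin

text \<open>
  Only the gradient part of the Newton--Sobolev norm matters. The functions with a \<open>p\<close>-weak upper
  gradient of finite energy form a linear space on which \<open>Q u = \<parallel>g\<^sub>u\<parallel>\<^sub>p\<close> is a seminorm dominated by the
  norm: minimal gradients exist because weak upper gradients of finite energy are stable under
  minima and decreasing limits, and the triangle inequality follows from the convexity of \<open>x powr p\<close>.

  A strongly measurable \<open>f\<close> with \<open>Q (f t)\<close> in \<open>L\<^sup>p\<close> is then an \<open>L\<^sup>p\<close>-limit of step functions
  \<open>\<Sum>i. indicator (B i) t * W i\<close>, for which translation continuity reduces to that of \<open>indicator (B i)\<close>
  in \<open>L\<^sup>1\<close>. Since \<open>Q\<close> passes under the Bochner integral, Jensen's inequality and Tonelli's theorem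
  bound the mollification error by the mean over \<open>s\<close> of the translation errors.
\<close>

section \<open>Powers of extended reals and curve integrals\<close>

text \<open>Two obstacles shape the proof. A weak upper gradient is controlled only off a family of
  curves of modulus zero, and such a family may contain a subcurve of a curve that it misses. Each
  exceptional family is therefore traded for a Borel weight of finite energy: the good curves become
  those along which the weight has a finite integral, a condition that passes to subcurves. The
  gradient inequality is then available on every parameter interval, which lets two gradients be
  spliced along one curve; splicing is the source of the stability under minima.

  The second obstacle is measurability in time. Neither
  \<open>Q (\<lambda>x. f (t - s) x - f t x)\<close> as a function of \<open>(t, s)\<close> nor
  \<open>F \<epsilon> t\<close> as a function of \<open>t\<close> comes with the measurability that
  Tonelli's theorem asks for. The step functions are therefore built over Borel sets and yield a
  jointly Borel majorant \<open>\<beta> t s\<close>, valid whenever \<open>t\<close> and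
  \<open>t - s\<close> avoid one fixed null set; every exchange of integrals is carried out on
  \<open>\<beta>\<close>.\<close>

lemma epow_mono: "x \<le> y \<Longrightarrow> 0 \<le> p \<Longrightarrow> epow x p \<le> epow y p"
  unfolding epow_def
  by (auto simp: top_unique enn2real_mono less_top intro!: ennreal_leI powr_mono2)

lemma epow_ennreal: "0 \<le> x \<Longrightarrow> epow (ennreal x) p = ennreal (x powr p)"
  by (simp add: epow_def)

lemma epow_top [simp]: "epow top p = top"
  by (simp add: epow_def)

lemma epow_0 [simp]: "epow 0 p = 0"
  by (simp add: epow_def)

lemma measurable_epow [measurable]:
  "g \<in> borel_measurable M \<Longrightarrow> (\<lambda>x. epow (g x) p) \<in> borel_measurable M"
  unfolding epow_def infinity_ennreal_def by (intro measurable_If) auto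

lemma epow_max: "0 \<le> p \<Longrightarrow> epow (max x y) p \<le> epow x p + epow y p"
  by (cases "x \<le> y") (auto simp: max_def)

lemma epow_cmult:
  assumes "0 < c" "0 \<le> p"
  shows "epow (ennreal c * x) p = ennreal (c powr p) * epow x p"
proof (cases x)
  case (real r)
  then show ?thesis
    using assms by (simp add: epow_ennreal ennreal_mult'' [symmetric] powr_mult flip: ennreal_mult)
next
  case top
  then show ?thesis using assms by (simp add: ennreal_mult_top)
qed

lemma epow_root: "0 < p \<Longrightarrow> epow (epow x (1 / p)) p = x"
  by (cases x) (auto simp: epow_ennreal powr_powr)

text \<open>Each \<open>a k\<close> is at most the \<open>p\<close>-th root of the whole sum, and so
  is the supremum; raising to the power \<open>p\<close> undoes the root. No continuity of
  \<open>epow\<close> is involved, only monotonicity and the inverse exponent.\<close>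

lemma epow_SUP_le:
  fixes a :: "nat \<Rightarrow> ennreal"
  assumes p: "0 < p"
  shows "epow (SUP k. a k) p \<le> (\<Sum>k. epow (a k) p)"
proof -
  have "a k \<le> epow (\<Sum>k. epow (a k) p) (1 / p)" for k
  proof -
    have "a k = epow (epow (a k) p) (1 / p)"
      using epow_root[of "1 / p" "a k"] p by simp
    also have "\<dots> \<le> epow (\<Sum>k. epow (a k) p) (1 / p)"
      using sum_le_suminf[of "\<lambda>k. epow (a k) p" "{k}"] p by (intro epow_mono) auto
    finally show ?thesis .
  qed
  then have "epow (SUP k. a k) p \<le> epow (epow (\<Sum>k. epow (a k) p) (1 / p)) p"
    using p by (intro epow_mono SUP_least) auto
  then show ?thesis using epow_root[OF p] by simp
qed

text \<open>Convexity up to the boundary: if one entry is 0, the claim reduces to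
  \<open>c powr p \<le> c\<close> for a weight \<open>c\<close> in the unit interval.\<close>

lemma convex_powr_nonneg:
  fixes x y :: real
  assumes p: "1 \<le> p" and "0 \<le> x" "0 \<le> y" "0 \<le> l" "l \<le> 1"
  shows "((1 - l) * x + l * y) powr p \<le> (1 - l) * x powr p + l * y powr p"
proof -
  have *: "(c * z) powr p \<le> c * z powr p" if "0 \<le> c" "c \<le> 1" "0 \<le> z" for c z :: real
  proof -
    have "c powr p \<le> c powr 1"
      using that p by (intro powr_mono') auto
    then show ?thesis using that by (cases "c = 0") (simp_all add: powr_mult mult_right_mono)
  qed
  show ?thesis
  proof (cases "x = 0 \<or> y = 0")
    case True
    then show ?thesis using *[of "1 - l" x] *[of l y] assms by auto
  next
    case False
    then show ?thesis
      using convex_onD[OF powr_convex[OF p], of l x y] assms by auto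
  qed
qed

text \<open>Convexity at the points \<open>x / a\<close> and \<open>y / b\<close> with weights
  proportional to \<open>a\<close> and \<open>b\<close>. If \<open>a\<close> and \<open>b\<close>
  bound the norms of two functions, integrating this inequality yields Minkowski's inequality, as in
  \<open>energy_add_le\<close>.\<close>

lemma powr_add_le_weighted:
  fixes x y :: real
  assumes p: "1 \<le> p" and "0 \<le> x" "0 \<le> y" "0 < a" "0 < b"
  shows "(x + y) powr p \<le> (a + b) powr p * (a / (a + b) * (x powr p / a powr p) + b / (a + b) * (y powr p / b powr p))"
proof -
  have e: "x + y = (a + b) * ((1 - b / (a + b)) * (x / a) + b / (a + b) * (y / b))"
  proof -
    have "1 - b / (a + b) = a / (a + b)" using assms by (simp add: field_simps)
    then show ?thesis using assms by (simp add: distrib_left)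
  qed
  have "((1 - b / (a + b)) * (x / a) + b / (a + b) * (y / b)) powr p
      \<le> (1 - b / (a + b)) * (x / a) powr p + b / (a + b) * (y / b) powr p"
    using assms by (intro convex_powr_nonneg) auto
  also have "\<dots> = a / (a + b) * (x powr p / a powr p) + b / (a + b) * (y powr p / b powr p)"
    using assms by (simp add: powr_divide field_simps)
  finally have *: "((1 - b / (a + b)) * (x / a) + b / (a + b) * (y / b)) powr p \<le> \<dots>" .
  have "0 \<le> (1 - b / (a + b)) * (x / a) + b / (a + b) * (y / b)"
    using assms by (auto intro!: add_nonneg_nonneg mult_nonneg_nonneg)
  then have "(x + y) powr p = (a + b) powr p * ((1 - b / (a + b)) * (x / a) + b / (a + b) * (y / b)) powr p"
    using assms by (subst e, subst powr_mult) auto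
  with * show ?thesis using assms by (simp add: mult_left_mono)
qed

lemma epow_add_le_weighted:
  assumes p: "1 \<le> p" and ab: "0 < a" "0 < b"
  shows "epow (x + y) p \<le> ennreal ((a + b) powr p * (a / (a + b)) / a powr p) * epow x p
           + ennreal ((a + b) powr p * (b / (a + b)) / b powr p) * epow y p"
proof (cases "x = top \<or> y = top")
  case True
  have "0 < (a + b) powr p * (a / (a + b)) / a powr p" "0 < (a + b) powr p * (b / (a + b)) / b powr p"
    using ab by auto
  then show ?thesis using True by (auto simp: ennreal_mult_top)
next
  case False
  then obtain r s where rs: "x = ennreal r" "y = ennreal s" "0 \<le> r" "0 \<le> s"
    by (cases x; cases y) auto
  show ?thesis
    using powr_add_le_weighted[OF p rs(3,4) ab] rs ab
    by (simp add: epow_ennreal flip: ennreal_plus ennreal_mult)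
       (auto simp: field_simps intro!: ennreal_leI)
qed

section \<open>Absolutely continuous curves, metric derivatives and line integrals\<close>

lemma ac_curveE:
  assumes "ac_curve U \<gamma>" "0 < e"
  obtains d where "d > 0"
    "\<And>(n::nat) (a::nat \<Rightarrow> real) b. (\<forall>i<n. 0 \<le> a i \<and> a i \<le> b i \<and> b i \<le> 1) \<Longrightarrow>
        (\<forall>i<n. \<forall>j<n. i \<noteq> j \<longrightarrow> b i \<le> a j \<or> b j \<le> a i) \<Longrightarrow>
        (\<Sum>i<n. b i - a i) < d \<Longrightarrow> (\<Sum>i<n. dist (\<gamma> (a i)) (\<gamma> (b i))) < e"
proof -
  from assms(1)[unfolded ac_curve_def, THEN conjunct2, rule_format, OF assms(2)]
  obtain d where "d > 0" and *: "\<forall>(n::nat) (a::nat \<Rightarrow> real) b.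
        (\<forall>i<n. 0 \<le> a i \<and> a i \<le> b i \<and> b i \<le> 1) \<and>
        (\<forall>i<n. \<forall>j<n. i \<noteq> j \<longrightarrow> b i \<le> a j \<or> b j \<le> a i) \<and>
        (\<Sum>i<n. b i - a i) < d \<longrightarrow> (\<Sum>i<n. dist (\<gamma> (a i)) (\<gamma> (b i))) < e"
    by (elim exE conjE)
  then show thesis
    by (intro that[of d] *[rule_format]) (simp_all only: simp_thms conj_assoc)
qed

lemma ac_curve_continuous:
  assumes "ac_curve U \<gamma>"
  shows "continuous_on {0..1} \<gamma>"
  unfolding continuous_on_iff
proof (intro ballI allI impI)
  fix x e :: real assume x: "x \<in> {0..1}" and "0 < e"
  from ac_curveE[OF assms \<open>0 < e\<close>] obtain d where d: "d > 0" and
    H: "\<And>(n::nat) (a::nat \<Rightarrow> real) b. (\<forall>i<n. 0 \<le> a i \<and> a i \<le> b i \<and> b i \<le> 1) \<Longrightarrow>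
        (\<forall>i<n. \<forall>j<n. i \<noteq> j \<longrightarrow> b i \<le> a j \<or> b j \<le> a i) \<Longrightarrow>
        (\<Sum>i<n. b i - a i) < d \<Longrightarrow> (\<Sum>i<n. dist (\<gamma> (a i)) (\<gamma> (b i))) < e"
    by blast
  have "dist (\<gamma> y) (\<gamma> x) < e" if y: "y \<in> {0..1}" "dist y x < d" for y
  proof -
    have "dist (\<gamma> (min x y)) (\<gamma> (max x y)) < e"
      using H[of 1 "\<lambda>_. min x y" "\<lambda>_. max x y"] x y by (auto simp: dist_real_def)
    then show ?thesis by (auto simp: min_def max_def dist_commute split: if_splits)
  qed
  with d show "\<exists>d>0. \<forall>x'\<in>{0..1}. dist x' x < d \<longrightarrow> dist (\<gamma> x') (\<gamma> x) < e" by blast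
qed

text \<open>Turns the infimum over all radii in a \<open>Limsup\<close> into a countable one, which
  preserves measurability.\<close>

lemma INF_positive_eq_INF_nat:
  fixes h :: "real \<Rightarrow> 'b::complete_lattice"
  assumes "\<And>d e. 0 < d \<Longrightarrow> d \<le> e \<Longrightarrow> h d \<le> h e"
  shows "(INF e\<in>{0<..}. h e) = (INF n. h (1 / Suc n))"
proof (rule antisym)
  show "(INF e\<in>{0<..}. h e) \<le> (INF n. h (1 / Suc n))"
    by (rule INF_greatest) (auto intro: INF_lower)
  show "(INF n. h (1 / Suc n)) \<le> (INF e\<in>{0<..}. h e)"
  proof (rule INF_greatest)
    fix e :: real assume "e \<in> {0<..}"
    then obtain n where "1 / Suc n < e" using nat_approx_posE by auto
    then show "(INF n. h (1 / Suc n)) \<le> h e"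
      by (intro INF_lower2[of n] assms) auto
  qed
qed

text \<open>Each difference quotient is continuous in the base point, so the supremum over a
  punctured ball is lower semicontinuous.\<close>

lemma metric_deriv_measurable:
  assumes \<gamma>: "continuous_on {0..1} \<gamma>"
  obtains m where "m \<in> borel_measurable borel" "\<And>t. t \<in> {0..1} \<Longrightarrow> metric_deriv \<gamma> t = m t"
proof -
  \<comment> \<open>Clamping the parameter extends the curve continuously to the whole line, so the
    preimages below are open in the line and not merely in the unit interval.\<close>
  define c where "c t = \<gamma> (max 0 (min 1 t))" for t
  have c: "continuous_on UNIV c"
    unfolding c_def by (rule continuous_on_compose2[OF \<gamma>]) (auto intro!: continuous_intros)
  define h where "h e t = (SUP y\<in>({0..1} \<inter> ball t e - {t}). ennreal (dist (c y) (c t) / \<bar>y - t\<bar>))" for e t :: real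
  have h: "h e \<in> borel_measurable borel" for e
  proof (rule borel_measurableI_greater)
    fix z :: ennreal
    have "open {t\<in>{t. t \<noteq> y \<and> dist t y < e}. ennreal (dist (c y) (c t) / \<bar>y - t\<bar>) \<in> {z<..}}" for y
    proof -
      have o: "open {t. t \<noteq> y \<and> dist t y < e}"
        by (intro open_Collect_conj open_Collect_neq open_Collect_less continuous_intros)
      have "continuous_on {t. t \<noteq> y \<and> dist t y < e} (\<lambda>t. ennreal (dist (c y) (c t) / \<bar>y - t\<bar>))"
        by (intro continuous_on_ennreal continuous_on_divide continuous_intros continuous_on_subset[OF c]) auto
      from continuous_open_preimage[OF this o, of "{z<..}"]
      show ?thesis by (simp add: vimage_def Int_def)
    qed
    then have "open (\<Union>y\<in>{0..1}. {t\<in>{t. t \<noteq> y \<and> dist t y < e}. ennreal (dist (c y) (c t) / \<bar>y - t\<bar>) \<in> {z<..}})"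
      by (intro open_UN) auto
    also have "(\<Union>y\<in>{0..1}. {t\<in>{t. t \<noteq> y \<and> dist t y < e}. ennreal (dist (c y) (c t) / \<bar>y - t\<bar>) \<in> {z<..}})
      = {t \<in> space borel. z < h e t}"
      unfolding h_def by (auto simp: less_SUP_iff)
    finally show "{t \<in> space borel. z < h e t} \<in> sets borel" by auto
  qed
  show thesis
  proof
    show "(\<lambda>t. INF n. h (1 / Suc n) t) \<in> borel_measurable borel"
      using h by measurable
    fix t :: real assume t: "t \<in> {0..1}"
    have "metric_deriv \<gamma> t = (INF e\<in>{0<..}. SUP y\<in>({0..1} \<inter> ball t e - {t}). ennreal (dist (\<gamma> y) (\<gamma> t) / \<bar>y - t\<bar>))"
      unfolding metric_deriv_def Limsup_within ..
    also have "\<dots> = (INF e\<in>{0<..}. h e t)"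
      unfolding h_def using t by (intro INF_cong SUP_cong) (auto simp: c_def)
    also have "\<dots> = (INF n. h (1 / Suc n) t)"
      by (rule INF_positive_eq_INF_nat) (auto simp: h_def intro!: SUP_subset_mono)
    finally show "metric_deriv \<gamma> t = (INF n. h (1 / Suc n) t)" .
  qed
qed

lemma line_integrand_measurable:
  fixes \<rho> :: "'a::metric_space \<Rightarrow> ennreal"
  assumes \<gamma>: "continuous_on {0..1} \<gamma>" and [measurable]: "\<rho> \<in> borel_measurable borel"
    and st: "0 \<le> s" "t \<le> 1"
  shows "(\<lambda>r. \<rho> (\<gamma> r) * metric_deriv \<gamma> r * indicator {s..t} r) \<in> borel_measurable borel"
proof -
  define c where "c t = \<gamma> (max 0 (min 1 t))" for t
  have "continuous_on UNIV c"
    unfolding c_def by (rule continuous_on_compose2[OF \<gamma>]) (auto intro!: continuous_intros)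
  then have [measurable]: "c \<in> borel_measurable borel" by (rule borel_measurable_continuous_onI)
  obtain m where m[measurable]: "m \<in> borel_measurable borel" "\<And>t. t \<in> {0..1} \<Longrightarrow> metric_deriv \<gamma> t = m t"
    using metric_deriv_measurable[OF \<gamma>] by blast
  have "(\<lambda>r. \<rho> (\<gamma> r) * metric_deriv \<gamma> r * indicator {s..t} r) = (\<lambda>r. \<rho> (c r) * m r * indicator {s..t} r)"
    using st by (auto simp: fun_eq_iff c_def m(2) split: split_indicator)
  then show ?thesis by simp
qed

text \<open>The line integral over a parameter subinterval. It is taken against
  \<open>lborel\<close>, where affine substitution of Borel integrands is available; passing to the
  completion does not change a nonnegative integral.\<close>

definition curve_int :: "('a::metric_space \<Rightarrow> ennreal) \<Rightarrow> (real \<Rightarrow> 'a) \<Rightarrow> real \<Rightarrow> real \<Rightarrow> ennreal" where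
  "curve_int \<rho> \<gamma> s t = (\<integral>\<^sup>+ r\<in>{s..t}. \<rho> (\<gamma> r) * metric_deriv \<gamma> r \<partial>lborel)"

lemma line_integral_eq_curve_int: "line_integral \<rho> \<gamma> = curve_int \<rho> \<gamma> 0 1"
  unfolding line_integral_def curve_int_def by (simp add: nn_integral_completion)

lemma curve_int_le_line_integral:
  "0 \<le> s \<Longrightarrow> t \<le> 1 \<Longrightarrow> curve_int \<rho> \<gamma> s t \<le> line_integral \<rho> \<gamma>"
  unfolding line_integral_eq_curve_int curve_int_def
  by (intro nn_integral_mono) (auto split: split_indicator)

lemma line_integral_mono: "(\<And>x. \<rho> x \<le> \<rho>' x) \<Longrightarrow> line_integral \<rho> \<gamma> \<le> line_integral \<rho>' \<gamma>"
  unfolding line_integral_def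
  by (intro nn_integral_mono mult_right_mono) auto

lemma line_integral_cmult:
  assumes \<gamma>: "ac_curve U \<gamma>" and \<rho>: "\<rho> \<in> borel_measurable borel"
  shows "line_integral (\<lambda>x. c * \<rho> x) \<gamma> = c * line_integral \<rho> \<gamma>"
proof -
  have "curve_int (\<lambda>x. c * \<rho> x) \<gamma> 0 1 = (\<integral>\<^sup>+r. c * (\<rho> (\<gamma> r) * metric_deriv \<gamma> r * indicator {0..1} r) \<partial>lborel)"
    unfolding curve_int_def by (simp add: mult.assoc)
  also have "\<dots> = c * curve_int \<rho> \<gamma> 0 1"
    unfolding curve_int_def
    using line_integrand_measurable[OF ac_curve_continuous[OF \<gamma>] \<rho>, of 0 1]
    by (intro nn_integral_cmult) auto
  finally show ?thesis unfolding line_integral_eq_curve_int .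
qed

lemma line_integral_add:
  assumes \<gamma>: "ac_curve U \<gamma>" and \<rho>: "\<rho> \<in> borel_measurable borel" "\<rho>' \<in> borel_measurable borel"
  shows "line_integral (\<lambda>x. \<rho> x + \<rho>' x) \<gamma> = line_integral \<rho> \<gamma> + line_integral \<rho>' \<gamma>"
proof -
  have "curve_int (\<lambda>x. \<rho> x + \<rho>' x) \<gamma> 0 1 = (\<integral>\<^sup>+r. \<rho> (\<gamma> r) * metric_deriv \<gamma> r * indicator {0..1} r
      + \<rho>' (\<gamma> r) * metric_deriv \<gamma> r * indicator {0..1} r \<partial>lborel)"
    unfolding curve_int_def by (simp add: distrib_right)
  also have "\<dots> = curve_int \<rho> \<gamma> 0 1 + curve_int \<rho>' \<gamma> 0 1"
    unfolding curve_int_def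
    using line_integrand_measurable[OF ac_curve_continuous[OF \<gamma>], of _ 0 1] \<rho>
    by (intro nn_integral_add) auto
  finally show ?thesis unfolding line_integral_eq_curve_int .
qed

lemma affine_in_interval:
  fixes s t r :: real
  assumes "s \<le> t" "0 \<le> r" "r \<le> 1"
  shows "s \<le> s + (t - s) * r" "s + (t - s) * r \<le> t"
proof -
  have "(t - s) * r \<le> (t - s) * 1" using assms by (intro mult_left_mono) auto
  then show "s + (t - s) * r \<le> t" by (simp add: algebra_simps)
qed (use assms in auto)

lemma ac_curve_subcurve:
  assumes \<gamma>: "ac_curve U \<gamma>" and st: "0 \<le> s" "s < t" "t \<le> 1"
  shows "ac_curve U (\<lambda>r. \<gamma> (s + (t - s) * r))"
proof -
  have in01: "0 \<le> s + (t - s) * r \<and> s + (t - s) * r \<le> 1" if "0 \<le> r" "r \<le> 1" for r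
    using affine_in_interval[of s t r] that st by linarith
  show ?thesis
    unfolding ac_curve_def
  proof (intro conjI allI impI)
    show "(\<lambda>r. \<gamma> (s + (t - s) * r)) ` {0..1} \<subseteq> U"
      using \<gamma> in01 by (auto simp: ac_curve_def)
    fix e :: real assume "0 < e"
    from ac_curveE[OF \<gamma> \<open>0 < e\<close>] obtain d where d: "d > 0" and
      H: "\<And>(n::nat) (a::nat \<Rightarrow> real) b. (\<forall>i<n. 0 \<le> a i \<and> a i \<le> b i \<and> b i \<le> 1) \<Longrightarrow>
        (\<forall>i<n. \<forall>j<n. i \<noteq> j \<longrightarrow> b i \<le> a j \<or> b j \<le> a i) \<Longrightarrow>
        (\<Sum>i<n. b i - a i) < d \<Longrightarrow> (\<Sum>i<n. dist (\<gamma> (a i)) (\<gamma> (b i))) < e"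
      by blast
    show "\<exists>\<delta>>0. \<forall>(n::nat) (a::nat \<Rightarrow> real) b.
        (\<forall>i<n. 0 \<le> a i \<and> a i \<le> b i \<and> b i \<le> 1) \<and>
        (\<forall>i<n. \<forall>j<n. i \<noteq> j \<longrightarrow> b i \<le> a j \<or> b j \<le> a i) \<and>
        (\<Sum>i<n. b i - a i) < \<delta> \<longrightarrow>
        (\<Sum>i<n. dist (\<gamma> (s + (t - s) * a i)) (\<gamma> (s + (t - s) * b i))) < e"
    proof (intro exI[of _ d] conjI d allI impI)
      fix n :: nat and a b :: "nat \<Rightarrow> real"
      assume A: "(\<forall>i<n. 0 \<le> a i \<and> a i \<le> b i \<and> b i \<le> 1) \<and>
        (\<forall>i<n. \<forall>j<n. i \<noteq> j \<longrightarrow> b i \<le> a j \<or> b j \<le> a i) \<and> (\<Sum>i<n. b i - a i) < d"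
      have "(\<Sum>i<n. (s + (t - s) * b i) - (s + (t - s) * a i)) \<le> (\<Sum>i<n. b i - a i)"
      proof (rule sum_mono)
        fix i assume "i \<in> {..<n}"
        then have "(t - s) * (b i - a i) \<le> 1 * (b i - a i)"
          using A st by (intro mult_right_mono) auto
        then show "(s + (t - s) * b i) - (s + (t - s) * a i) \<le> b i - a i"
          by (simp add: algebra_simps)
      qed
      with A st in01 show "(\<Sum>i<n. dist (\<gamma> (s + (t - s) * a i)) (\<gamma> (s + (t - s) * b i))) < e"
        by (intro H) (auto intro!: mult_left_mono)
    qed
  qed
qed

text \<open>The affine map contracts by \<open>t - s \<le> 1\<close>, so it sends a punctured ball
  into the punctured ball of the same radius around the image, while each difference quotient gains
  the factor \<open>t - s\<close>. Equality may fail at the ends, where the full curve also sees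
  parameters outside \<open>{s..t}\<close>.\<close>

lemma metric_deriv_subcurve_le:
  assumes st: "0 \<le> s" "s < t" "t \<le> 1" and r: "0 \<le> r" "r \<le> 1"
  shows "metric_deriv (\<lambda>r. \<gamma> (s + (t - s) * r)) r \<le> ennreal (t - s) * metric_deriv \<gamma> (s + (t - s) * r)"
proof -
  let ?A = "\<lambda>r. s + (t - s) * r"
  have in01: "0 \<le> ?A r \<and> ?A r \<le> 1" if "0 \<le> r" "r \<le> 1" for r
    using affine_in_interval[of s t r] that st by linarith
  define L where "L = (\<lambda>e. SUP y\<in>({0..1} \<inter> ball (?A r) e - {?A r}). ennreal (dist (\<gamma> y) (\<gamma> (?A r)) / \<bar>y - ?A r\<bar>))"
  have "metric_deriv (\<lambda>r. \<gamma> (?A r)) r \<le> ennreal (t - s) * L e" if e: "0 < e" for e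
  proof -
    have "metric_deriv (\<lambda>r. \<gamma> (?A r)) r
       \<le> (SUP y\<in>({0..1} \<inter> ball r e - {r}). ennreal (dist (\<gamma> (?A y)) (\<gamma> (?A r)) / \<bar>y - r\<bar>))"
      unfolding metric_deriv_def Limsup_within using e by (intro INF_lower) auto
    also have "\<dots> \<le> ennreal (t - s) * L e"
    proof (rule SUP_least)
      fix y assume y: "y \<in> {0..1} \<inter> ball r e - {r}"
      have eq: "\<bar>?A y - ?A r\<bar> = (t - s) * \<bar>y - r\<bar>"
        using st by (simp add: abs_mult flip: right_diff_distrib)
      have "(t - s) * \<bar>y - r\<bar> \<le> 1 * \<bar>y - r\<bar>" using st by (intro mult_right_mono) auto
      moreover have "\<bar>y - r\<bar> < e" using y by (simp add: dist_real_def abs_minus_commute)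
      ultimately have "(t - s) * \<bar>y - r\<bar> < e" by simp
      with eq y have "?A y \<in> {0..1} \<inter> ball (?A r) e - {?A r}"
        using in01[of y] st by (auto simp: dist_real_def abs_minus_commute[of r] abs_minus_commute[of "(t - s) * r"])
      then have "ennreal (dist (\<gamma> (?A y)) (\<gamma> (?A r)) / \<bar>?A y - ?A r\<bar>) \<le> L e"
        unfolding L_def by (rule SUP_upper)
      then have "ennreal (t - s) * ennreal (dist (\<gamma> (?A y)) (\<gamma> (?A r)) / \<bar>?A y - ?A r\<bar>) \<le> ennreal (t - s) * L e"
        by (rule mult_left_mono) simp
      then show "ennreal (dist (\<gamma> (?A y)) (\<gamma> (?A r)) / \<bar>y - r\<bar>) \<le> ennreal (t - s) * L e"
        unfolding eq using st by (simp flip: ennreal_mult)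
    qed
    finally show ?thesis .
  qed
  note * = this
  \<comment> \<open>With the constant moved to the left by its reciprocal, the infimum over
    \<open>e\<close> can be taken without distributing a product over it.\<close>
  have c: "ennreal (1 / (t - s)) * (ennreal (t - s) * z) = z" "ennreal (t - s) * (ennreal (1 / (t - s)) * z) = z" for z
    using st by (simp_all flip: mult.assoc ennreal_mult)
  have "ennreal (1 / (t - s)) * metric_deriv (\<lambda>r. \<gamma> (?A r)) r \<le> L e" if "0 < e" for e
    using mult_left_mono[OF *[OF that], of "ennreal (1 / (t - s))"] unfolding c by simp
  then have "ennreal (1 / (t - s)) * metric_deriv (\<lambda>r. \<gamma> (?A r)) r \<le> (INF e\<in>{0<..}. L e)"
    by (intro INF_greatest) auto
  also have "\<dots> = metric_deriv \<gamma> (?A r)"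
    unfolding metric_deriv_def Limsup_within L_def ..
  finally show ?thesis
    using mult_left_mono[of _ _ "ennreal (t - s)"] c(2) by (metis zero_le)
qed

text \<open>Affine substitution. Its purpose is heredity: a weight with finite integral along a
  curve has finite integral along every subcurve, and a gradient inequality on the subcurve becomes
  one on the parameter interval.\<close>

lemma line_integral_subcurve_le:
  assumes \<gamma>: "ac_curve U \<gamma>" and st: "0 \<le> s" "s < t" "t \<le> 1" and \<rho>: "\<rho> \<in> borel_measurable borel"
  shows "line_integral \<rho> (\<lambda>r. \<gamma> (s + (t - s) * r)) \<le> curve_int \<rho> \<gamma> s t"
proof -
  let ?A = "\<lambda>r. s + (t - s) * r"
  let ?f = "\<lambda>r. \<rho> (\<gamma> r) * metric_deriv \<gamma> r * indicator {s..t} r"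
  have f: "?f \<in> borel_measurable borel"
    using line_integrand_measurable[OF ac_curve_continuous[OF \<gamma>] \<rho>] st by auto
  have "line_integral \<rho> (\<lambda>r. \<gamma> (?A r)) \<le> (\<integral>\<^sup>+ r. ennreal (t - s) * ?f (?A r) \<partial>lborel)"
    unfolding line_integral_eq_curve_int curve_int_def
  proof (rule nn_integral_mono)
    fix r :: real
    show "\<rho> (\<gamma> (?A r)) * metric_deriv (\<lambda>r. \<gamma> (?A r)) r * indicator {0..1} r \<le> ennreal (t - s) * ?f (?A r)"
    proof (cases "r \<in> {0..1}")
      case True
      then have "?A r \<in> {s..t}" using affine_in_interval[of s t r] st by auto
      with True show ?thesis
        using mult_left_mono[OF metric_deriv_subcurve_le[OF st, of r \<gamma>], of "\<rho> (\<gamma> (?A r))"]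
        by (simp add: ac_simps)
    qed auto
  qed
  also have "\<dots> = ennreal (t - s) * (\<integral>\<^sup>+ r. ?f (?A r) \<partial>lborel)"
    using f by (intro nn_integral_cmult) auto
  also have "\<dots> = (\<integral>\<^sup>+ r. ?f r \<partial>lborel)"
    using nn_integral_real_affine[OF f, of "t - s" s] st by auto
  finally show ?thesis unfolding curve_int_def .
qed

section \<open>Weak upper gradients\<close>

text \<open>The trace of an upper gradient along a single curve. The inequality is required on all
  subintervals of \<open>{0..1}\<close>, since only then can two such functions be spliced.\<close>

definition interval_ug :: "(real \<Rightarrow> real) \<Rightarrow> (real \<Rightarrow> ennreal) \<Rightarrow> bool" where
  "interval_ug \<phi> G \<longleftrightarrow> (\<forall>s t. 0 \<le> s \<and> s \<le> t \<and> t \<le> 1 \<longrightarrow>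
     ennreal \<bar>\<phi> t - \<phi> s\<bar> \<le> (\<integral>\<^sup>+ r\<in>{s..t}. G r \<partial>lborel))"

text \<open>The increment is split at \<open>c\<close>, with one gradient used on each side. The
  splitting point is null, so \<open>J\<close> may be open or closed there; both kinds are needed to
  cut out an interval.\<close>

lemma interval_ug_halfline:
  assumes G: "interval_ug \<phi> G" and H: "interval_ug \<phi> H"
    and [measurable]: "G \<in> borel_measurable borel" "H \<in> borel_measurable borel"
    and J: "{c<..} \<subseteq> J" "J \<subseteq> {c..}"
  shows "interval_ug \<phi> (\<lambda>r. if r \<in> J then G r else H r)"
  unfolding interval_ug_def
proof (intro allI impI, elim conjE)
  fix s t :: real assume st: "0 \<le> s" "s \<le> t" "t \<le> 1"
  let ?K = "\<lambda>r. if r \<in> J then G r else H r"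
  \<comment> \<open>The point of \<open>{s..t}\<close> closest to \<open>c\<close>. If
    \<open>c\<close> lies outside, one of the two pieces shrinks to a point.\<close>
  define m where "m = max s (min t c)"
  have m: "s \<le> m" "m \<le> t" using st by (auto simp: m_def)
  have "ennreal \<bar>\<phi> t - \<phi> s\<bar> \<le> ennreal (\<bar>\<phi> m - \<phi> s\<bar> + \<bar>\<phi> t - \<phi> m\<bar>)"
    by (intro ennreal_leI) linarith
  also have "\<dots> = ennreal \<bar>\<phi> m - \<phi> s\<bar> + ennreal \<bar>\<phi> t - \<phi> m\<bar>" by simp
  also have "\<dots> \<le> (\<integral>\<^sup>+ r\<in>{s..m}. H r \<partial>lborel) + (\<integral>\<^sup>+ r\<in>{m..t}. G r \<partial>lborel)"
    using G H m st unfolding interval_ug_def by (intro add_mono) auto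
  also have "\<dots> = (\<integral>\<^sup>+ r. H r * indicator {s..m} r + G r * indicator {m..t} r \<partial>lborel)"
    by (rule nn_integral_add[symmetric]) auto
  also have "\<dots> = (\<integral>\<^sup>+ r\<in>{s..t}. ?K r \<partial>lborel)"
  proof (rule nn_integral_cong_AE)
    have "AE r in lborel. r \<noteq> m" by (rule AE_lborel_singleton)
    then show "AE r in lborel. H r * indicator {s..m} r + G r * indicator {m..t} r = ?K r * indicator {s..t} r"
    proof eventually_elim
      case (elim r)
      consider "r < m" | "r > m" using elim by linarith
      then show ?case
      proof cases
        case 1
        then have "r \<notin> J" if "s \<le> r" using J that by (auto simp: m_def)
        with 1 m show ?thesis by (auto split: split_indicator)
      next
        case 2
        then have "r \<in> J" if "r \<le> t" using J that by (auto simp: m_def)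
        with 2 m show ?thesis by (auto split: split_indicator)
      qed
    qed
  qed
  finally show "ennreal \<bar>\<phi> t - \<phi> s\<bar> \<le> \<dots>" .
qed

lemma interval_ug_open_interval:
  assumes G: "interval_ug \<phi> G" and H: "interval_ug \<phi> H"
    and [measurable]: "G \<in> borel_measurable borel" "H \<in> borel_measurable borel"
  shows "interval_ug \<phi> (\<lambda>r. if r \<in> {c<..<d} then G r else H r)"
proof -
  have "interval_ug \<phi> (\<lambda>r. if r \<in> {d..} then H r else if r \<in> {c<..} then G r else H r)"
    using assms by (intro interval_ug_halfline[where c = d] interval_ug_halfline[where c = c]) auto
  moreover have "(\<lambda>r. if r \<in> {d..} then H r else if r \<in> {c<..} then G r else H r)
      = (\<lambda>r. if r \<in> {c<..<d} then G r else H r)"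
    by auto
  ultimately show ?thesis by simp
qed

text \<open>An open set is a countable union of open intervals. Finitely many are inserted one
  splice at a time; the passage to the full union is dominated convergence with majorant
  \<open>G + H\<close>, which is where the finite integrals enter.\<close>

lemma interval_ug_open:
  assumes G: "interval_ug \<phi> G" and H: "interval_ug \<phi> H"
    and [measurable]: "G \<in> borel_measurable borel" "H \<in> borel_measurable borel"
    and fin: "(\<integral>\<^sup>+ r\<in>{0..1}. G r \<partial>lborel) < \<infinity>" "(\<integral>\<^sup>+ r\<in>{0..1}. H r \<partial>lborel) < \<infinity>"
    and S: "open S"
  shows "interval_ug \<phi> (\<lambda>r. if r \<in> S then G r else H r)"
proof -
  obtain D where D: "countable D" "\<And>X. X \<in> D \<Longrightarrow> \<exists>a b. X = box a b" "\<Union>D = S"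
    using open_countable_Union_open_box[OF S] by metis
  show ?thesis
  proof (cases "D = {}")
    case True
    then show ?thesis using D H by simp
  next
    case False
    define X where "X = from_nat_into D"
    have X: "range X = D" unfolding X_def using False D by (simp add: range_from_nat_into)
    define O' where "O' n = (\<Union>i<n. X i)" for n
    have Xb: "\<exists>a b. X n = {a<..<b}" for n
    proof -
      have "X n \<in> D" using X by auto
      then show ?thesis using D(2) box_real(1) by metis
    qed
    have open_O: "open (O' n)" for n
      unfolding O'_def using Xb by (metis open_UN open_greaterThanLessThan)
    then have [measurable]: "O' n \<in> sets borel" for n by auto
    have [measurable]: "S \<in> sets borel" using S by auto
    let ?K = "\<lambda>n r. if r \<in> O' n then G r else H r"
    have K: "interval_ug \<phi> (?K n)" for n
    proof (induction n)
      case 0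
      then show ?case using H by (simp add: O'_def)
    next
      case (Suc n)
      obtain a b where ab: "X n = {a<..<b}" using Xb by blast
      have "interval_ug \<phi> (\<lambda>r. if r \<in> {a<..<b} then G r else ?K n r)"
        by (intro interval_ug_open_interval G Suc.IH) measurable
      moreover have "(\<lambda>r. if r \<in> {a<..<b} then G r else ?K n r) = ?K (Suc n)"
        by (auto simp: O'_def lessThan_Suc ab)
      ultimately show ?case by simp
    qed
    show ?thesis
      unfolding interval_ug_def
    proof (intro allI impI, elim conjE)
      fix s t :: real assume st: "0 \<le> s" "s \<le> t" "t \<le> 1"
      have "(\<lambda>n. \<integral>\<^sup>+ r. ?K n r * indicator {s..t} r \<partial>lborel)
          \<longlonglongrightarrow> (\<integral>\<^sup>+ r. (if r \<in> S then G r else H r) * indicator {s..t} r \<partial>lborel)"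
      proof (rule nn_integral_dominated_convergence[where w = "\<lambda>r. G r * indicator {0..1} r + H r * indicator {0..1} r"])
        show "AE r in lborel. ?K n r * indicator {s..t} r \<le> G r * indicator {0..1} r + H r * indicator {0..1} r" for n
          using st by (intro always_eventually) (auto split: split_indicator)
        show "(\<integral>\<^sup>+ r. G r * indicator {0..1} r + H r * indicator {0..1} r \<partial>lborel) < \<infinity>"
          using fin by (subst nn_integral_add) auto
        have lim: "(\<lambda>n. ?K n r) \<longlonglongrightarrow> (if r \<in> S then G r else H r)" for r
        proof (cases "r \<in> S")
          case True
          then obtain i where "r \<in> X i" using D X by auto
          then have "r \<in> O' n" if "n \<ge> Suc i" for n
            using that by (auto simp: O'_def intro!: bexI[of _ i])
          then show ?thesis
            using True by (intro tendsto_eventually eventually_sequentiallyI[of "Suc i"]) auto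
        next
          case False
          then have "r \<notin> O' n" for n using D X by (auto simp: O'_def)
          then show ?thesis using False by auto
        qed
        show "AE r in lborel. (\<lambda>n. ?K n r * indicator {s..t} r) \<longlonglongrightarrow> (if r \<in> S then G r else H r) * indicator {s..t} r"
        proof (intro always_eventually allI)
          fix r
          show "(\<lambda>n. ?K n r * indicator {s..t} r) \<longlonglongrightarrow> (if r \<in> S then G r else H r) * indicator {s..t} r"
            using lim[of r] by (cases "r \<in> {s..t}") (simp_all split del: if_split)
        qed
      qed measurable
      then show "ennreal \<bar>\<phi> t - \<phi> s\<bar> \<le> (\<integral>\<^sup>+ r\<in>{s..t}. (if r \<in> S then G r else H r) \<partial>lborel)"
        using K st by (intro LIMSEQ_le_const) (auto simp: interval_ug_def)
    qed
  qed
qed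

text \<open>Outer regularity of \<open>G dr\<close> replaces \<open>{G \<le> H}\<close> by a slightly larger open set.\<close>

lemma interval_ug_min:
  assumes G: "interval_ug \<phi> G" and H: "interval_ug \<phi> H"
    and [measurable]: "G \<in> borel_measurable borel" "H \<in> borel_measurable borel"
    and fin: "(\<integral>\<^sup>+ r\<in>{0..1}. G r \<partial>lborel) < \<infinity>" "(\<integral>\<^sup>+ r\<in>{0..1}. H r \<partial>lborel) < \<infinity>"
  shows "ennreal \<bar>\<phi> 1 - \<phi> 0\<bar> \<le> (\<integral>\<^sup>+ r\<in>{0..1}. min (G r) (H r) \<partial>lborel)"
proof (rule ennreal_le_epsilon)
  fix e :: real assume e: "0 < e"
  define A where "A = {r. G r \<le> H r}"
  have A[measurable]: "A \<in> sets borel" unfolding A_def by measurable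
  define M where "M = density lborel (\<lambda>r. G r * indicator {0..1} r)"
  have M: "emeasure M B = (\<integral>\<^sup>+ r. G r * indicator {0..1} r * indicator B r \<partial>lborel)" if "B \<in> sets borel" for B
    unfolding M_def using that by (subst emeasure_density) auto
  \<comment> \<open>Finiteness of the measure \<open>G dr\<close> on the unit interval is the
    hypothesis under which outer regularity is applied.\<close>
  have sp: "emeasure M (space M) \<noteq> \<infinity>"
    using fin M[of UNIV] by (simp add: M_def space_density)
  have MA: "emeasure M A < \<infinity>"
    using sp emeasure_space[of M A] by (metis infinity_ennreal_def less_top order_le_less_trans)
  have "emeasure M A < emeasure M A + ennreal e"
    using MA e ennreal_add_left_cancel_less[of "emeasure M A" 0 "ennreal e"] by (simp add: ennreal_less_zero_iff)
  then have "(INF S \<in> {S. A \<subseteq> S \<and> open S}. emeasure M S) < emeasure M A + ennreal e"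
    by (subst outer_regular[symmetric, OF _ sp A]) (auto simp: M_def)
  then obtain S where S: "A \<subseteq> S" "open S" "emeasure M S < emeasure M A + ennreal e"
    by (auto simp: INF_less_iff)
  then have [measurable]: "S \<in> sets borel" by auto
  have "ennreal \<bar>\<phi> 1 - \<phi> 0\<bar> \<le> (\<integral>\<^sup>+ r\<in>{0..1}. (if r \<in> S then G r else H r) \<partial>lborel)"
    using interval_ug_open[OF G H _ _ fin S(2)] unfolding interval_ug_def by auto
  also have "\<dots> = (\<integral>\<^sup>+ r. G r * indicator {0..1} r * indicator S r + H r * indicator {0..1} r * indicator (-S) r \<partial>lborel)"
    by (intro nn_integral_cong) (auto split: split_indicator)
  also have "\<dots> = emeasure M S + (\<integral>\<^sup>+ r. H r * indicator {0..1} r * indicator (-S) r \<partial>lborel)"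
    by (subst nn_integral_add) (auto simp: M)
  \<comment> \<open>On \<open>S - A\<close> the larger function \<open>G\<close> is charged, at a
    total cost of at most \<open>e\<close>; the region charged with \<open>H\<close> only grows when
    \<open>-S\<close> is replaced by \<open>-A\<close>.\<close>
  also have "\<dots> \<le> emeasure M A + ennreal e + (\<integral>\<^sup>+ r. H r * indicator {0..1} r * indicator (-A) r \<partial>lborel)"
    using S by (intro add_mono nn_integral_mono) (auto split: split_indicator)
  also have "\<dots> = emeasure M A + (\<integral>\<^sup>+ r. H r * indicator {0..1} r * indicator (-A) r \<partial>lborel) + ennreal e"
    by (simp add: ac_simps)
  also have "emeasure M A + (\<integral>\<^sup>+ r. H r * indicator {0..1} r * indicator (-A) r \<partial>lborel)
     = (\<integral>\<^sup>+ r. G r * indicator {0..1} r * indicator A r + H r * indicator {0..1} r * indicator (-A) r \<partial>lborel)"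
    unfolding M[OF A] by (rule nn_integral_add[symmetric]) auto
  also have "\<dots> = (\<integral>\<^sup>+ r\<in>{0..1}. min (G r) (H r) \<partial>lborel)"
    by (intro nn_integral_cong) (auto simp: A_def min_def split: split_indicator)
  finally show "ennreal \<bar>\<phi> 1 - \<phi> 0\<bar> \<le> (\<integral>\<^sup>+ r\<in>{0..1}. min (G r) (H r) \<partial>lborel) + ennreal e" .
qed

section \<open>Energy, modulus and weights for exceptional curves\<close>

locale borel_domain =
  fixes \<mu> :: "'a::metric_space measure" and U :: "'a set" and p :: real
  assumes sets_eq [measurable_cong, simp]: "sets \<mu> = sets borel"
    and U_borel [measurable]: "U \<in> sets borel"
    and p_ge_1: "1 \<le> p"
begin

lemma p_pos: "0 < p" using p_ge_1 by simp

definition energy :: "('a \<Rightarrow> ennreal) \<Rightarrow> ennreal" where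
  "energy g = (\<integral>\<^sup>+ x\<in>U. epow (g x) p \<partial>\<mu>)"

lemma energy_mono: "(\<And>x. g x \<le> h x) \<Longrightarrow> energy g \<le> energy h"
  unfolding energy_def using p_pos by (intro nn_integral_mono mult_right_mono epow_mono) auto

lemma energy_cmult:
  assumes "0 < c" and [measurable]: "g \<in> borel_measurable borel"
  shows "energy (\<lambda>x. ennreal c * g x) = ennreal (c powr p) * energy g"
  unfolding energy_def using assms p_pos
  by (subst nn_integral_cmult[symmetric]) (auto simp: epow_cmult mult.assoc)

lemma energy_SUP:
  assumes [measurable]: "\<And>k. \<rho> k \<in> borel_measurable borel"
  shows "energy (\<lambda>x. SUP k::nat. \<rho> k x) \<le> (\<Sum>k. energy (\<rho> k))"
proof -
  have "energy (\<lambda>x. SUP k. \<rho> k x) \<le> (\<integral>\<^sup>+ x. (\<Sum>k. epow (\<rho> k x) p * indicator U x) \<partial>\<mu>)"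
    unfolding energy_def
    by (intro nn_integral_mono) (auto intro!: epow_SUP_le p_pos split: split_indicator)
  also have "\<dots> = (\<Sum>k. energy (\<rho> k))"
    unfolding energy_def by (rule nn_integral_suminf) measurable
  finally show ?thesis .
qed

lemma energy_max:
  assumes [measurable]: "g \<in> borel_measurable borel" "h \<in> borel_measurable borel"
  shows "energy (\<lambda>x. max (g x) (h x)) \<le> energy g + energy h"
proof -
  have "energy (\<lambda>x. max (g x) (h x)) \<le> (\<integral>\<^sup>+ x. epow (g x) p * indicator U x + epow (h x) p * indicator U x \<partial>\<mu>)"
    unfolding energy_def using p_pos
    by (intro nn_integral_mono) (auto intro!: epow_max split: split_indicator)
  also have "\<dots> = energy g + energy h"
    unfolding energy_def by (rule nn_integral_add) measurable
  finally show ?thesis .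
qed

text \<open>Minkowski's inequality in terms of strict upper bounds for zero: the coefficients from
  \<open>epow_add_le_weighted\<close> are tuned so that they recombine to
  \<open>(a + b) powr p\<close>. Positivity of \<open>a\<close> and \<open>b\<close> keeps the
  quotients meaningful; vanishing norms are reached later through a small margin.\<close>

lemma energy_add_le:
  assumes [measurable]: "g \<in> borel_measurable borel" "h \<in> borel_measurable borel"
    and ab: "0 < a" "0 < b" and g: "energy g \<le> ennreal (a powr p)" and h: "energy h \<le> ennreal (b powr p)"
  shows "energy (\<lambda>x. g x + h x) \<le> ennreal ((a + b) powr p)"
proof -
  define A where "A = (a + b) powr p * (a / (a + b)) / a powr p"
  define B where "B = (a + b) powr p * (b / (a + b)) / b powr p"
  have AB: "0 \<le> A" "0 \<le> B" using ab by (auto simp: A_def B_def)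
  have "energy (\<lambda>x. g x + h x) \<le> (\<integral>\<^sup>+ x. ennreal A * (epow (g x) p * indicator U x) + ennreal B * (epow (h x) p * indicator U x) \<partial>\<mu>)"
    unfolding energy_def
    using epow_add_le_weighted[OF p_ge_1 ab] unfolding A_def[symmetric] B_def[symmetric]
    by (intro nn_integral_mono) (auto split: split_indicator)
  also have "\<dots> = ennreal A * energy g + ennreal B * energy h"
    unfolding energy_def by (subst nn_integral_add) (auto simp: nn_integral_cmult)
  also have "\<dots> \<le> ennreal A * ennreal (a powr p) + ennreal B * ennreal (b powr p)"
    using g h by (intro add_mono mult_left_mono) auto
  also have "\<dots> = ennreal (A * a powr p + B * b powr p)"
    using AB by (simp add: ennreal_mult)
  also have "A * a powr p + B * b powr p = (a + b) powr p"
  proof -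
    have "A * a powr p + B * b powr p = (a + b) powr p * (a / (a + b)) + (a + b) powr p * (b / (a + b))"
      using ab by (simp add: A_def B_def)
    also have "\<dots> = (a + b) powr p * (a / (a + b) + b / (a + b))" by (simp only: distrib_left)
    also have "a / (a + b) + b / (a + b) = 1" using ab by (simp flip: add_divide_distrib)
    finally show ?thesis by simp
  qed
  finally show ?thesis .
qed

text \<open>Scaling leaves finiteness of a line integral unchanged, so each weight may be shrunk
  until the energies are summable. The supremum then has finite energy and dominates a positive
  multiple of every member.\<close>

lemma common_weight:
  assumes [measurable]: "\<And>k::nat. \<rho> k \<in> borel_measurable borel" and fin: "\<And>k. energy (\<rho> k) < \<infinity>"
  obtains \<sigma> where "\<sigma> \<in> borel_measurable borel" "energy \<sigma> < \<infinity>"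
    "\<And>\<gamma> k. ac_curve U \<gamma> \<Longrightarrow> line_integral \<sigma> \<gamma> < \<infinity> \<Longrightarrow> line_integral (\<rho> k) \<gamma> < \<infinity>"
proof -
  define e where "e k = enn2real (energy (\<rho> k))" for k
  have e: "energy (\<rho> k) = ennreal (e k)" "0 \<le> e k" for k using fin[of k] by (auto simp: e_def)
  \<comment> \<open>Chosen so that \<open>c k powr p * e k \<le> (1/2) ^ Suc k\<close>; the summand
    1 in the denominator covers the case \<open>e k = 0\<close>.\<close>
  define c where "c k = ((1/2) ^ Suc k / (e k + 1)) powr (1 / p)" for k
  have c: "0 < c k" for k using e(2)[of k] by (auto simp: c_def)
  define \<sigma> where "\<sigma> x = (SUP k. ennreal (c k) * \<rho> k x)" for x
  have "energy \<sigma> \<le> (\<Sum>k. energy (\<lambda>x. ennreal (c k) * \<rho> k x))"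
    unfolding \<sigma>_def by (rule energy_SUP) measurable
  also have "\<dots> \<le> (\<Sum>k. ennreal ((1/2) ^ Suc k))"
  proof (intro suminf_le summableI)
    fix k
    have "energy (\<lambda>x. ennreal (c k) * \<rho> k x) = ennreal (c k powr p * e k)"
      using c[of k] by (subst energy_cmult) (auto simp: e ennreal_mult)
    also have "c k powr p * e k = (1/2) ^ Suc k * (e k / (e k + 1))"
      using p_pos e(2)[of k] by (simp add: c_def powr_powr)
    also have "\<dots> \<le> (1/2) ^ Suc k * 1"
      using e(2)[of k] by (intro mult_left_mono) auto
    finally show "energy (\<lambda>x. ennreal (c k) * \<rho> k x) \<le> ennreal ((1/2) ^ Suc k)"
      by (auto intro: ennreal_leI)
  qed
  also have "\<dots> = ennreal 1"
    using power_half_series by (intro suminf_ennreal_eq) auto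
  finally have en: "energy \<sigma> < \<infinity>" by (auto simp: less_top[symmetric] top_unique)
  show thesis
  proof
    show "\<sigma> \<in> borel_measurable borel" unfolding \<sigma>_def by measurable
    show "energy \<sigma> < \<infinity>" by (rule en)
    fix \<gamma> k assume \<gamma>: "ac_curve U \<gamma>" and "line_integral \<sigma> \<gamma> < \<infinity>"
    have "ennreal (c k) * line_integral (\<rho> k) \<gamma> = line_integral (\<lambda>x. ennreal (c k) * \<rho> k x) \<gamma>"
      by (rule line_integral_cmult[OF \<gamma>, symmetric]) measurable
    also have "\<dots> \<le> line_integral \<sigma> \<gamma>"
      unfolding \<sigma>_def by (intro line_integral_mono SUP_upper) auto
    also have "\<dots> < \<infinity>" by fact
    finally show "line_integral (\<rho> k) \<gamma> < \<infinity>"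
      using c[of k] by (auto simp: ennreal_mult_less_top)
  qed
qed

text \<open>If \<open>\<rho> k\<close> is admissible for \<open>\<Gamma>\<close>, then \<open>SUP k. (k + 1) * \<rho> k\<close> has infinite integral along every
  curve of \<open>\<Gamma>\<close>; a supremum, unlike a sum, needs no Minkowski inequality.\<close>

lemma p_modulus_0_weight:
  assumes "p_modulus \<mu> U p \<Gamma> = 0"
  obtains \<rho> where "\<rho> \<in> borel_measurable borel" "energy \<rho> < \<infinity>"
    "\<And>\<gamma>. ac_curve U \<gamma> \<Longrightarrow> \<gamma> \<in> \<Gamma> \<Longrightarrow> line_integral \<rho> \<gamma> = \<infinity>"
proof -
  \<comment> \<open>The divisor \<open>(real k + 1) powr p\<close> pays in advance for the factor
    \<open>k + 1\<close> by which the \<open>k\<close>-th function is multiplied below, and the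
    powers of one half make the energies summable.\<close>
  have "\<exists>\<rho>. \<rho> \<in> borel_measurable borel \<and> (\<forall>\<gamma>\<in>\<Gamma>. 1 \<le> line_integral \<rho> \<gamma>)
      \<and> energy \<rho> < ennreal ((1/2) ^ Suc k / (real k + 1) powr p)" for k
  proof -
    have "0 < (1/2) ^ Suc k / (real k + 1) powr p" by (auto intro!: divide_pos_pos)
    then have "p_modulus \<mu> U p \<Gamma> < ennreal ((1/2) ^ Suc k / (real k + 1) powr p)"
      unfolding assms by (simp only: ennreal_less_zero_iff)
    then show ?thesis unfolding p_modulus_def INF_less_iff energy_def by blast
  qed
  then obtain \<rho> where \<rho>[measurable]: "\<And>k. \<rho> k \<in> borel_measurable borel" and
    adm: "\<And>k \<gamma>. \<gamma> \<in> \<Gamma> \<Longrightarrow> 1 \<le> line_integral (\<rho> k) \<gamma>" and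
    en: "\<And>k. energy (\<rho> k) < ennreal ((1/2) ^ Suc k / (real k + 1) powr p)"
    by metis
  define \<sigma> where "\<sigma> x = (SUP k. ennreal (real k + 1) * \<rho> k x)" for x
  have "energy \<sigma> \<le> (\<Sum>k. energy (\<lambda>x. ennreal (real k + 1) * \<rho> k x))"
    unfolding \<sigma>_def by (rule energy_SUP) measurable
  also have "\<dots> \<le> (\<Sum>k. ennreal ((1/2) ^ Suc k))"
  proof (intro suminf_le summableI)
    fix k :: nat
    have "energy (\<lambda>x. ennreal (real k + 1) * \<rho> k x) = ennreal ((real k + 1) powr p) * energy (\<rho> k)"
      by (rule energy_cmult) auto
    also have "\<dots> \<le> ennreal ((real k + 1) powr p) * ennreal ((1/2) ^ Suc k / (real k + 1) powr p)"
      using en[of k] by (intro mult_left_mono) auto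
    also have "\<dots> = ennreal ((real k + 1) powr p * ((1/2) ^ Suc k / (real k + 1) powr p))"
      by (rule ennreal_mult[symmetric]) auto
    also have "\<dots> = ennreal ((1/2) ^ Suc k)" by simp
    finally show "energy (\<lambda>x. ennreal (real k + 1) * \<rho> k x) \<le> ennreal ((1/2) ^ Suc k)" .
  qed
  also have "\<dots> = ennreal 1"
    using power_half_series by (intro suminf_ennreal_eq) auto
  finally have en: "energy \<sigma> < \<infinity>" by (auto simp: less_top[symmetric] top_unique)
  show thesis
  proof
    show "\<sigma> \<in> borel_measurable borel" unfolding \<sigma>_def by measurable
    show "energy \<sigma> < \<infinity>" by (rule en)
    fix \<gamma> assume \<gamma>: "ac_curve U \<gamma>" "\<gamma> \<in> \<Gamma>"
    have le: "ennreal (real k + 1) \<le> line_integral \<sigma> \<gamma>" for k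
    proof -
      have "ennreal (real k + 1) * 1 \<le> ennreal (real k + 1) * line_integral (\<rho> k) \<gamma>"
        using adm[OF \<gamma>(2)] by (intro mult_left_mono) auto
      also have "\<dots> = line_integral (\<lambda>x. ennreal (real k + 1) * \<rho> k x) \<gamma>"
        by (rule line_integral_cmult[OF \<gamma>(1), symmetric]) measurable
      also have "\<dots> \<le> line_integral \<sigma> \<gamma>"
        unfolding \<sigma>_def by (intro line_integral_mono SUP_upper) auto
      finally show ?thesis by simp
    qed
    show "line_integral \<sigma> \<gamma> = \<infinity>"
    proof (rule ccontr)
      assume "line_integral \<sigma> \<gamma> \<noteq> \<infinity>"
      then obtain r where r: "line_integral \<sigma> \<gamma> = ennreal r" "0 \<le> r"
        by (cases "line_integral \<sigma> \<gamma>") auto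
      obtain k :: nat where "r < real k" using reals_Archimedean2 by blast
      with le[of k] r show False by (simp add: ennreal_le_iff del: ennreal_plus)
    qed
  qed
qed

text \<open>Every positive multiple of \<rho> is admissible, because an infinite integral stays
  infinite, and small multiples have small energy. Together with \<open>p_modulus_0_weight\<close>,
  this makes null families and weights of finite energy interchangeable.\<close>

lemma p_modulus_infinite_line_integral:
  assumes [measurable]: "\<rho> \<in> borel_measurable borel" and en: "energy \<rho> < \<infinity>"
  shows "p_modulus \<mu> U p {\<gamma>. ac_curve U \<gamma> \<and> line_integral \<rho> \<gamma> = \<infinity>} = 0"
proof -
  obtain e where e: "energy \<rho> = ennreal e" "0 \<le> e" using en by (cases "energy \<rho>") auto
  have "p_modulus \<mu> U p {\<gamma>. ac_curve U \<gamma> \<and> line_integral \<rho> \<gamma> = \<infinity>} \<le> ennreal d" if d: "0 < d" for d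
  proof -
    define c where "c = (d / (e + 1)) powr (1 / p)"
    have c: "0 < c" using d e by (auto simp: c_def)
    have "p_modulus \<mu> U p {\<gamma>. ac_curve U \<gamma> \<and> line_integral \<rho> \<gamma> = \<infinity>} \<le> energy (\<lambda>x. ennreal c * \<rho> x)"
      unfolding p_modulus_def energy_def using c
      by (intro INF_lower) (auto simp: line_integral_cmult ennreal_mult_top)
    also have "\<dots> = ennreal (c powr p * e)"
      using c by (subst energy_cmult) (auto simp: e ennreal_mult)
    also have "c powr p * e = d * (e / (e + 1))"
      using p_pos e d by (simp add: c_def powr_powr)
    also have "\<dots> \<le> d * 1" using e d by (intro mult_left_mono) auto
    finally show ?thesis by (auto intro: ennreal_leI)
  qed
  then show ?thesis
    using ennreal_le_epsilon[of 0 "p_modulus \<mu> U p {\<gamma>. ac_curve U \<gamma> \<and> line_integral \<rho> \<gamma> = \<infinity>}"] by auto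
qed

lemma p_weak_ugI:
  assumes "g \<in> borel_measurable borel" "\<rho> \<in> borel_measurable borel" "energy \<rho> < \<infinity>"
    and "\<And>\<gamma>. ac_curve U \<gamma> \<Longrightarrow> line_integral \<rho> \<gamma> < \<infinity> \<Longrightarrow> ennreal \<bar>u (\<gamma> 1) - u (\<gamma> 0)\<bar> \<le> line_integral g \<gamma>"
  shows "p_weak_ug \<mu> U p u g"
  unfolding p_weak_ug_def
proof (intro conjI exI allI impI)
  show "p_modulus \<mu> U p {\<gamma>. ac_curve U \<gamma> \<and> line_integral \<rho> \<gamma> = \<infinity>} = 0"
    using assms by (intro p_modulus_infinite_line_integral)
qed (use assms in \<open>auto simp: less_top\<close>)

text \<open>If the weight is finite along \<gamma>, it is finite along each subcurve, so no subcurve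
  is exceptional. The inequality between the end points of the subcurve is then the inequality on
  \<open>{s..t}\<close>.\<close>

lemma p_weak_ug_weight:
  assumes "p_weak_ug \<mu> U p u g"
  obtains \<rho> where "\<rho> \<in> borel_measurable borel" "energy \<rho> < \<infinity>"
    "\<And>\<gamma> (s::real) t. ac_curve U \<gamma> \<Longrightarrow> line_integral \<rho> \<gamma> < \<infinity> \<Longrightarrow> 0 \<le> s \<Longrightarrow> s \<le> t \<Longrightarrow> t \<le> 1 \<Longrightarrow>
       ennreal \<bar>u (\<gamma> t) - u (\<gamma> s)\<bar> \<le> curve_int g \<gamma> s t"
proof -
  from assms obtain \<Gamma> where g: "g \<in> borel_measurable borel" and \<Gamma>: "p_modulus \<mu> U p \<Gamma> = 0"
    and ug: "\<And>\<gamma>. ac_curve U \<gamma> \<Longrightarrow> \<gamma> \<notin> \<Gamma> \<Longrightarrow> ennreal \<bar>u (\<gamma> 1) - u (\<gamma> 0)\<bar> \<le> line_integral g \<gamma>"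
    unfolding p_weak_ug_def by blast
  obtain \<rho> where \<rho>: "\<rho> \<in> borel_measurable borel" "energy \<rho> < \<infinity>"
    and inf: "\<And>\<gamma>. ac_curve U \<gamma> \<Longrightarrow> \<gamma> \<in> \<Gamma> \<Longrightarrow> line_integral \<rho> \<gamma> = \<infinity>"
    using p_modulus_0_weight[OF \<Gamma>] by blast
  show thesis
  proof (rule that[OF \<rho>])
    fix \<gamma> and s t :: real assume \<gamma>: "ac_curve U \<gamma>" "line_integral \<rho> \<gamma> < \<infinity>" and st: "0 \<le> s" "s \<le> t" "t \<le> 1"
    show "ennreal \<bar>u (\<gamma> t) - u (\<gamma> s)\<bar> \<le> curve_int g \<gamma> s t"
    proof (cases "s = t")
      case False
      then have st': "s < t" using st by auto
      let ?\<sigma> = "\<lambda>r. \<gamma> (s + (t - s) * r)"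
      have \<sigma>: "ac_curve U ?\<sigma>" using ac_curve_subcurve[OF \<gamma>(1)] st st' by auto
      have "line_integral \<rho> ?\<sigma> \<le> line_integral \<rho> \<gamma>"
        using line_integral_subcurve_le[OF \<gamma>(1) st(1) st' st(3) \<rho>(1)]
          curve_int_le_line_integral[OF st(1,3)] by (rule order_trans)
      with \<gamma> inf[OF \<sigma>] have "?\<sigma> \<notin> \<Gamma>" by auto
      from ug[OF \<sigma> this] have "ennreal \<bar>u (\<gamma> t) - u (\<gamma> s)\<bar> \<le> line_integral g ?\<sigma>" by simp
      also have "\<dots> \<le> curve_int g \<gamma> s t"
        by (rule line_integral_subcurve_le[OF \<gamma>(1) st(1) st' st(3) g])
      finally show ?thesis .
    qed auto
  qed
qed

section \<open>Algebraic and order operations on weak upper gradients\<close>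

lemma p_weak_ug_measurable: "p_weak_ug \<mu> U p u g \<Longrightarrow> g \<in> borel_measurable borel"
  by (simp add: p_weak_ug_def)

lemma p_weak_ug_weight':
  assumes "p_weak_ug \<mu> U p u g"
  obtains \<rho> where "\<rho> \<in> borel_measurable borel" "energy \<rho> < \<infinity>"
    "\<And>\<gamma>. ac_curve U \<gamma> \<Longrightarrow> line_integral \<rho> \<gamma> < \<infinity> \<Longrightarrow>
       ennreal \<bar>u (\<gamma> 1) - u (\<gamma> 0)\<bar> \<le> line_integral g \<gamma>"
  using p_weak_ug_weight[OF assms] unfolding line_integral_eq_curve_int
  by (metis order_refl zero_le_one)

lemma p_weak_ug_add:
  assumes g: "p_weak_ug \<mu> U p u g" and h: "p_weak_ug \<mu> U p v h"
  shows "p_weak_ug \<mu> U p (\<lambda>x. u x + v x) (\<lambda>x. g x + h x)"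
proof -
  note [measurable] = p_weak_ug_measurable[OF g] p_weak_ug_measurable[OF h]
  obtain \<rho> where \<rho>[measurable]: "\<rho> \<in> borel_measurable borel" and \<rho>': "energy \<rho> < \<infinity>"
    "\<And>\<gamma>. ac_curve U \<gamma> \<Longrightarrow> line_integral \<rho> \<gamma> < \<infinity> \<Longrightarrow> ennreal \<bar>u (\<gamma> 1) - u (\<gamma> 0)\<bar> \<le> line_integral g \<gamma>"
    using p_weak_ug_weight'[OF g] by metis
  obtain \<sigma> where \<sigma>[measurable]: "\<sigma> \<in> borel_measurable borel" and \<sigma>': "energy \<sigma> < \<infinity>"
    "\<And>\<gamma>. ac_curve U \<gamma> \<Longrightarrow> line_integral \<sigma> \<gamma> < \<infinity> \<Longrightarrow> ennreal \<bar>v (\<gamma> 1) - v (\<gamma> 0)\<bar> \<le> line_integral h \<gamma>"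
    using p_weak_ug_weight'[OF h] by metis
  show ?thesis
  \<comment> \<open>A curve with finite integral of the maximum avoids both exceptional families at
    once.\<close>
  proof (rule p_weak_ugI[where \<rho> = "\<lambda>x. max (\<rho> x) (\<sigma> x)"])
    have "energy (\<lambda>x. max (\<rho> x) (\<sigma> x)) \<le> energy \<rho> + energy \<sigma>" by (rule energy_max) measurable
    also have "\<dots> < \<infinity>" using \<rho>' \<sigma>' by simp
    finally show "energy (\<lambda>x. max (\<rho> x) (\<sigma> x)) < \<infinity>" .
    fix \<gamma> assume \<gamma>: "ac_curve U \<gamma>" and fin: "line_integral (\<lambda>x. max (\<rho> x) (\<sigma> x)) \<gamma> < \<infinity>"
    have "line_integral \<rho> \<gamma> < \<infinity>" "line_integral \<sigma> \<gamma> < \<infinity>"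
      by (rule le_less_trans[OF line_integral_mono fin]; simp)+
    then have "ennreal \<bar>u (\<gamma> 1) - u (\<gamma> 0)\<bar> + ennreal \<bar>v (\<gamma> 1) - v (\<gamma> 0)\<bar> \<le> line_integral g \<gamma> + line_integral h \<gamma>"
      using \<rho>' \<sigma>' \<gamma> by (intro add_mono) auto
    then have "ennreal (\<bar>u (\<gamma> 1) - u (\<gamma> 0)\<bar> + \<bar>v (\<gamma> 1) - v (\<gamma> 0)\<bar>) \<le> line_integral (\<lambda>x. g x + h x) \<gamma>"
      by (subst line_integral_add[OF \<gamma>]) (auto simp: ennreal_plus)
    then show "ennreal \<bar>u (\<gamma> 1) + v (\<gamma> 1) - (u (\<gamma> 0) + v (\<gamma> 0))\<bar> \<le> line_integral (\<lambda>x. g x + h x) \<gamma>"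
      by (rule order_trans[rotated]) (intro ennreal_leI, linarith)
  qed measurable
qed

lemma p_weak_ug_cmult:
  assumes g: "p_weak_ug \<mu> U p u g"
  shows "p_weak_ug \<mu> U p (\<lambda>x. c * u x) (\<lambda>x. ennreal \<bar>c\<bar> * g x)"
proof -
  note [measurable] = p_weak_ug_measurable[OF g]
  obtain \<rho> where \<rho>[measurable]: "\<rho> \<in> borel_measurable borel" and \<rho>': "energy \<rho> < \<infinity>"
    "\<And>\<gamma>. ac_curve U \<gamma> \<Longrightarrow> line_integral \<rho> \<gamma> < \<infinity> \<Longrightarrow> ennreal \<bar>u (\<gamma> 1) - u (\<gamma> 0)\<bar> \<le> line_integral g \<gamma>"
    using p_weak_ug_weight'[OF g] by metis
  show ?thesis
  proof (rule p_weak_ugI[OF _ \<rho> \<rho>'(1)])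
    fix \<gamma> assume \<gamma>: "ac_curve U \<gamma>" "line_integral \<rho> \<gamma> < \<infinity>"
    have "ennreal \<bar>c * u (\<gamma> 1) - c * u (\<gamma> 0)\<bar> = ennreal \<bar>c\<bar> * ennreal \<bar>u (\<gamma> 1) - u (\<gamma> 0)\<bar>"
      by (simp add: ennreal_mult[symmetric] flip: abs_mult right_diff_distrib)
    also have "\<dots> \<le> ennreal \<bar>c\<bar> * line_integral g \<gamma>"
      using \<rho>'(2)[OF \<gamma>] by (rule mult_left_mono) auto
    also have "\<dots> = line_integral (\<lambda>x. ennreal \<bar>c\<bar> * g x) \<gamma>"
      by (rule line_integral_cmult[OF \<gamma>(1), symmetric]) measurable
    finally show "ennreal \<bar>c * u (\<gamma> 1) - c * u (\<gamma> 0)\<bar> \<le> line_integral (\<lambda>x. ennreal \<bar>c\<bar> * g x) \<gamma>" .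
  qed measurable
qed

text \<open>Reduces to one curve and \<open>interval_ug_min\<close>. The gradients \<open>g\<close>
  and \<open>h\<close> are themselves made part of the weight: along the remaining curves their
  integrals are then finite, as the splicing argument demands.\<close>

lemma p_weak_ug_min:
  assumes g: "p_weak_ug \<mu> U p u g" "energy g < \<infinity>" and h: "p_weak_ug \<mu> U p u h" "energy h < \<infinity>"
  shows "p_weak_ug \<mu> U p u (\<lambda>x. min (g x) (h x))"
proof -
  note gh[measurable] = p_weak_ug_measurable[OF g(1)] p_weak_ug_measurable[OF h(1)]
  obtain \<rho> where \<rho>[measurable]: "\<rho> \<in> borel_measurable borel" and \<rho>': "energy \<rho> < \<infinity>"
    "\<And>\<gamma> (s::real) t. ac_curve U \<gamma> \<Longrightarrow> line_integral \<rho> \<gamma> < \<infinity> \<Longrightarrow> 0 \<le> s \<Longrightarrow> s \<le> t \<Longrightarrow> t \<le> 1 \<Longrightarrow>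
       ennreal \<bar>u (\<gamma> t) - u (\<gamma> s)\<bar> \<le> curve_int g \<gamma> s t"
    using p_weak_ug_weight[OF g(1)] by metis
  obtain \<sigma> where \<sigma>[measurable]: "\<sigma> \<in> borel_measurable borel" and \<sigma>': "energy \<sigma> < \<infinity>"
    "\<And>\<gamma> (s::real) t. ac_curve U \<gamma> \<Longrightarrow> line_integral \<sigma> \<gamma> < \<infinity> \<Longrightarrow> 0 \<le> s \<Longrightarrow> s \<le> t \<Longrightarrow> t \<le> 1 \<Longrightarrow>
       ennreal \<bar>u (\<gamma> t) - u (\<gamma> s)\<bar> \<le> curve_int h \<gamma> s t"
    using p_weak_ug_weight[OF h(1)] by metis
  let ?w = "\<lambda>x. max (max (\<rho> x) (\<sigma> x)) (max (g x) (h x))"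
  show ?thesis
  proof (rule p_weak_ugI[where \<rho> = ?w])
    have "energy ?w \<le> energy (\<lambda>x. max (\<rho> x) (\<sigma> x)) + energy (\<lambda>x. max (g x) (h x))" by (rule energy_max) measurable
    also have "\<dots> \<le> (energy \<rho> + energy \<sigma>) + (energy g + energy h)" by (intro add_mono energy_max) measurable
    also have "\<dots> < \<infinity>" using \<rho>' \<sigma>' g h by simp
    finally show "energy ?w < \<infinity>" .
    fix \<gamma> assume \<gamma>: "ac_curve U \<gamma>" and fin: "line_integral ?w \<gamma> < \<infinity>"
    have fin': "line_integral \<rho> \<gamma> < \<infinity>" "line_integral \<sigma> \<gamma> < \<infinity>" "line_integral g \<gamma> < \<infinity>" "line_integral h \<gamma> < \<infinity>"
      by (rule le_less_trans[OF line_integral_mono fin]; simp add: le_max_iff_disj)+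
    \<comment> \<open>The built-in indicator makes the integrands Borel on the whole line without
      changing them on subintervals of \<open>{0..1}\<close>.\<close>
    define G where "G r = g (\<gamma> r) * metric_deriv \<gamma> r * indicator {0..1} r" for r
    define H where "H r = h (\<gamma> r) * metric_deriv \<gamma> r * indicator {0..1} r" for r
    have GH: "G \<in> borel_measurable borel" "H \<in> borel_measurable borel"
      unfolding G_def[abs_def] H_def[abs_def] by (intro line_integrand_measurable[OF ac_curve_continuous[OF \<gamma>]] gh; simp)+
    have eq: "(\<integral>\<^sup>+ r\<in>{s..t}. G r \<partial>lborel) = curve_int g \<gamma> s t" "(\<integral>\<^sup>+ r\<in>{s..t}. H r \<partial>lborel) = curve_int h \<gamma> s t"
      if "0 \<le> s" "t \<le> 1" for s t
      unfolding curve_int_def G_def H_def using that by (auto intro!: nn_integral_cong split: split_indicator)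
    have "ennreal \<bar>u (\<gamma> 1) - u (\<gamma> 0)\<bar> \<le> (\<integral>\<^sup>+ r\<in>{0..1}. min (G r) (H r) \<partial>lborel)"
    proof (rule interval_ug_min[where \<phi> = "\<lambda>r. u (\<gamma> r)"])
      show "interval_ug (\<lambda>r. u (\<gamma> r)) G" "interval_ug (\<lambda>r. u (\<gamma> r)) H"
        unfolding interval_ug_def using \<rho>'(2)[OF \<gamma> fin'(1)] \<sigma>'(2)[OF \<gamma> fin'(2)] by (auto simp: eq)
      show "(\<integral>\<^sup>+ r\<in>{0..1}. G r \<partial>lborel) < \<infinity>" "(\<integral>\<^sup>+ r\<in>{0..1}. H r \<partial>lborel) < \<infinity>"
        using fin' by (auto simp: eq line_integral_eq_curve_int)
    qed fact+
    also have "\<dots> = line_integral (\<lambda>x. min (g x) (h x)) \<gamma>"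
      unfolding line_integral_eq_curve_int curve_int_def G_def H_def
    proof (intro nn_integral_cong)
      fix r :: real
      have "min (a * c) (b * c) = min a b * c" for a b c :: ennreal
        using mult_right_mono[of a b c] mult_right_mono[of b a c] by (cases "a \<le> b") (auto simp: min_def intro: antisym)
      then show "min (g (\<gamma> r) * metric_deriv \<gamma> r * indicator {0..1} r) (h (\<gamma> r) * metric_deriv \<gamma> r * indicator {0..1} r) * indicator {0..1} r
        = min (g (\<gamma> r)) (h (\<gamma> r)) * metric_deriv \<gamma> r * indicator {0..1} r"
        by (auto split: split_indicator)
    qed
    finally show "ennreal \<bar>u (\<gamma> 1) - u (\<gamma> 0)\<bar> \<le> line_integral (\<lambda>x. min (g x) (h x)) \<gamma>" .
  qed measurable
qed

text \<open>Monotone convergence from above along each curve. It needs a finite integral to start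
  from, so every \<open>g k\<close> is joined to its weight, and \<open>common_weight\<close> merges
  the countably many exceptional families.\<close>

lemma p_weak_ug_INF:
  assumes ug: "\<And>k. p_weak_ug \<mu> U p u (g k)" and en: "\<And>k. energy (g k) < \<infinity>" and dec: "\<And>k x. g (Suc k) x \<le> g k x"
  shows "p_weak_ug \<mu> U p u (\<lambda>x. INF k. g k x)"
proof -
  note g[measurable] = p_weak_ug_measurable[OF ug]
  have "\<exists>\<rho>. \<rho> \<in> borel_measurable borel \<and> energy \<rho> < \<infinity> \<and>
      (\<forall>\<gamma>. ac_curve U \<gamma> \<longrightarrow> line_integral \<rho> \<gamma> < \<infinity> \<longrightarrow> ennreal \<bar>u (\<gamma> 1) - u (\<gamma> 0)\<bar> \<le> line_integral (g k) \<gamma>)" for k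
    using p_weak_ug_weight'[OF ug[of k]] by metis
  then obtain \<rho> where \<rho>[measurable]: "\<And>k. \<rho> k \<in> borel_measurable borel" and \<rho>': "\<And>k. energy (\<rho> k) < \<infinity>"
     "\<And>k \<gamma>. ac_curve U \<gamma> \<Longrightarrow> line_integral (\<rho> k) \<gamma> < \<infinity> \<Longrightarrow> ennreal \<bar>u (\<gamma> 1) - u (\<gamma> 0)\<bar> \<le> line_integral (g k) \<gamma>"
    by metis
  have max_fin: "energy (\<lambda>x. max (\<rho> k x) (g k x)) < \<infinity>" for k
  proof -
    have "energy (\<lambda>x. max (\<rho> k x) (g k x)) \<le> energy (\<rho> k) + energy (g k)" by (rule energy_max) measurable
    also have "\<dots> < \<infinity>" using \<rho>' en by simp
    finally show ?thesis .
  qed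
  have max_meas: "(\<lambda>x. max (\<rho> k x) (g k x)) \<in> borel_measurable borel" for k by measurable
  obtain \<sigma> where \<sigma>: "\<sigma> \<in> borel_measurable borel" "energy \<sigma> < \<infinity>"
    and lf: "\<And>\<gamma> k. ac_curve U \<gamma> \<Longrightarrow> line_integral \<sigma> \<gamma> < \<infinity> \<Longrightarrow> line_integral (\<lambda>x. max (\<rho> k x) (g k x)) \<gamma> < \<infinity>"
    using common_weight[of "\<lambda>k x. max (\<rho> k x) (g k x)", OF max_meas max_fin] by blast
  show ?thesis
  proof (rule p_weak_ugI[OF _ \<sigma>])
    fix \<gamma> assume \<gamma>: "ac_curve U \<gamma>" "line_integral \<sigma> \<gamma> < \<infinity>"
    have fin: "line_integral (\<rho> k) \<gamma> < \<infinity>" "line_integral (g k) \<gamma> < \<infinity>" for k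
      by (rule le_less_trans[OF line_integral_mono lf[OF \<gamma>, of k]]; simp)+
    define G where "G k r = g k (\<gamma> r) * metric_deriv \<gamma> r * indicator {0..1} r" for k r
    have G: "G k \<in> borel_measurable lborel" for k
      unfolding G_def[abs_def] using line_integrand_measurable[OF ac_curve_continuous[OF \<gamma>(1)] g[of k], of 0 1] by simp
    have Gi: "(\<integral>\<^sup>+ r. G k r \<partial>lborel) = line_integral (g k) \<gamma>" for k
      unfolding line_integral_eq_curve_int curve_int_def G_def ..
    have decg: "decseq (\<lambda>k. g k x)" for x using dec by (auto intro: decseq_SucI)
    have "(\<lambda>k. \<integral>\<^sup>+ r. G k r \<partial>lborel) \<longlonglongrightarrow> (\<integral>\<^sup>+ r. (INF k. G k r) \<partial>lborel)"
    proof -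
      have "decseq G" using dec by (auto intro!: decseq_SucI le_funI mult_right_mono simp: G_def)
      then have *: "(\<integral>\<^sup>+ r. (INF k. G k r) \<partial>lborel) = (INF k. integral\<^sup>N lborel (G k))"
        using fin by (intro nn_integral_monotone_convergence_INF_decseq[where i = 0] G) (auto simp: Gi)
      have "decseq (\<lambda>k. integral\<^sup>N lborel (G k))"
        using dec by (auto intro!: decseq_SucI nn_integral_mono mult_right_mono simp: G_def)
      then show ?thesis unfolding * by (rule LIMSEQ_INF)
    qed
    then have "ennreal \<bar>u (\<gamma> 1) - u (\<gamma> 0)\<bar> \<le> (\<integral>\<^sup>+ r. (INF k. G k r) \<partial>lborel)"
      using \<rho>'(2)[OF \<gamma>(1) fin(1)] by (intro LIMSEQ_le_const) (auto simp: Gi)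
    also have "\<dots> = line_integral (\<lambda>x. INF k. g k x) \<gamma>"
      unfolding line_integral_eq_curve_int curve_int_def
    proof (rule nn_integral_cong_AE)
      \<comment> \<open>The infimum need not commute with multiplication by an infinite metric
        derivative, since \<open>0 * \<infinity> = 0\<close>. At almost every such parameter,
        however, finiteness of \<open>G 0\<close> forces \<open>g 0\<close> to vanish, and then
        every \<open>g k\<close> vanishes too.\<close>
      have "AE r in lborel. G 0 r \<noteq> \<infinity>"
        using fin(2)[of 0] G by (intro nn_integral_PInf_AE) (auto simp: Gi)
      then show "AE r in lborel. (INF k. G k r) = (INF k. g k (\<gamma> r)) * metric_deriv \<gamma> r * indicator {0..1} r"
      proof eventually_elim
        case (elim r)
        let ?m = "metric_deriv \<gamma> r * indicator {0..1} r"
        have "(INF k. G k r) = ?m * (INF k. g k (\<gamma> r))"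
        proof (cases "?m < top")
          case True
          have "(\<lambda>k. ?m * g k (\<gamma> r)) \<longlonglongrightarrow> ?m * (INF k. g k (\<gamma> r))"
            by (rule ennreal_tendsto_cmult[OF True LIMSEQ_INF[OF decg]])
          moreover have "(\<lambda>k. ?m * g k (\<gamma> r)) \<longlonglongrightarrow> (INF k. ?m * g k (\<gamma> r))"
            using dec by (intro LIMSEQ_INF decseq_SucI mult_left_mono) auto
          ultimately show ?thesis
            by (simp add: LIMSEQ_unique G_def ac_simps)
        next
          case False
          then have m: "?m = top" using top.not_eq_extremum by blast
          have G': "G k r = g k (\<gamma> r) * ?m" for k by (simp add: G_def mult.assoc)
          have g0: "g 0 (\<gamma> r) = 0"
            using elim unfolding G' m by (auto simp: ennreal_mult_top split: if_splits)
          have "g k (\<gamma> r) = 0" for k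
            using decseqD[OF decg, of 0 k "\<gamma> r"] g0 by simp
          then show ?thesis by (simp add: G_def)
        qed
        then show ?case by (simp add: ac_simps)
      qed
    qed
    finally show "ennreal \<bar>u (\<gamma> 1) - u (\<gamma> 0)\<bar> \<le> line_integral (\<lambda>x. INF k. g k x) \<gamma>" .
  qed measurable
qed

end

section \<open>The Dirichlet seminorm\<close>

context borel_domain
begin

definition dirichlet :: "('a \<Rightarrow> real) set" where
  "dirichlet = {u. \<exists>g. p_weak_ug \<mu> U p u g \<and> energy g < \<infinity>}"

text \<open>An infimum instead of the energy of \<open>min_wug\<close>: any weak upper gradient then
  gives an upper bound, with no reference to a chosen minimizer. \<open>energy_min_wug\<close> shows
  that the two agree on \<open>dirichlet\<close>.\<close>

definition min_energy :: "('a \<Rightarrow> real) \<Rightarrow> ennreal" where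
  "min_energy u = (INF g\<in>{g. p_weak_ug \<mu> U p u g}. energy g)"

definition seminorm :: "('a \<Rightarrow> real) \<Rightarrow> real" where
  "seminorm u = enn2real (min_energy u) powr (1 / p)"

lemma dirichletI: "p_weak_ug \<mu> U p u g \<Longrightarrow> energy g \<le> ennreal c \<Longrightarrow> u \<in> dirichlet"
  unfolding dirichlet_def infinity_ennreal_def mem_Collect_eq using le_less_trans[OF _ ennreal_less_top] by blast

lemma min_energy_le: "p_weak_ug \<mu> U p u g \<Longrightarrow> min_energy u \<le> energy g"
  unfolding min_energy_def by (auto intro: INF_lower)

text \<open>The direct method, without weak compactness: running minima turn a minimizing sequence
  into a decreasing sequence of weak upper gradients, whose pointwise infimum is again one and has
  energy below that of every member.\<close>

lemma energy_attained:
  assumes u: "u \<in> dirichlet"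
  obtains g where "p_weak_ug \<mu> U p u g" "energy g = min_energy u"
proof -
  have fin: "min_energy u < \<infinity>"
    using u min_energy_le unfolding dirichlet_def by (auto intro: le_less_trans)
  have "\<exists>h. p_weak_ug \<mu> U p u h \<and> energy h < min_energy u + ennreal (1 / Suc k)" for k :: nat
  proof -
    have "min_energy u < min_energy u + ennreal (1 / Suc k)"
      using fin ennreal_add_left_cancel_less[of "min_energy u" 0 "ennreal (1 / Suc k)"]
      by (simp add: ennreal_less_zero_iff)
    then show ?thesis by (subst (asm) (1) min_energy_def) (auto simp: INF_less_iff)
  qed
  then obtain h where h: "\<And>k. p_weak_ug \<mu> U p u (h k)" and en: "\<And>k. energy (h k) < min_energy u + ennreal (1 / Suc k)"
    by metis
  define g where "g k x = (INF i\<in>{..k::nat}. h i x)" for k x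
  have g_Suc: "g (Suc k) = (\<lambda>x. min (h (Suc k) x) (g k x))" for k
    by (simp add: g_def fun_eq_iff atMost_Suc inf_min)
  have finh: "energy (h k) < \<infinity>" for k
    using en[of k] fin by (auto intro: less_trans simp: less_top[symmetric])
  have g_le: "g k x \<le> h k x" for k x unfolding g_def by (rule INF_lower) auto
  have fing: "energy (g k) < \<infinity>" for k
    by (rule le_less_trans[OF energy_mono finh[of k]]) (rule g_le)
  have ug: "p_weak_ug \<mu> U p u (g k)" for k
  proof (induction k)
    case 0
    have "g 0 = h 0" by (simp add: g_def fun_eq_iff)
    then show ?case using h by simp
  next
    case (Suc k)
    then show ?case unfolding g_Suc using h finh fing by (intro p_weak_ug_min)
  qed
  have inf: "p_weak_ug \<mu> U p u (\<lambda>x. INF k. g k x)"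
    by (rule p_weak_ug_INF[OF ug fing]) (simp add: g_Suc)
  have "energy (\<lambda>x. INF k. g k x) \<le> min_energy u"
  proof (rule ennreal_le_epsilon)
    fix e :: real assume "0 < e"
    then obtain k where k: "1 / Suc k < e" using nat_approx_posE by auto
    have "energy (\<lambda>x. INF k. g k x) \<le> energy (h k)"
      by (intro energy_mono INF_lower2[of k] g_le) auto
    also have "\<dots> \<le> min_energy u + ennreal (1 / Suc k)" using en[of k] by auto
    also have "\<dots> \<le> min_energy u + ennreal e" using k by (intro add_left_mono ennreal_leI) auto
    finally show "energy (\<lambda>x. INF k. g k x) \<le> min_energy u + ennreal e" .
  qed
  with min_energy_le[OF inf] show thesis by (intro that[OF inf] antisym)
qed

text \<open>A minimizer of the energy is minimal pointwise: \<open>min g h\<close> is a competitor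
  below \<open>g\<close>, so it has the same finite energy, and the two integrands agree almost
  everywhere. This gives the choice in \<open>min_wug\<close> its meaning.\<close>

lemma min_wug_exists:
  assumes u: "u \<in> dirichlet"
  shows "is_min_wug \<mu> U p u (min_wug \<mu> U p u)"
proof -
  obtain g where g: "p_weak_ug \<mu> U p u g" "energy g = min_energy u"
    using energy_attained[OF u] .
  have fin: "energy g < \<infinity>"
    using u min_energy_le g unfolding dirichlet_def by (auto intro: le_less_trans)
  have "AE x in \<mu>. x \<in> U \<longrightarrow> g x \<le> h x" if h: "p_weak_ug \<mu> U p u h" "energy h < \<infinity>" for h
  proof -
    note [measurable] = p_weak_ug_measurable[OF g(1)] p_weak_ug_measurable[OF h(1)]
    let ?f = "\<lambda>x. epow (g x) p * indicator U x" and ?m = "\<lambda>x. epow (min (g x) (h x)) p * indicator U x"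
    have le: "?m x \<le> ?f x" for x
      using p_pos by (intro mult_right_mono epow_mono) auto
    have "energy g \<le> energy (\<lambda>x. min (g x) (h x))"
      unfolding g(2) by (intro min_energy_le p_weak_ug_min g h fin)
    with energy_mono[of "\<lambda>x. min (g x) (h x)" g] have eq: "energy (\<lambda>x. min (g x) (h x)) = energy g"
      by (intro antisym) auto
    have "(\<integral>\<^sup>+x. ?f x - ?m x \<partial>\<mu>) = (\<integral>\<^sup>+x. ?f x \<partial>\<mu>) - (\<integral>\<^sup>+x. ?m x \<partial>\<mu>)"
      using fin eq le by (intro nn_integral_diff) (auto simp: energy_def)
    also have "\<dots> = 0" using eq fin unfolding energy_def by simp
    finally have "AE x in \<mu>. ?f x - ?m x = 0"
      by (subst (asm) nn_integral_0_iff_AE) auto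
    moreover have "AE x in \<mu>. ?f x \<noteq> \<infinity>"
      using fin unfolding energy_def by (intro nn_integral_PInf_AE) auto
    ultimately show ?thesis
    proof eventually_elim
      case (elim x)
      show ?case
      proof
        assume x: "x \<in> U"
        with elim have "epow (g x) p \<le> epow (min (g x) (h x)) p"
          by (auto simp: diff_eq_0_iff_ennreal)
        then have "epow (epow (g x) p) (1 / p) \<le> epow (epow (min (g x) (h x)) p) (1 / p)"
          by (rule epow_mono) (use p_pos in simp)
        then have "g x \<le> min (g x) (h x)"
          using epow_root[of "1 / p"] p_pos by simp
        then show "g x \<le> h x" by simp
      qed
    qed
  qed
  then have "is_min_wug \<mu> U p u g"
    using g fin unfolding is_min_wug_def energy_def by auto
  then show ?thesis unfolding min_wug_def by (metis someI)
qed

lemma energy_min_wug: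
  assumes u: "u \<in> dirichlet"
  shows "energy (min_wug \<mu> U p u) = min_energy u"
proof -
  from min_wug_exists[OF u] have m: "p_weak_ug \<mu> U p u (min_wug \<mu> U p u)"
    and le: "\<And>h. p_weak_ug \<mu> U p u h \<Longrightarrow> energy h < \<infinity> \<Longrightarrow> AE x in \<mu>. x \<in> U \<longrightarrow> min_wug \<mu> U p u x \<le> h x"
    unfolding is_min_wug_def energy_def by auto
  obtain g where g: "p_weak_ug \<mu> U p u g" "energy g = min_energy u"
    using energy_attained[OF u] .
  have fin: "energy g < \<infinity>"
    using u min_energy_le g unfolding dirichlet_def by (auto intro: le_less_trans)
  have "energy (min_wug \<mu> U p u) \<le> energy g"
    unfolding energy_def
  proof (rule nn_integral_mono_AE, use le[OF g(1) fin] in eventually_elim)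
    fix x assume "x \<in> U \<longrightarrow> min_wug \<mu> U p u x \<le> g x"
    then show "epow (min_wug \<mu> U p u x) p * indicator U x \<le> epow (g x) p * indicator U x"
      using p_pos by (auto split: split_indicator intro: epow_mono)
  qed
  with min_energy_le[OF m] g show ?thesis by (intro antisym) auto
qed

lemma seminorm_powr:
  assumes u: "u \<in> dirichlet"
  shows "ennreal (seminorm u powr p) = min_energy u"
proof -
  have "min_energy u < \<infinity>"
    using u min_energy_le unfolding dirichlet_def by (auto intro: le_less_trans)
  then show ?thesis unfolding seminorm_def using p_pos by (simp add: powr_powr less_top)
qed

lemma seminorm_nonneg: "0 \<le> seminorm u"
  by (simp add: seminorm_def)

lemma seminorm_leI:
  assumes "p_weak_ug \<mu> U p u g" "energy g \<le> ennreal (c powr p)" "0 \<le> c"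
  shows "seminorm u \<le> c"
proof -
  have "enn2real (min_energy u) \<le> c powr p"
    using min_energy_le[OF assms(1)] assms(2) by (intro enn2real_leI) auto
  then have "seminorm u \<le> (c powr p) powr (1 / p)"
    unfolding seminorm_def using p_pos by (intro powr_mono2) auto
  then show ?thesis using assms p_pos by (simp add: powr_powr)
qed

lemma dirichlet_wug:
  assumes u: "u \<in> dirichlet"
  obtains g where "p_weak_ug \<mu> U p u g" "energy g = ennreal (seminorm u powr p)" "g \<in> borel_measurable borel"
  using energy_attained[OF u] seminorm_powr[OF u] p_weak_ug_measurable by metis

lemma
  assumes u: "u \<in> dirichlet" and v: "v \<in> dirichlet"
  shows dirichlet_add: "(\<lambda>x. u x + v x) \<in> dirichlet"
    and seminorm_add: "seminorm (\<lambda>x. u x + v x) \<le> seminorm u + seminorm v"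
proof -
  obtain g where g: "p_weak_ug \<mu> U p u g" "energy g = ennreal (seminorm u powr p)" "g \<in> borel_measurable borel"
    using dirichlet_wug[OF u] .
  obtain h where h: "p_weak_ug \<mu> U p v h" "energy h = ennreal (seminorm v powr p)" "h \<in> borel_measurable borel"
    using dirichlet_wug[OF v] .
  \<comment> \<open>\<open>energy_add_le\<close> asks for positive bounds, so each seminorm is
    enlarged by \<open>e / 2\<close> in case it vanishes; the margin is removed at the end by
    letting \<open>e\<close> tend to 0.\<close>
  have le: "energy (\<lambda>x. g x + h x) \<le> ennreal ((seminorm u + seminorm v + e) powr p)" if "0 < e" for e
  proof -
    have "energy (\<lambda>x. g x + h x) \<le> ennreal (((seminorm u + e / 2) + (seminorm v + e / 2)) powr p)"
      using that seminorm_nonneg[of u] seminorm_nonneg[of v] p_pos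
      by (intro energy_add_le g(3) h(3)) (auto simp: g(2) h(2) intro!: ennreal_leI powr_mono2)
    then show ?thesis by (simp add: algebra_simps)
  qed
  have ug: "p_weak_ug \<mu> U p (\<lambda>x. u x + v x) (\<lambda>x. g x + h x)"
    by (rule p_weak_ug_add[OF g(1) h(1)])
  show "(\<lambda>x. u x + v x) \<in> dirichlet"
    using dirichletI[OF ug le[of 1]] by simp
  show "seminorm (\<lambda>x. u x + v x) \<le> seminorm u + seminorm v"
  proof (rule field_le_epsilon)
    fix e :: real assume "0 < e"
    then show "seminorm (\<lambda>x. u x + v x) \<le> seminorm u + seminorm v + e"
      using seminorm_nonneg[of u] seminorm_nonneg[of v] by (intro seminorm_leI[OF ug le]) auto
  qed
qed

lemma
  assumes u: "u \<in> dirichlet"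
  shows dirichlet_cmult: "(\<lambda>x. c * u x) \<in> dirichlet"
    and seminorm_cmult: "seminorm (\<lambda>x. c * u x) \<le> \<bar>c\<bar> * seminorm u"
proof -
  obtain g where g: "p_weak_ug \<mu> U p u g" "energy g = ennreal (seminorm u powr p)" "g \<in> borel_measurable borel"
    using dirichlet_wug[OF u] .
  have ug: "p_weak_ug \<mu> U p (\<lambda>x. c * u x) (\<lambda>x. ennreal \<bar>c\<bar> * g x)"
    by (rule p_weak_ug_cmult[OF g(1)])
  have en: "energy (\<lambda>x. ennreal \<bar>c\<bar> * g x) \<le> ennreal ((\<bar>c\<bar> * seminorm u) powr p)"
  proof (cases "c = 0")
    case True
    then show ?thesis by (simp add: energy_def)
  next
    case False
    then have "energy (\<lambda>x. ennreal \<bar>c\<bar> * g x) = ennreal (\<bar>c\<bar> powr p) * ennreal (seminorm u powr p)"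
      using g by (subst energy_cmult) auto
    then show ?thesis using seminorm_nonneg[of u] by (simp add: powr_mult flip: ennreal_mult)
  qed
  show "(\<lambda>x. c * u x) \<in> dirichlet"
    using dirichletI[OF ug en] .
  show "seminorm (\<lambda>x. c * u x) \<le> \<bar>c\<bar> * seminorm u"
    using seminorm_nonneg[of u] by (intro seminorm_leI[OF ug en]) auto
qed

lemma dirichlet_0: "(\<lambda>x. 0) \<in> dirichlet"
proof -
  have "p_weak_ug \<mu> U p (\<lambda>x. 0) (\<lambda>x. 0)"
    by (rule p_weak_ugI[where \<rho> = "\<lambda>x. 0"]) (auto simp: energy_def)
  then show ?thesis unfolding dirichlet_def by (auto simp: energy_def intro!: exI[of _ "\<lambda>x. 0"])
qed

lemma in_N1p_dirichlet: "in_N1p \<mu> U p u \<Longrightarrow> u \<in> dirichlet"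
  unfolding in_N1p_def dirichlet_def energy_def by auto

lemma integral_min_wug:
  assumes "u \<in> dirichlet"
  shows "(\<integral>\<^sup>+ x\<in>U. epow (min_wug \<mu> U p u x) p \<partial>\<mu>) = ennreal (seminorm u powr p)"
  using energy_min_wug[OF assms] seminorm_powr[OF assms] unfolding energy_def by simp

lemma seminorm_le_N1p_norm:
  assumes "u \<in> dirichlet"
  shows "ennreal (seminorm u) \<le> N1p_norm \<mu> U p u"
proof -
  have "ennreal (seminorm u) = epow (ennreal (seminorm u powr p)) (1 / p)"
    using seminorm_nonneg[of u] p_pos by (simp add: epow_ennreal powr_powr)
  also have "\<dots> \<le> N1p_norm \<mu> U p u"
    unfolding N1p_norm_def integral_min_wug[OF assms] using p_pos by (intro epow_mono) auto
  finally show ?thesis .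
qed

end

section \<open>Seminorm-valued Bochner integration\<close>

text \<open>The tangent to \<open>y powr p\<close> at the point \<open>x\<close> lies below the
  graph. It comes from Young's inequality for \<open>y powr p\<close> and \<open>x powr p\<close>
  with weights \<open>1 / p\<close> and \<open>1 - 1 / p\<close>.\<close>

lemma Young_tangent_powr:
  fixes x y :: real
  assumes p: "1 \<le> p" and "0 \<le> x" "0 \<le> y"
  shows "p * x powr (p - 1) * y \<le> y powr p + (p - 1) * x powr p"
proof (cases "x = 0 \<or> y = 0")
  \<comment> \<open>At \<open>x = 0\<close> the left side vanishes even for \<open>p = 1\<close>,
    because \<open>0 powr 0 = 0\<close>.\<close>
  case True
  then show ?thesis using assms by auto
next
  case False
  then have "(y powr p) powr (1 / p) * (x powr p) powr (1 - 1 / p) \<le> 1 / p * y powr p + (1 - 1 / p) * x powr p"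
    using assms by (intro Youngs_inequality_0) auto
  moreover have "(y powr p) powr (1 / p) * (x powr p) powr (1 - 1 / p) = y * x powr (p - 1)"
    using False assms by (simp add: powr_powr right_diff_distrib)
  ultimately have "p * (y * x powr (p - 1)) \<le> p * (1 / p * y powr p + (1 - 1 / p) * x powr p)"
    using p by (intro mult_left_mono) auto
  also have "\<dots> = y powr p + (p - 1) * x powr p" using p by (simp add: field_simps)
  finally show ?thesis by (simp add: ac_simps)
qed

text \<open>Integrates the tangent line of \<open>x powr p\<close> at \<open>X\<close>, so the right-hand side of the hypothesis
  may be infinite.\<close>

lemma powr_nn_integral_le:
  assumes p: "1 \<le> p" and [measurable]: "k \<in> borel_measurable M" "b \<in> borel_measurable M"
    and k: "\<And>s. 0 \<le> k s" "(\<integral>\<^sup>+ s. ennreal (k s) \<partial>M) = 1" and b: "\<And>s. 0 \<le> b s"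
    and X: "0 \<le> X" "ennreal X \<le> (\<integral>\<^sup>+ s. ennreal (k s * b s) \<partial>M)"
  shows "ennreal (X powr p) \<le> (\<integral>\<^sup>+ s. ennreal (k s * b s powr p) \<partial>M)"
proof -
  define A where "A = p * X powr (p - 1)"
  define B where "B = (p - 1) * X powr p"
  have AB: "0 \<le> A" "0 \<le> B" using p by (auto simp: A_def B_def)
  \<comment> \<open>Integrating the tangent inequality against the unit mass \<open>k\<close> adds
    \<open>B\<close> on the right. By this identity the left side is \<open>X powr p + B\<close>,
    and the finite \<open>B\<close> cancels.\<close>
  have AX: "A * X = X powr p + B"
  proof (cases "X = 0")
    case False
    then have "X powr (p - 1) * X = X powr p"
      using X powr_add[of X "p - 1" 1] by simp
    then show ?thesis by (simp add: A_def B_def algebra_simps)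
  qed (auto simp: A_def B_def)
  have "ennreal (X powr p) + ennreal B = ennreal A * ennreal X"
    using AX AB X by (simp flip: ennreal_plus ennreal_mult)
  also have "\<dots> \<le> ennreal A * (\<integral>\<^sup>+ s. ennreal (k s * b s) \<partial>M)"
    using X by (intro mult_left_mono) auto
  also have "\<dots> = (\<integral>\<^sup>+ s. ennreal (A * (k s * b s)) \<partial>M)"
    using AB k b by (subst nn_integral_cmult[symmetric]) (auto simp: ennreal_mult)
  also have "\<dots> \<le> (\<integral>\<^sup>+ s. ennreal (k s * b s powr p) + ennreal B * ennreal (k s) \<partial>M)"
  proof (rule nn_integral_mono)
    fix s
    have "A * (k s * b s) \<le> k s * (b s powr p + B)"
      using mult_left_mono[OF Young_tangent_powr[OF p X(1) b[of s]] k(1)[of s]] by (simp add: A_def B_def ac_simps)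
    then have "ennreal (A * (k s * b s)) \<le> ennreal (k s * b s powr p + B * k s)"
      by (intro ennreal_leI) (simp add: algebra_simps)
    then show "ennreal (A * (k s * b s)) \<le> ennreal (k s * b s powr p) + ennreal B * ennreal (k s)"
      using AB k b by (simp add: ennreal_mult)
  qed
  also have "\<dots> = (\<integral>\<^sup>+ s. ennreal (k s * b s powr p) \<partial>M) + ennreal B"
    using k by (subst nn_integral_add) (auto simp: nn_integral_cmult)
  finally show ?thesis
    by (subst (asm) (1 2) add.commute) (simp add: ennreal_add_left_cancel_le)
qed

section \<open>Translations on the real line and Borel representatives\<close>

lemma lborel_null_reflect_translate:
  assumes Z: "Z \<in> null_sets lborel"
  shows "AE s in lborel. (t::real) - s \<notin> Z" "AE t in lborel. t - (s::real) \<notin> Z"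
proof -
  have [measurable]: "Z \<in> sets borel" using Z by auto
  have "AE x in lborel. x \<notin> Z" using Z by (rule AE_not_in)
  from AE_borel_affine[OF _ _ this, of "-1" t] AE_borel_affine[OF _ _ this, of 1 "-s"]
  show "AE s in lborel. t - s \<notin> Z" "AE t in lborel. t - s \<notin> Z" by (auto simp: algebra_simps)
qed

lemma nn_integral_lborel_translate:
  fixes f :: "real \<Rightarrow> ennreal"
  assumes "f \<in> borel_measurable borel"
  shows "(\<integral>\<^sup>+ t. f (t - s) \<partial>lborel) = (\<integral>\<^sup>+ t. f t \<partial>lborel)"
  using nn_integral_real_affine[OF assms, of 1 "-s"] by simp

text \<open>Squeeze \<open>B\<close> between a compact \<open>K\<close> and an open
  \<open>S\<close>. A shift shorter than the distance from \<open>K\<close> to the complement of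
  \<open>S\<close> can change membership in \<open>B\<close> only if \<open>t\<close> or
  \<open>t - s\<close> lies in \<open>S - K\<close>.\<close>

lemma indicator_translation_continuous:
  fixes B :: "real set"
  assumes B: "B \<in> sets borel" "bounded B" and e: "0 < e"
  obtains d where "0 < d"
    "\<And>s. \<bar>s\<bar> < d \<Longrightarrow> (\<integral>\<^sup>+ t. ennreal \<bar>indicat_real B (t - s) - indicat_real B t\<bar> \<partial>lborel) \<le> ennreal e"
proof -
  have Bl: "B \<in> sets lebesgue" using B by auto
  \<comment> \<open>A quarter for each of the inner and outer errors; their sum is counted twice, at
    \<open>t\<close> and at \<open>t - s\<close>.\<close>
  obtain S where S: "open S" "B \<subseteq> S" "S - B \<in> lmeasurable" "emeasure lebesgue (S - B) < ennreal (e / 4)"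
    using sets_lebesgue_outer_open[OF Bl, of "e / 4"] e by auto
  obtain K where K: "closed K" "K \<subseteq> B" "B - K \<in> lmeasurable" "emeasure lebesgue (B - K) < ennreal (e / 4)"
    using sets_lebesgue_inner_closed[OF Bl, of "e / 4"] e by auto
  have "compact K" using K B bounded_subset by (auto simp: compact_eq_bounded_closed)
  then obtain d where d: "0 < d" "\<And>x y. x \<in> K \<Longrightarrow> y \<in> - S \<Longrightarrow> d \<le> dist x y"
    using separate_compact_closed[of K "-S"] S K by blast
  define W where "W = S - K"
  have W[measurable]: "W \<in> sets borel" unfolding W_def using S K by auto
  have "emeasure lborel W = emeasure lebesgue W" by simp
  also have "\<dots> = emeasure lebesgue ((S - B) \<union> (B - K))"
    using S K by (intro arg_cong[where f = "emeasure lebesgue"]) (auto simp: W_def)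
  also have "\<dots> \<le> emeasure lebesgue (S - B) + emeasure lebesgue (B - K)"
    using S K by (intro emeasure_subadditive) auto
  also have "\<dots> \<le> ennreal (e / 4) + ennreal (e / 4)" using S K by (intro add_mono) auto
  also have "\<dots> = ennreal (e / 2)" using e by (simp flip: ennreal_plus)
  finally have Wm: "emeasure lborel W \<le> ennreal (e / 2)" .
  show thesis
  proof (rule that[OF d(1)])
    fix s :: real assume s: "\<bar>s\<bar> < d"
    have near: "y \<in> S" if "x \<in> K" "\<bar>x - y\<bar> < d" for x y
      using d(2)[of x y] that by (force simp: dist_real_def)
    have "(\<integral>\<^sup>+ t. ennreal \<bar>indicat_real B (t - s) - indicat_real B t\<bar> \<partial>lborel)
       \<le> (\<integral>\<^sup>+ t. indicator W (t - s) + indicator W t \<partial>lborel)"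
    proof (rule nn_integral_mono)
      fix t
      have "t - s \<in> W \<or> t \<in> W" if "t \<in> B \<and> t - s \<notin> B \<or> t \<notin> B \<and> t - s \<in> B"
        using that near[of t "t - s"] near[of "t - s" t] s S K unfolding W_def by auto
      then show "ennreal \<bar>indicat_real B (t - s) - indicat_real B t\<bar> \<le> indicator W (t - s) + indicator W t"
        by (auto split: split_indicator)
    qed
    also have "\<dots> = emeasure lborel W + emeasure lborel W"
      using nn_integral_lborel_translate[of "indicator W" s]
      by (subst nn_integral_add) auto
    also have "\<dots> \<le> ennreal (e / 2) + ennreal (e / 2)" using Wm by (intro add_mono)
    also have "\<dots> = ennreal e" using e by (simp flip: ennreal_plus)
    finally show "(\<integral>\<^sup>+ t. ennreal \<bar>indicat_real B (t - s) - indicat_real B t\<bar> \<partial>lborel) \<le> ennreal e" .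
  qed
qed

text \<open>Every summand is at most the largest one. The crude constant is harmless, since it is
  absorbed when the accuracy is chosen in \<open>translation_bound\<close>.\<close>

lemma powr_sum_le:
  fixes a :: "'i \<Rightarrow> real"
  assumes "finite I" "\<And>i. i \<in> I \<Longrightarrow> 0 \<le> a i" and p: "0 < p"
  shows "(\<Sum>i\<in>I. a i) powr p \<le> real (card I) powr p * (\<Sum>i\<in>I. a i powr p)"
proof (cases "I = {}")
  case False
  define m where "m = Max (a ` I)"
  have m: "\<And>i. i \<in> I \<Longrightarrow> a i \<le> m" "m \<in> a ` I" using False assms by (auto simp: m_def)
  then obtain j where j: "j \<in> I" "m = a j" by auto
  have "(\<Sum>i\<in>I. a i) powr p \<le> (real (card I) * m) powr p"
    using assms m sum_bounded_above[of I a m] by (intro powr_mono2 sum_nonneg) auto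
  also have "\<dots> = real (card I) powr p * a j powr p"
    using assms j by (simp add: powr_mult)
  also have "\<dots> \<le> real (card I) powr p * (\<Sum>i\<in>I. a i powr p)"
    using assms j by (intro mult_left_mono member_le_sum) auto
  finally show ?thesis .
qed (use p in auto)

text \<open>Borel sets are wanted because the indicator of \<open>B\<close> at \<open>t - s\<close>
  has to be Borel measurable jointly in \<open>(t, s)\<close>.\<close>

lemma lebesgue_set_borel_version:
  fixes A :: "real set"
  assumes A: "A \<in> sets lebesgue"
  obtains B where "B \<in> sets borel" "AE x in lborel. x \<in> A \<longleftrightarrow> x \<in> B"
proof -
  have "(indicat_real A) \<in> borel_measurable lebesgue" using A by simp
  then obtain g where g[measurable]: "g \<in> borel_measurable lborel" and eq: "AE x in lborel. indicat_real A x = g x"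
    using completion_ex_borel_measurable_real by blast
  have "{x \<in> space lborel. g x = 1} \<in> sets lborel" by measurable
  then have "{x. g x = 1} \<in> sets borel" by simp
  moreover have "AE x in lborel. x \<in> A \<longleftrightarrow> x \<in> {x. g x = 1}"
    using eq by eventually_elim (auto simp: indicator_def split: if_splits)
  ultimately show thesis by (rule that)
qed

text \<open>Isolates what the argument in time uses of the Dirichlet seminorm. One inequality for
  multiples is enough: applied to the factor -1 in both directions, it gives the symmetry in
  \<open>Q_minus_commute\<close>.\<close>

locale function_seminorm =
  fixes D :: "('a \<Rightarrow> real) set" and Q :: "('a \<Rightarrow> real) \<Rightarrow> real"
  assumes D_zero: "(\<lambda>x. 0) \<in> D"
    and D_add: "u \<in> D \<Longrightarrow> v \<in> D \<Longrightarrow> (\<lambda>x. u x + v x) \<in> D"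
    and D_cmult: "u \<in> D \<Longrightarrow> (\<lambda>x. c * u x) \<in> D"
    and Q_nonneg: "0 \<le> Q u"
    and Q_add: "u \<in> D \<Longrightarrow> v \<in> D \<Longrightarrow> Q (\<lambda>x. u x + v x) \<le> Q u + Q v"
    and Q_cmult: "u \<in> D \<Longrightarrow> Q (\<lambda>x. c * u x) \<le> \<bar>c\<bar> * Q u"
begin

lemma D_diff: "u \<in> D \<Longrightarrow> v \<in> D \<Longrightarrow> (\<lambda>x. u x - v x) \<in> D"
  using D_add[of u "\<lambda>x. -1 * v x"] D_cmult[of v "-1"] by simp

lemma Q_minus_commute: "u \<in> D \<Longrightarrow> v \<in> D \<Longrightarrow> Q (\<lambda>x. u x - v x) = Q (\<lambda>x. v x - u x)"
  using Q_cmult[OF D_diff, of u v "-1"] Q_cmult[OF D_diff, of v u "-1"] by simp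

lemma Q_triangle:
  "u \<in> D \<Longrightarrow> v \<in> D \<Longrightarrow> w \<in> D \<Longrightarrow> Q (\<lambda>x. u x - w x) \<le> Q (\<lambda>x. u x - v x) + Q (\<lambda>x. v x - w x)"
  using Q_add[OF D_diff D_diff, of u v v w] by simp

lemma Q_zero: "Q (\<lambda>x. 0) = 0"
  using Q_cmult[OF D_zero, of 0] Q_nonneg[of "\<lambda>x. 0"] by simp

lemma D_sum: "finite I \<Longrightarrow> (\<And>i. i \<in> I \<Longrightarrow> V i \<in> D) \<Longrightarrow> (\<lambda>x. \<Sum>i\<in>I. c i * V i x) \<in> D"
proof (induction I rule: finite_induct)
  case (insert j I)
  then have "(\<lambda>x. c j * V j x + (\<Sum>i\<in>I. c i * V i x)) \<in> D"
    by (intro D_add D_cmult) auto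
  then show ?case using insert by simp
qed (simp add: D_zero)

lemma Q_sum:
  "finite I \<Longrightarrow> (\<And>i. i \<in> I \<Longrightarrow> V i \<in> D) \<Longrightarrow> Q (\<lambda>x. \<Sum>i\<in>I. c i * V i x) \<le> (\<Sum>i\<in>I. \<bar>c i\<bar> * Q (V i))"
proof (induction I rule: finite_induct)
  case (insert j I)
  have "Q (\<lambda>x. c j * V j x + (\<Sum>i\<in>I. c i * V i x)) \<le> Q (\<lambda>x. c j * V j x) + Q (\<lambda>x. \<Sum>i\<in>I. c i * V i x)"
    using insert by (intro Q_add D_cmult D_sum) auto
  also have "\<dots> \<le> \<bar>c j\<bar> * Q (V j) + (\<Sum>i\<in>I. \<bar>c i\<bar> * Q (V i))"
    using insert by (intro add_mono Q_cmult) auto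
  finally show ?case using insert by simp
qed (simp add: Q_zero)

lemma simple_fn_in_D: "(\<And>i. i < n \<Longrightarrow> V i \<in> D) \<Longrightarrow> simple_fn n E V s \<in> D"
  using D_sum[of "{..<n}" V "\<lambda>i. indicator (E i) s"] by (simp add: simple_fn_def[abs_def])

lemma simple_function_simple_fn:
  assumes "\<And>i. i < n \<Longrightarrow> E i \<in> sets M"
  shows "simple_function M (simple_fn n E V)"
  using assms
proof (induction n)
  case 0
  have "simple_fn 0 E V = (\<lambda>s x. 0)" by (simp add: simple_fn_def fun_eq_iff)
  then show ?case by simp
next
  case (Suc n)
  then have "simple_function M (\<lambda>s. (\<lambda>F c x. F x + c * V n x) (simple_fn n E V s) (indicat_real (E n) s))"
    by (intro simple_function_compose2[where h = "\<lambda>F c x. F x + c * V n x"]) auto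
  moreover have "(\<lambda>s. (\<lambda>F c x. F x + c * V n x) (simple_fn n E V s) (indicat_real (E n) s)) = simple_fn (Suc n) E V"
    by (simp add: simple_fn_def fun_eq_iff)
  ultimately show ?case by simp
qed

text \<open>\<open>D\<close> carries no sigma-algebra. For simple \<open>Y\<close> and
  \<open>T j\<close>, however, the composition with \<open>Q\<close> takes finitely many values, and
  the reverse triangle inequality carries the convergence of \<open>T j\<close> to \<open>h\<close>
  over to these real functions.\<close>

lemma measurable_Q_limit:
  assumes T: "\<And>j. simple_function lebesgue (T j)" "\<And>j s. T j s \<in> D"
    and h: "AE s in lebesgue. s \<in> S \<longrightarrow> h s \<in> D \<and> (\<lambda>j. Q (\<lambda>x. T j s x - h s x)) \<longlonglongrightarrow> 0"
    and Y: "simple_function lebesgue Y" "\<And>s. Y s \<in> D" and S: "S \<in> sets lebesgue"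
  shows "(\<lambda>s::real. indicator S s * Q (\<lambda>x. Y s x - h s x)) \<in> borel_measurable lebesgue"
proof -
  let ?f = "\<lambda>j s. indicator S s * Q (\<lambda>x. Y s x - T j s x)"
  have f: "?f j \<in> borel_measurable lebesgue" for j
  proof -
    have "simple_function lebesgue (\<lambda>s. (\<lambda>u v. Q (\<lambda>x. u x - v x)) (Y s) (T j s))"
      using T Y by (intro simple_function_compose2[where h = "\<lambda>u v. Q (\<lambda>x. u x - v x)"]) auto
    then have [measurable]: "(\<lambda>s. Q (\<lambda>x. Y s x - T j s x)) \<in> borel_measurable lebesgue"
      by (rule borel_measurable_simple_function)
    show ?thesis using S by measurable
  qed
  have lim: "AE s in lebesgue. (\<lambda>j. ?f j s) \<longlonglongrightarrow> indicator S s * Q (\<lambda>x. Y s x - h s x)"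
    using h
  proof eventually_elim
    case (elim s)
    show ?case
    proof (cases "s \<in> S")
      case True
      with elim have hD: "h s \<in> D" and l: "(\<lambda>j. Q (\<lambda>x. T j s x - h s x)) \<longlonglongrightarrow> 0" by auto
      have "(\<lambda>j. Q (\<lambda>x. Y s x - T j s x) - Q (\<lambda>x. Y s x - h s x)) \<longlonglongrightarrow> 0"
      proof (rule Lim_null_comparison[OF _ l], rule always_eventually, rule allI)
        fix j
        show "norm (Q (\<lambda>x. Y s x - T j s x) - Q (\<lambda>x. Y s x - h s x)) \<le> Q (\<lambda>x. T j s x - h s x)"
          using Q_triangle[OF Y(2)[of s] T(2)[of j s] hD] Q_triangle[OF Y(2)[of s] hD T(2)[of j s]]
            Q_minus_commute[OF hD T(2)[of j s]]
          by (auto simp: abs_le_iff)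
      qed
      then show ?thesis using True by (simp add: LIM_zero_iff)
    qed auto
  qed
  \<comment> \<open>Off \<open>N\<close> the convergence holds at every point; completeness of
    Lebesgue measure absorbs the null set.\<close>
  define N where "N = {s. \<not> ((\<lambda>j. ?f j s) \<longlonglongrightarrow> indicator S s * Q (\<lambda>x. Y s x - h s x))}"
  have N: "N \<in> null_sets lebesgue"
    using lim unfolding completion.AE_iff_null_sets N_def by simp
  have "(\<lambda>s. indicator (-N) s * (indicator S s * Q (\<lambda>x. Y s x - h s x))) \<in> borel_measurable lebesgue"
  proof (rule borel_measurable_LIMSEQ_real)
    fix s
    show "(\<lambda>j. indicator (-N) s * ?f j s) \<longlonglongrightarrow> indicator (-N) s * (indicator S s * Q (\<lambda>x. Y s x - h s x))"
      by (cases "s \<in> N") (auto simp: N_def intro!: tendsto_intros)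
  next
    fix j
    have "N \<in> sets lebesgue" using N by auto
    then have "- N \<in> sets lebesgue" by (simp add: Compl_in_sets_lebesgue)
    then show "(\<lambda>s. indicator (-N) s * ?f j s) \<in> borel_measurable lebesgue"
      using f[of j] by (intro borel_measurable_times[of "indicator (-N)"]) auto
  qed
  then show ?thesis
  proof (rule borel_measurable_AE)
    show "AE s in lebesgue. indicator (-N) s * (indicator S s * Q (\<lambda>x. Y s x - h s x)) = indicator S s * Q (\<lambda>x. Y s x - h s x)"
      using AE_not_in[OF N] by eventually_elim auto
  qed
qed

text \<open>The sets in a representation of \<open>T\<close> may overlap, so \<open>S\<close> is
  partitioned by the values of \<open>T\<close>; then the triangle inequality for finite sums
  applies. Integrating pointwise in \<open>x\<close> makes the left side independent of any
  representation.\<close>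

lemma Q_integral_simple:
  assumes T: "simple_function lebesgue T" "\<And>s. T s \<in> D" and S: "S \<in> lmeasurable"
  shows "ennreal (Q (\<lambda>x. LINT s|lebesgue. indicator S (s::real) * T s x)) \<le> (\<integral>\<^sup>+ s\<in>S. ennreal (Q (T s)) \<partial>lebesgue)"
proof -
  define P where "P y = S \<inter> T -` {y}" for y
  have fin: "finite (range T)" using T(1) by (simp add: simple_function_def)
  have P: "P y \<in> lmeasurable" if "y \<in> range T" for y
  proof (rule fmeasurableI2[OF S])
    have "T -` {y} \<inter> space lebesgue \<in> sets lebesgue" using T(1) by (rule simple_functionD)
    then show "P y \<in> sets lebesgue" using S by (simp add: P_def)
  qed (auto simp: P_def)
  \<comment> \<open>One identity for all real functionals of the value: it is applied to evaluation
    at \<open>x\<close> and to \<open>Q\<close>.\<close>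
  have pt: "indicator S s * \<phi> (T s) = (\<Sum>y\<in>range T. indicator (P y) s * \<phi> y)" for s and \<phi> :: "('a \<Rightarrow> real) \<Rightarrow> real"
  proof -
    have "(\<Sum>y\<in>range T. indicator (P y) s * \<phi> y) = (\<Sum>y\<in>range T. if y = T s then indicator S s * \<phi> y else 0)"
      by (intro sum.cong) (auto simp: P_def split: split_indicator)
    also have "\<dots> = indicator S s * \<phi> (T s)" using fin by (subst sum.delta) auto
    finally show ?thesis ..
  qed
  have int: "(LINT s|lebesgue. indicator S s * T s x) = (\<Sum>y\<in>range T. measure lebesgue (P y) * y x)" for x
  proof -
    have "(LINT s|lebesgue. indicator S s * T s x) = (LINT s|lebesgue. (\<Sum>y\<in>range T. indicator (P y) s * y x))"
      using pt[of _ "\<lambda>y. y x"] by simp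
    also have "\<dots> = (\<Sum>y\<in>range T. LINT s|lebesgue. indicator (P y) s * y x)"
      using P by (intro Bochner_Integration.integral_sum integrable_mult_left) (simp add: lmeasurable_iff_integrable)
    also have "\<dots> = (\<Sum>y\<in>range T. measure lebesgue (P y) * y x)"
      using P by (intro sum.cong) auto
    finally show ?thesis .
  qed
  have rD: "y \<in> D" if "y \<in> range T" for y using that T by auto
  have "Q (\<lambda>x. LINT s|lebesgue. indicator S s * T s x) \<le> (\<Sum>y\<in>range T. \<bar>measure lebesgue (P y)\<bar> * Q y)"
    unfolding int by (rule Q_sum[OF fin rD])
  then have "ennreal (Q (\<lambda>x. LINT s|lebesgue. indicator S s * T s x)) \<le> ennreal (\<Sum>y\<in>range T. measure lebesgue (P y) * Q y)"
    by (intro ennreal_leI) simp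
  also have "\<dots> = (\<Sum>y\<in>range T. ennreal (measure lebesgue (P y) * Q y))"
    using Q_nonneg by (intro sum_ennreal[symmetric]) auto
  also have "\<dots> = (\<Sum>y\<in>range T. \<integral>\<^sup>+ s. ennreal (Q y) * indicator (P y) s \<partial>lebesgue)"
  proof (rule sum.cong[OF refl])
    fix y assume y: "y \<in> range T"
    have "(\<integral>\<^sup>+ s. ennreal (Q y) * indicator (P y) s \<partial>lebesgue) = ennreal (Q y) * emeasure lebesgue (P y)"
      using P[OF y] by (intro nn_integral_cmult_indicator) auto
    then show "ennreal (measure lebesgue (P y) * Q y) = (\<integral>\<^sup>+ s. ennreal (Q y) * indicator (P y) s \<partial>lebesgue)"
      using P[OF y] Q_nonneg by (simp add: emeasure_eq_measure2 ennreal_mult mult.commute)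
  qed
  also have "\<dots> = (\<integral>\<^sup>+ s. (\<Sum>y\<in>range T. ennreal (Q y) * indicator (P y) s) \<partial>lebesgue)"
    using P by (intro nn_integral_sum[symmetric]) auto
  also have "\<dots> = (\<integral>\<^sup>+ s\<in>S. ennreal (Q (T s)) \<partial>lebesgue)"
  proof (rule nn_integral_cong)
    fix s
    have "(\<Sum>y\<in>range T. ennreal (Q y) * indicator (P y) s) = (\<Sum>y\<in>range T. ennreal (indicator (P y) s * Q y))"
      by (intro sum.cong) (auto split: split_indicator)
    also have "\<dots> = ennreal (indicator S s * Q (T s))"
      unfolding pt[of s Q] using Q_nonneg by (intro sum_ennreal) auto
    finally show "(\<Sum>y\<in>range T. ennreal (Q y) * indicator (P y) s) = ennreal (Q (T s)) * indicator S s"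
      by (auto split: split_indicator)
  qed
  finally show "ennreal (Q (\<lambda>x. LINT s|lebesgue. indicator S s * T s x)) \<le> (\<integral>\<^sup>+ s\<in>S. ennreal (Q (T s)) \<partial>lebesgue)" .
qed

end

lemma powr_add3_le:
  fixes x y z :: real
  assumes "0 \<le> x" "0 \<le> y" "0 \<le> z" "0 < p"
  shows "(x + y + z) powr p \<le> 3 powr p * (x powr p + y powr p + z powr p)"
  using powr_sum_le[of "{..<3::nat}" "\<lambda>i. if i = 0 then x else if i = 1 then y else z" p] assms
  by (simp add: eval_nat_numeral lessThan_Suc ac_simps)

section \<open>Step approximation, translations and Bochner integrals under a seminorm\<close>

context function_seminorm
begin

text \<open>Cutting the simple functions off where they are at distance more than \<open>1\<close> from \<open>f\<close> makes
  the error dominated, so that pointwise convergence improves to convergence in \<open>L\<^sup>p\<close>.\<close>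

lemma approx_borel_step:
  fixes f :: "real \<Rightarrow> 'a \<Rightarrow> real"
  assumes p: "1 \<le> p"
    and E: "\<And>k i. i < n k \<Longrightarrow> E k i \<in> sets lebesgue \<and> V k i \<in> D"
    and f: "AE s in lebesgue. s \<in> {a..b} \<longrightarrow> f s \<in> D \<and> (\<lambda>k. Q (\<lambda>x. simple_fn (n k) (E k) (V k) s x - f s x)) \<longlonglongrightarrow> 0"
    and fin: "(\<integral>\<^sup>+ s\<in>{a..b}. ennreal (Q (f s) powr p) \<partial>lebesgue) < \<infinity>" and e: "0 < e"
  obtains N :: nat and B W \<phi> where "\<And>i. i < N \<Longrightarrow> B i \<in> sets borel \<and> bounded (B i) \<and> W i \<in> D"
    "\<phi> \<in> borel_measurable borel" "\<And>s. 0 \<le> \<phi> s" "(\<integral>\<^sup>+ s. ennreal (\<phi> s powr p) \<partial>lborel) \<le> ennreal e"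
    "AE s in lborel. s \<in> {a..b} \<longrightarrow> f s \<in> D \<and> Q (\<lambda>x. f s x - simple_fn N B W s x) \<le> \<phi> s"
proof -
  let ?I = "{a..b}"
  define T where "T k = simple_fn (n k) (E k) (V k)" for k
  have T: "simple_function lebesgue (T k)" "T k s \<in> D" for k s
    unfolding T_def using E by (auto intro: simple_function_simple_fn simple_fn_in_D)
  have f': "AE s in lebesgue. s \<in> ?I \<longrightarrow> f s \<in> D \<and> (\<lambda>k. Q (\<lambda>x. T k s x - f s x)) \<longlonglongrightarrow> 0"
    using f by (simp add: T_def)
  define q where "q k s = indicator ?I s * Q (\<lambda>x. T k s x - f s x)" for k s
  define q0 where "q0 s = indicator ?I s * Q (\<lambda>x. 0 - f s x)" for s
  have [measurable]: "q k \<in> borel_measurable lebesgue" for k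
    unfolding q_def[abs_def] by (rule measurable_Q_limit[OF T f' T]) auto
  have [measurable]: "q0 \<in> borel_measurable lebesgue"
    unfolding q0_def[abs_def]
    using measurable_Q_limit[OF T f', of "\<lambda>_ _. 0"] D_zero by auto
  have qn: "0 \<le> q k s" "0 \<le> q0 s" for k s using Q_nonneg by (auto simp: q_def q0_def)
  define A where "A k = {s \<in> space lebesgue. q k s \<le> 1} \<inter> ?I" for k
  have A[measurable]: "A k \<in> sets lebesgue" for k
    unfolding A_def by (intro sets.Int) (measurable, auto)
  \<comment> \<open>The error on \<open>{a..b}\<close> of the step function that equals
    \<open>T k\<close> on \<open>A k\<close> and 0 elsewhere; outside \<open>{a..b}\<close> it is
    0.\<close>
  define r where "r k s = (if s \<in> A k then q k s else q0 s)" for k s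
  have r[measurable]: "r k \<in> borel_measurable lebesgue" for k
    unfolding r_def[abs_def] by measurable
  have rn: "0 \<le> r k s" for k s using qn by (auto simp: r_def)
  have "(\<lambda>k. \<integral>\<^sup>+ s. ennreal (r k s powr p) \<partial>lebesgue) \<longlonglongrightarrow> integral\<^sup>N lebesgue (\<lambda>s::real. 0)"
  proof (rule nn_integral_dominated_convergence[where w = "\<lambda>s. indicator ?I s + ennreal (q0 s powr p)"])
    show "AE s in lebesgue. ennreal (r k s powr p) \<le> indicator ?I s + ennreal (q0 s powr p)" for k
    proof (intro always_eventually allI)
      fix s
      show "ennreal (r k s powr p) \<le> indicator ?I s + ennreal (q0 s powr p)"
      proof (cases "s \<in> A k")
        case True
        then have "r k s powr p \<le> 1" "s \<in> ?I"
          using qn p powr_mono2[of p "q k s" 1] by (auto simp: r_def A_def)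
        then show ?thesis using ennreal_leI[of "r k s powr p" 1] by (simp add: add_increasing2)
      next
        case False
        then show ?thesis by (simp add: r_def)
      qed
    qed
    have "(\<integral>\<^sup>+ s. ennreal (q0 s powr p) \<partial>lebesgue) \<le> (\<integral>\<^sup>+ s\<in>?I. ennreal (Q (f s) powr p) \<partial>lebesgue)"
    proof (rule nn_integral_mono_AE, use f' in eventually_elim)
      fix s assume s: "s \<in> ?I \<longrightarrow> f s \<in> D \<and> (\<lambda>k. Q (\<lambda>x. T k s x - f s x)) \<longlonglongrightarrow> 0"
      show "ennreal (q0 s powr p) \<le> ennreal (Q (f s) powr p) * indicator ?I s"
      proof (cases "s \<in> ?I")
        case True
        then have "Q (\<lambda>x. 0 - f s x) \<le> Q (f s)"
          using s Q_cmult[of "f s" "-1"] by simp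
        then show ?thesis using True Q_nonneg p by (auto simp: q0_def intro!: ennreal_leI powr_mono2)
      qed (auto simp: q0_def)
    qed
    also have "\<dots> < \<infinity>" by (rule fin)
    finally show "(\<integral>\<^sup>+ s. indicator ?I s + ennreal (q0 s powr p) \<partial>lebesgue) < \<infinity>"
      by (subst nn_integral_add) (auto intro!: borel_measurable_indicator simp: emeasure_lborel_Icc_eq)
    show "AE s in lebesgue. (\<lambda>k. ennreal (r k s powr p)) \<longlonglongrightarrow> 0"
      using f'
    proof eventually_elim
      case (elim s)
      have "(\<lambda>k. r k s) \<longlonglongrightarrow> 0"
      proof (cases "s \<in> ?I")
        case True
        then have l: "(\<lambda>k. q k s) \<longlonglongrightarrow> 0" using elim by (auto simp: q_def)
        then have "\<forall>\<^sub>F k in sequentially. q k s < 1" by (rule order_tendstoD) simp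
        then have "\<forall>\<^sub>F k in sequentially. r k s = q k s"
          by (rule eventually_mono) (use True in \<open>auto simp: r_def A_def\<close>)
        then show ?thesis using l by (simp add: tendsto_cong)
      next
        case False
        then have "r k s = 0" for k by (auto simp: r_def q0_def A_def)
        then show ?thesis by simp
      qed
      then have "(\<lambda>k. r k s powr p) \<longlonglongrightarrow> 0 powr p"
        using p rn by (intro tendsto_powr2) auto
      then show ?case by (simp add: ennreal_tendsto_0_iff)
    qed
    show "(\<lambda>s. indicator ?I s + ennreal (q0 s powr p)) \<in> borel_measurable lebesgue"
      by (intro borel_measurable_add borel_measurable_indicator) (simp, measurable)
  qed measurable
  then have "\<forall>\<^sub>F k in sequentially. (\<integral>\<^sup>+ s. ennreal (r k s powr p) \<partial>lebesgue) < ennreal e"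
    using e by (intro order_tendstoD) auto
  then obtain k where k: "(\<integral>\<^sup>+ s. ennreal (r k s powr p) \<partial>lebesgue) < ennreal e"
    by (auto simp: eventually_sequentially)
  have "\<exists>B. B \<in> sets borel \<and> (AE x in lborel. x \<in> E k i \<inter> A k \<longleftrightarrow> x \<in> B)" if "i < n k" for i
    using lebesgue_set_borel_version[of "E k i \<inter> A k"] E[OF that] A[of k] by (metis sets.Int)
  then obtain B where B: "\<And>i. i < n k \<Longrightarrow> B i \<in> sets borel"
    "\<And>i. i < n k \<Longrightarrow> AE x in lborel. x \<in> E k i \<inter> A k \<longleftrightarrow> x \<in> B i" by metis
  obtain g where g[measurable]: "g \<in> borel_measurable lborel" and geq: "AE s in lborel. r k s = g s"
    using completion_ex_borel_measurable_real[OF r] by blast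
  have Beq: "AE s in lborel. \<forall>i\<in>{..<n k}. s \<in> E k i \<inter> A k \<longleftrightarrow> s \<in> B i"
    using B(2) by (intro AE_finite_allI) auto
  have f'': "AE s in lborel. s \<in> ?I \<longrightarrow> f s \<in> D"
    using f by (subst (asm) AE_completion_iff) (auto elim: eventually_mono)
  show thesis
  \<comment> \<open>Intersecting with the interval makes the Borel sets bounded. The maximum with 0
    gives nonnegativity everywhere, as \<open>g\<close> agrees with \<open>r k\<close> only almost
    everywhere.\<close>
  proof (rule that[of "n k" "\<lambda>i. B i \<inter> ?I" "V k" "\<lambda>s. max 0 (g s)"])
    show "B i \<inter> ?I \<in> sets borel \<and> bounded (B i \<inter> ?I) \<and> V k i \<in> D" if "i < n k" for i
      using B(1)[OF that] E[OF that] bounded_subset[of ?I] by auto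
    show "(\<lambda>s. max 0 (g s)) \<in> borel_measurable borel" using g by simp
    show "0 \<le> max 0 (g s)" for s by simp
    have "(\<integral>\<^sup>+ s. ennreal (max 0 (g s) powr p) \<partial>lborel) = (\<integral>\<^sup>+ s. ennreal (r k s powr p) \<partial>lborel)"
      using geq by (intro nn_integral_cong_AE, eventually_elim) (metis rn max_absorb2)
    also have "\<dots> \<le> ennreal e" using k by (simp add: nn_integral_completion)
    finally show "(\<integral>\<^sup>+ s. ennreal (max 0 (g s) powr p) \<partial>lborel) \<le> ennreal e" .
    show "AE s in lborel. s \<in> ?I \<longrightarrow> f s \<in> D \<and> Q (\<lambda>x. f s x - simple_fn (n k) (\<lambda>i. B i \<inter> ?I) (V k) s x) \<le> max 0 (g s)"
      using geq Beq f''
    proof eventually_elim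
      case (elim s)
      show ?case
      proof (intro impI conjI)
        assume s: "s \<in> ?I"
        then show fD: "f s \<in> D" using elim by simp
        show "Q (\<lambda>x. f s x - simple_fn (n k) (\<lambda>i. B i \<inter> ?I) (V k) s x) \<le> max 0 (g s)"
        proof (cases "s \<in> A k")
          case True
          then have "simple_fn (n k) (\<lambda>i. B i \<inter> ?I) (V k) s = T k s"
            unfolding T_def simple_fn_def fun_eq_iff using elim s
            by (intro allI sum.cong refl arg_cong2[where f = times]) (auto simp: indicator_def)
          then have "Q (\<lambda>x. f s x - simple_fn (n k) (\<lambda>i. B i \<inter> ?I) (V k) s x) = q k s"
            using Q_minus_commute[OF fD T(2)[of k s]] s by (simp add: q_def)
          also have "\<dots> = g s" using True elim by (simp add: r_def)
          finally show ?thesis by simp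
        next
          case False
          then have "simple_fn (n k) (\<lambda>i. B i \<inter> ?I) (V k) s = (\<lambda>x. 0)"
            unfolding simple_fn_def fun_eq_iff using elim
            by (intro allI sum.neutral) (auto simp: indicator_def)
          then have "Q (\<lambda>x. f s x - simple_fn (n k) (\<lambda>i. B i \<inter> ?I) (V k) s x) = q0 s"
            using Q_minus_commute[OF fD D_zero] s by (simp add: q0_def)
          also have "\<dots> = g s" using False elim by (simp add: r_def)
          finally show ?thesis by simp
        qed
      qed
    qed
  qed
qed

text \<open>With \<open>G\<close> the approximating step function, go from \<open>f (t - s)\<close>
  to \<open>G (t - s)\<close>, to \<open>G t\<close>, to \<open>f t\<close>. The outer distances are
  bounded by \<phi> at \<open>t - s\<close> and at \<open>t\<close>; the middle one is explicit in
  the Borel sets. Their sum is a jointly Borel majorant, to which Tonelli's theorem applies.\<close>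

lemma translation_bound:
  fixes f :: "real \<Rightarrow> 'a \<Rightarrow> real"
  assumes p: "1 \<le> p"
    and E: "\<And>k i. i < n k \<Longrightarrow> E k i \<in> sets lebesgue \<and> V k i \<in> D"
    and f: "AE s in lebesgue. s \<in> {a..b} \<longrightarrow> f s \<in> D \<and> (\<lambda>k. Q (\<lambda>x. simple_fn (n k) (E k) (V k) s x - f s x)) \<longlonglongrightarrow> 0"
    and fin: "(\<integral>\<^sup>+ s\<in>{a..b}. ennreal (Q (f s) powr p) \<partial>lebesgue) < \<infinity>" and e: "0 < e"
  obtains d :: real and Z :: "real set" and \<beta> :: "real \<Rightarrow> real \<Rightarrow> real" where
    "0 < d" "Z \<in> null_sets lborel" "(\<lambda>(t, s). \<beta> t s) \<in> borel_measurable (borel \<Otimes>\<^sub>M borel)" "\<And>t s. 0 \<le> \<beta> t s"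
    "\<And>s. \<bar>s\<bar> < d \<Longrightarrow> (\<integral>\<^sup>+ t. ennreal (\<beta> t s powr p) \<partial>lborel) \<le> ennreal e"
    "\<And>t. t \<in> {a..b} \<Longrightarrow> t \<notin> Z \<Longrightarrow> f t \<in> D"
    "\<And>t s. t \<in> {a..b} \<Longrightarrow> t \<notin> Z \<Longrightarrow> t - s \<in> {a..b} \<Longrightarrow> t - s \<notin> Z \<Longrightarrow> Q (\<lambda>x. f (t - s) x - f t x) \<le> \<beta> t s"
proof -
  define c3 where "c3 = (3::real) powr p"
  have c3: "0 < c3" by (simp add: c3_def)
  \<comment> \<open>\<open>c3\<close> is the constant for the \<open>p\<close>-th power of a sum of
    three terms. Each \<phi> term thus contributes \<open>e / 4\<close>, leaving
    \<open>e / 2\<close> for the step function.\<close>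
  have e4: "0 < e / (4 * c3)" using e c3 by simp
  obtain N B W \<phi> where BW: "\<And>i. i < N \<Longrightarrow> B i \<in> sets borel \<and> bounded (B i) \<and> W i \<in> D"
    and \<phi>[measurable]: "\<phi> \<in> borel_measurable borel" and \<phi>0: "\<And>s. 0 \<le> \<phi> s"
    and \<phi>i: "(\<integral>\<^sup>+ s. ennreal (\<phi> s powr p) \<partial>lborel) \<le> ennreal (e / (4 * c3))"
    and good: "AE s in lborel. s \<in> {a..b} \<longrightarrow> f s \<in> D \<and> Q (\<lambda>x. f s x - simple_fn N B W s x) \<le> \<phi> s"
    using approx_borel_step[OF p E f fin e4] by blast
  have [measurable]: "i < N \<Longrightarrow> B i \<in> sets borel" for i using BW by auto
  obtain Z where Z: "Z \<in> null_sets lborel"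
    and Zc: "\<And>s. s \<in> space lborel - Z \<Longrightarrow> s \<in> {a..b} \<longrightarrow> f s \<in> D \<and> Q (\<lambda>x. f s x - simple_fn N B W s x) \<le> \<phi> s"
    using AE_E3[OF good] by blast
  have good': "f s \<in> D \<and> Q (\<lambda>x. f s x - simple_fn N B W s x) \<le> \<phi> s" if "s \<notin> Z" "s \<in> {a..b}" for s
    using Zc[of s] that by simp
  define \<psi> where "\<psi> t s = (\<Sum>i<N. \<bar>indicat_real (B i) (t - s) - indicat_real (B i) t\<bar> * Q (W i))" for t s
  have \<psi>0: "0 \<le> \<psi> t s" for t s unfolding \<psi>_def using Q_nonneg by (intro sum_nonneg) auto
  define \<beta> where "\<beta> t s = \<phi> (t - s) + \<psi> t s + \<phi> t" for t s
  define c where "c i = c3 * real N powr p * Q (W i) powr p" for i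
  have c: "0 \<le> c i" for i using c3 by (auto simp: c_def)
  define C where "C = (\<Sum>i<N. c i)"
  have C: "0 \<le> C" unfolding C_def using c by (intro sum_nonneg) auto
  \<comment> \<open>\<open>C\<close> collects the coefficients of the indicator differences; the
    added 1 avoids division by zero when they all vanish.\<close>
  define e' where "e' = e / (2 * (C + 1))"
  have e': "0 < e'" "C * e' \<le> e / 2"
    using e C by (auto simp: e'_def field_simps)
  have "\<exists>d>0. \<forall>s. \<bar>s\<bar> < d \<longrightarrow> (\<integral>\<^sup>+ t. ennreal \<bar>indicat_real (B i) (t - s) - indicat_real (B i) t\<bar> \<partial>lborel) \<le> ennreal e'" if "i < N" for i
    using indicator_translation_continuous[of "B i" e'] BW[OF that] e' by metis
  then obtain dd where dd: "\<And>i. i < N \<Longrightarrow> 0 < dd i"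
    "\<And>i s. i < N \<Longrightarrow> \<bar>s\<bar> < dd i \<Longrightarrow> (\<integral>\<^sup>+ t. ennreal \<bar>indicat_real (B i) (t - s) - indicat_real (B i) t\<bar> \<partial>lborel) \<le> ennreal e'"
    by metis
  \<comment> \<open>The inserted 1 keeps the minimum meaningful when \<open>N = 0\<close>.\<close>
  define d where "d = Min (insert 1 (dd ` {..<N}))"
  have d: "0 < d" "\<And>i. i < N \<Longrightarrow> d \<le> dd i" unfolding d_def using dd(1) by (auto simp: Min_gr_iff)
  show thesis
  proof (rule that[of d Z \<beta>])
    show "0 < d" "Z \<in> null_sets lborel" by fact+
    show "0 \<le> \<beta> t s" for t s using \<phi>0 \<psi>0 by (simp add: \<beta>_def)
    show "f t \<in> D" if "t \<in> {a..b}" "t \<notin> Z" for t using good' that by auto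
    show "(\<lambda>(t, s). \<beta> t s) \<in> borel_measurable (borel \<Otimes>\<^sub>M borel)"
    proof -
      have [measurable]: "(\<lambda>x. indicat_real (B i) (fst x - snd x)) \<in> borel_measurable (borel \<Otimes>\<^sub>M borel)" if "i < N" for i
        by (rule measurable_compose[where N = borel and g = "indicat_real (B i)"]) (use that in measurable)
      show ?thesis
        unfolding \<beta>_def \<psi>_def by (simp add: case_prod_unfold) measurable
    qed
    fix t s :: real
    {
      assume s: "\<bar>s\<bar> < d"
      let ?\<omega> = "\<lambda>i t. ennreal \<bar>indicat_real (B i) (t - s) - indicat_real (B i) t\<bar>"
      have "(\<integral>\<^sup>+ t. ennreal (\<beta> t s powr p) \<partial>lborel) \<le>
         (\<integral>\<^sup>+ t. ennreal c3 * ennreal (\<phi> (t - s) powr p) + (\<Sum>i<N. ennreal (c i) * ?\<omega> i t) + ennreal c3 * ennreal (\<phi> t powr p) \<partial>lborel)"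
      proof (rule nn_integral_mono)
        fix t
        have "\<psi> t s powr p \<le> real N powr p * (\<Sum>i<N. (\<bar>indicat_real (B i) (t - s) - indicat_real (B i) t\<bar> * Q (W i)) powr p)"
          unfolding \<psi>_def using powr_sum_le[of "{..<N}" "\<lambda>i. \<bar>indicat_real (B i) (t - s) - indicat_real (B i) t\<bar> * Q (W i)" p] Q_nonneg p by auto
        \<comment> \<open>A difference of indicators has absolute value 0 or 1, so the power does
          not affect it; continuity in the first mean suffices for every \<open>p\<close>.\<close>
        also have "(\<Sum>i<N. (\<bar>indicat_real (B i) (t - s) - indicat_real (B i) t\<bar> * Q (W i)) powr p)
            = (\<Sum>i<N. \<bar>indicat_real (B i) (t - s) - indicat_real (B i) t\<bar> * Q (W i) powr p)"
          by (intro sum.cong) (auto simp: indicator_def)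
        finally have "c3 * \<psi> t s powr p \<le> c3 * (real N powr p * (\<Sum>i<N. \<bar>indicat_real (B i) (t - s) - indicat_real (B i) t\<bar> * Q (W i) powr p))"
          using c3 by (intro mult_left_mono) auto
        also have "\<dots> = (\<Sum>i<N. c i * \<bar>indicat_real (B i) (t - s) - indicat_real (B i) t\<bar>)"
          by (simp add: c_def sum_distrib_left ac_simps)
        finally have \<psi>le: "c3 * \<psi> t s powr p \<le> \<dots>" .
        have "\<beta> t s powr p \<le> c3 * (\<phi> (t - s) powr p + \<psi> t s powr p + \<phi> t powr p)"
          unfolding \<beta>_def c3_def using \<phi>0 \<psi>0 p by (intro powr_add3_le) auto
        also have "\<dots> \<le> c3 * \<phi> (t - s) powr p + (\<Sum>i<N. c i * \<bar>indicat_real (B i) (t - s) - indicat_real (B i) t\<bar>) + c3 * \<phi> t powr p"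
          using \<psi>le by (simp add: distrib_left)
        finally have "ennreal (\<beta> t s powr p) \<le> ennreal (c3 * \<phi> (t - s) powr p + (\<Sum>i<N. c i * \<bar>indicat_real (B i) (t - s) - indicat_real (B i) t\<bar>) + c3 * \<phi> t powr p)"
          by (rule ennreal_leI)
        also have "\<dots> = ennreal c3 * ennreal (\<phi> (t - s) powr p) + (\<Sum>i<N. ennreal (c i) * ?\<omega> i t) + ennreal c3 * ennreal (\<phi> t powr p)"
          using c3 c by (simp add: ennreal_mult sum_nonneg flip: sum_ennreal)
        finally show "ennreal (\<beta> t s powr p) \<le> \<dots>" .
      qed
      also have "\<dots> = ennreal c3 * (\<integral>\<^sup>+ t. ennreal (\<phi> (t - s) powr p) \<partial>lborel) + (\<Sum>i<N. ennreal (c i) * (\<integral>\<^sup>+ t. ?\<omega> i t \<partial>lborel))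
           + ennreal c3 * (\<integral>\<^sup>+ t. ennreal (\<phi> t powr p) \<partial>lborel)"
      proof -
        have [measurable]: "(\<lambda>t. indicat_real (B i) (t - s)) \<in> borel_measurable borel" if "i < N" for i
          by (rule measurable_compose[where N = borel and g = "indicat_real (B i)"]) (use that in measurable)
        have m[measurable]: "?\<omega> i \<in> borel_measurable lborel" if "i < N" for i
          using that by measurable
        have mX: "(\<lambda>t. ennreal (\<phi> (t - s) powr p)) \<in> borel_measurable lborel"
          "(\<lambda>t. ennreal (\<phi> t powr p)) \<in> borel_measurable lborel" by measurable
        have mX': "(\<lambda>t. ennreal c3 * ennreal (\<phi> (t - s) powr p)) \<in> borel_measurable lborel"
          "(\<lambda>t. ennreal c3 * ennreal (\<phi> t powr p)) \<in> borel_measurable lborel" by measurable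
        have mY: "(\<lambda>t. \<Sum>i<N. ennreal (c i) * ?\<omega> i t) \<in> borel_measurable lborel"
          by (intro borel_measurable_sum borel_measurable_times_ennreal m) auto
        have "(\<integral>\<^sup>+ t. (\<Sum>i<N. ennreal (c i) * ?\<omega> i t) \<partial>lborel) = (\<Sum>i<N. \<integral>\<^sup>+ t. ennreal (c i) * ?\<omega> i t \<partial>lborel)"
          by (intro nn_integral_sum borel_measurable_times_ennreal m) auto
        also have "\<dots> = (\<Sum>i<N. ennreal (c i) * (\<integral>\<^sup>+ t. ?\<omega> i t \<partial>lborel))"
          by (intro sum.cong nn_integral_cmult m) auto
        finally have iY: "(\<integral>\<^sup>+ t. (\<Sum>i<N. ennreal (c i) * ?\<omega> i t) \<partial>lborel) = \<dots>" .
        have add3: "(\<integral>\<^sup>+ t. X t + Y t + X' t \<partial>lborel) = (\<integral>\<^sup>+ t. X t \<partial>lborel) + (\<integral>\<^sup>+ t. Y t \<partial>lborel) + (\<integral>\<^sup>+ t. X' t \<partial>lborel)"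
          if "X \<in> borel_measurable lborel" "Y \<in> borel_measurable lborel" "X' \<in> borel_measurable lborel" for X Y X' :: "real \<Rightarrow> ennreal"
          using that by (simp add: nn_integral_add)
        show ?thesis
          unfolding add3[OF mX'(1) mY mX'(2)]
            nn_integral_cmult[OF mX(1)] nn_integral_cmult[OF mX(2)] iY ..
      qed
      also have "(\<integral>\<^sup>+ t. ennreal (\<phi> (t - s) powr p) \<partial>lborel) = (\<integral>\<^sup>+ t. ennreal (\<phi> t powr p) \<partial>lborel)"
        by (rule nn_integral_lborel_translate) measurable
      also have "ennreal c3 * (\<integral>\<^sup>+ t. ennreal (\<phi> t powr p) \<partial>lborel) + (\<Sum>i<N. ennreal (c i) * (\<integral>\<^sup>+ t. ?\<omega> i t \<partial>lborel))
           + ennreal c3 * (\<integral>\<^sup>+ t. ennreal (\<phi> t powr p) \<partial>lborel)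
         \<le> ennreal c3 * ennreal (e / (4 * c3)) + (\<Sum>i<N. ennreal (c i) * ennreal e') + ennreal c3 * ennreal (e / (4 * c3))"
        using \<phi>i dd(2) d s by (intro add_mono mult_left_mono sum_mono) force+
      also have "\<dots> = ennreal (c3 * (e / (4 * c3)) + (\<Sum>i<N. c i * e') + c3 * (e / (4 * c3)))"
      proof -
        have 1: "ennreal c3 * ennreal (e / (4 * c3)) = ennreal (c3 * (e / (4 * c3)))"
          using c3 e by (intro ennreal_mult[symmetric]) auto
        have "(\<Sum>i<N. ennreal (c i) * ennreal e') = (\<Sum>i<N. ennreal (c i * e'))"
          using c e' by (intro sum.cong ennreal_mult[symmetric]) auto
        also have "\<dots> = ennreal (\<Sum>i<N. c i * e')" using c e' by (intro sum_ennreal) auto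
        finally have 2: "(\<Sum>i<N. ennreal (c i) * ennreal e') = ennreal (\<Sum>i<N. c i * e')" .
        have "0 \<le> (\<Sum>i<N. c i * e')" using c e' by (intro sum_nonneg) auto
        then show ?thesis unfolding 1 2 using c3 e by (subst ennreal_plus; simp)+
      qed
      also have "\<dots> \<le> ennreal e"
      proof (rule ennreal_leI)
        have "(\<Sum>i<N. c i * e') = C * e'" by (simp add: C_def sum_distrib_right)
        moreover have "c3 * (e / (4 * c3)) = e / 4" using c3 by simp
        ultimately show "c3 * (e / (4 * c3)) + (\<Sum>i<N. c i * e') + c3 * (e / (4 * c3)) \<le> e"
          using e'(2) by linarith
      qed
      finally show "(\<integral>\<^sup>+ t. ennreal (\<beta> t s powr p) \<partial>lborel) \<le> ennreal e" .
    }
    assume t: "t \<in> {a..b}" "t \<notin> Z" "t - s \<in> {a..b}" "t - s \<notin> Z"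
    let ?G = "simple_fn N B W"
    have G: "?G r \<in> D" for r using BW by (intro simple_fn_in_D) auto
    have fD: "f t \<in> D" "f (t - s) \<in> D" using good' t by auto
    have "Q (\<lambda>x. f (t - s) x - f t x) \<le> Q (\<lambda>x. f (t - s) x - ?G (t - s) x) + Q (\<lambda>x. ?G (t - s) x - f t x)"
      by (rule Q_triangle[OF fD(2) G fD(1)])
    also have "Q (\<lambda>x. ?G (t - s) x - f t x) \<le> Q (\<lambda>x. ?G (t - s) x - ?G t x) + Q (\<lambda>x. ?G t x - f t x)"
      by (rule Q_triangle[OF G G fD(1)])
    also have "Q (\<lambda>x. ?G t x - f t x) = Q (\<lambda>x. f t x - ?G t x)" by (rule Q_minus_commute[OF G fD(1)])
    also have "Q (\<lambda>x. ?G (t - s) x - ?G t x) \<le> \<psi> t s"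
    proof -
      have "(\<lambda>x. ?G (t - s) x - ?G t x) = (\<lambda>x. \<Sum>i<N. (indicat_real (B i) (t - s) - indicat_real (B i) t) * W i x)"
        by (simp add: simple_fn_def left_diff_distrib sum_subtractf)
      then show ?thesis unfolding \<psi>_def using BW by (simp only:) (intro Q_sum, auto)
    qed
    finally show "Q (\<lambda>x. f (t - s) x - f t x) \<le> \<beta> t s"
      using good'[OF t(2,1)] good'[OF t(4,3)] by (simp add: \<beta>_def)
  qed
qed

text \<open>Since \<open>k\<close> has mass 1, \<open>w\<close> is the integral of
  \<open>k s * w\<close>, and the claim is the triangle inequality for the integral of
  \<open>h s - k s * w\<close>. To reduce it to simple functions, \<open>v\<close> is replaced by
  the combinations \<open>y j\<close> and \<open>k\<close> by a rounded kernel.\<close>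

lemma Q_bochner_le:
  fixes h :: "real \<Rightarrow> 'a \<Rightarrow> real"
  assumes S: "S \<in> lmeasurable" and w: "w \<in> D" and v: "v \<in> D"
    and k[measurable]: "k \<in> borel_measurable borel" and kb: "\<And>s. 0 \<le> k s" "\<And>s. k s \<le> M"
    and k1: "(\<integral>\<^sup>+ s\<in>S. ennreal (k s) \<partial>lebesgue) = 1"
    and T: "\<And>j. simple_function lebesgue (T j)" "\<And>j s. T j s \<in> D"
    and h: "AE s in lebesgue. s \<in> S \<longrightarrow> h s \<in> D \<and> (\<lambda>j. Q (\<lambda>x. T j s x - h s x)) \<longlonglongrightarrow> 0"
    and E: "\<And>j i. i < n j \<Longrightarrow> E j i \<in> sets lebesgue \<and> E j i \<subseteq> S \<and> V j i \<in> D"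
    and lim1: "(\<lambda>j. \<integral>\<^sup>+ s\<in>S. ennreal (Q (\<lambda>x. simple_fn (n j) (E j) (V j) s x - h s x)) \<partial>lebesgue) \<longlonglongrightarrow> 0"
    and lim2: "(\<lambda>j. Q (\<lambda>x. (\<Sum>i<n j. measure lebesgue (E j i) * V j i x) - v x)) \<longlonglongrightarrow> 0"
    and b[measurable]: "b \<in> borel_measurable borel" and b0: "\<And>s. 0 \<le> b s"
    and hb: "AE s in lebesgue. s \<in> S \<longrightarrow> Q (\<lambda>x. h s x - k s * w x) \<le> k s * b s"
  shows "ennreal (Q (\<lambda>x. v x - w x)) \<le> (\<integral>\<^sup>+ s\<in>S. ennreal (k s * b s) \<partial>lebesgue)"
proof -
  define L where "L = (\<integral>\<^sup>+ s\<in>S. ennreal (k s * b s) \<partial>lebesgue)"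
  define l where "l = measure lebesgue S"
  have [measurable]: "S \<in> sets lebesgue" using S by auto
  have kl[measurable]: "k \<in> borel_measurable lebesgue" "b \<in> borel_measurable lebesgue"
    using k b by (auto intro: measurable_completion)
  define G where "G j = simple_fn (n j) (E j) (V j)" for j
  have G: "simple_function lebesgue (G j)" "G j s \<in> D" for j s
    unfolding G_def using E by (auto intro: simple_function_simple_fn simple_fn_in_D)
  define \<alpha> where "\<alpha> j = (\<integral>\<^sup>+ s\<in>S. ennreal (Q (\<lambda>x. G j s x - h s x)) \<partial>lebesgue)" for j
  define y where "y j x = (\<Sum>i<n j. measure lebesgue (E j i) * V j i x)" for j x
  have y: "y j \<in> D" for j unfolding y_def[abs_def] using E by (intro D_sum) auto
  have kint: "integrable lebesgue (\<lambda>s. indicator S s * k s)" "(LINT s|lebesgue. indicator S s * k s) = 1"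
  proof -
    have "has_bochner_integral lebesgue (\<lambda>s. indicator S s * k s) 1"
      using k1 kb by (intro has_bochner_integral_nn_integral) (auto simp: ennreal_mult' ennreal_indicator ac_simps)
    then show "integrable lebesgue (\<lambda>s. indicator S s * k s)" "(LINT s|lebesgue. indicator S s * k s) = 1"
      by (auto simp: has_bochner_integral_iff)
  qed
  \<comment> \<open>The last term appears twice: once for rounding the kernel under the integral,
    and once because the rounded kernel no longer has mass 1.\<close>
  have main: "ennreal (Q (\<lambda>x. v x - w x)) \<le> ennreal (Q (\<lambda>x. y j x - v x)) + (\<alpha> j + L + ennreal (l * Q w * (1 / Suc m))) + ennreal (l * Q w * (1 / Suc m))" for j m
  proof -
    \<comment> \<open>Rounding down to multiples of \<open>1 / Suc m\<close>. As \<open>k\<close>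
      lies between 0 and \<open>M\<close>, only finitely many values occur, so subtracting
      \<open>\<kappa> s * w\<close> from \<open>G j s\<close> leaves a simple function.\<close>
    define \<kappa> where "\<kappa> s = real_of_int \<lfloor>Suc m * k s\<rfloor> / Suc m" for s
    have \<kappa>: "0 \<le> \<kappa> s" "\<kappa> s \<le> k s" "k s - \<kappa> s \<le> 1 / Suc m" for s
    proof -
      define z where "z = real (Suc m) * k s"
      have z: "real_of_int \<lfloor>z\<rfloor> \<le> z" "z - real_of_int \<lfloor>z\<rfloor> \<le> 1" "0 \<le> real_of_int \<lfloor>z\<rfloor>"
        using floor_correct[of z] kb(1)[of s] by (linarith, linarith, simp add: z_def)
      have \<kappa>z: "\<kappa> s = real_of_int \<lfloor>z\<rfloor> / Suc m" and kz: "k s = z / Suc m"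
        by (simp_all add: \<kappa>_def z_def)
      show "0 \<le> \<kappa> s" using z unfolding \<kappa>z by simp
      show "\<kappa> s \<le> k s" unfolding \<kappa>z kz using z by (intro divide_right_mono) auto
      show "k s - \<kappa> s \<le> 1 / Suc m"
        unfolding \<kappa>z kz diff_divide_distrib[symmetric] using z by (intro divide_right_mono) auto
    qed
    have \<kappa>m[measurable]: "\<kappa> \<in> borel_measurable lebesgue" unfolding \<kappa>_def[abs_def] by measurable
    have \<kappa>s: "simple_function lebesgue \<kappa>"
    proof (rule simple_function_borel_measurable[OF \<kappa>m], rule finite_subset)
      show "\<kappa> ` space lebesgue \<subseteq> (\<lambda>i. real_of_int i / Suc m) ` {0..\<lfloor>Suc m * M\<rfloor>}"
        using kb by (auto simp: \<kappa>_def intro!: imageI floor_mono mult_left_mono)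
    qed auto
    define c where "c = (LINT s|lebesgue. indicator S s * \<kappa> s)"
    have \<kappa>int: "integrable lebesgue (\<lambda>s. indicator S s * \<kappa> s)"
      by (rule Bochner_Integration.integrable_bound[OF kint(1)]) (use \<kappa> kb in \<open>auto split: split_indicator\<close>)
    have Sint: "integrable lebesgue (indicat_real S)" using S by (simp add: lmeasurable_iff_integrable)
    have c: "\<bar>c - 1\<bar> \<le> l * (1 / Suc m)"
    proof -
      have "1 - c = (LINT s|lebesgue. indicator S s * k s - indicator S s * \<kappa> s)"
        unfolding c_def using kint \<kappa>int by simp
      moreover have "\<dots> \<le> (LINT s|lebesgue. indicator S s * (1 / Suc m))"
        using kint \<kappa>int Sint \<kappa>(3) by (intro integral_mono) (auto split: split_indicator)
      moreover have "\<dots> = l * (1 / Suc m)" by (simp add: l_def)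
      moreover have "0 \<le> (LINT s|lebesgue. indicator S s * k s - indicator S s * \<kappa> s)"
        using \<kappa>(2) by (intro integral_nonneg_AE) (auto split: split_indicator)
      ultimately show ?thesis by linarith
    qed
    define Y where "Y s x = G j s x - \<kappa> s * w x" for s x
    have Ys: "simple_function lebesgue Y"
    proof -
      have "simple_function lebesgue (\<lambda>s. (\<lambda>u c x. u x - c * w x) (G j s) (\<kappa> s))"
        using G(1) \<kappa>s by (rule simple_function_compose2[where h = "\<lambda>u c x. u x - c * w x"])
      then show ?thesis by (simp add: Y_def[abs_def])
    qed
    have YD: "Y s \<in> D" for s unfolding Y_def[abs_def] by (intro D_diff D_cmult G w)
    have Yint: "(LINT s|lebesgue. indicator S s * Y s x) = y j x - c * w x" for x
    proof -
      have Ei: "integrable lebesgue (indicat_real (E j i))" if "i < n j" for i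
        using fmeasurableI2[OF S] E[OF that] by (simp add: lmeasurable_iff_integrable)
      have "indicator S s * Y s x = (\<Sum>i<n j. indicator (E j i) s * V j i x) - (indicator S s * \<kappa> s) * w x" for s
      proof -
        have "indicator S s * G j s x = G j s x"
        proof (cases "s \<in> S")
          case False
          then have "G j s x = 0" unfolding G_def simple_fn_def using E by (intro sum.neutral) (auto simp: indicator_def)
          then show ?thesis by simp
        qed auto
        then show ?thesis by (simp add: Y_def right_diff_distrib G_def simple_fn_def)
      qed
      then have "(LINT s|lebesgue. indicator S s * Y s x)
          = (LINT s|lebesgue. (\<Sum>i<n j. indicator (E j i) s * V j i x) - (indicator S s * \<kappa> s) * w x)" by simp
      also have "\<dots> = (LINT s|lebesgue. (\<Sum>i<n j. indicator (E j i) s * V j i x)) - (LINT s|lebesgue. (indicator S s * \<kappa> s) * w x)"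
        using Ei \<kappa>int by (intro Bochner_Integration.integral_diff Bochner_Integration.integrable_sum integrable_mult_left) auto
      also have "(LINT s|lebesgue. (\<Sum>i<n j. indicator (E j i) s * V j i x)) = (\<Sum>i<n j. LINT s|lebesgue. indicator (E j i) s * V j i x)"
        using Ei by (intro Bochner_Integration.integral_sum integrable_mult_left) auto
      also have "\<dots> = y j x" by (simp add: y_def)
      also have "(LINT s|lebesgue. (indicator S s * \<kappa> s) * w x) = c * w x" by (simp add: c_def)
      finally show ?thesis .
    qed
    \<comment> \<open>The \<open>G j\<close> are known to converge to \<open>h\<close> only in mean,
      so measurability is drawn from the other family \<open>T\<close>, which converges almost
      everywhere.\<close>
    have qm[measurable]: "(\<lambda>s. indicator S s * Q (\<lambda>x. G j s x - h s x)) \<in> borel_measurable lebesgue"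
      by (rule measurable_Q_limit[OF T h G]) simp
    have "ennreal (Q (\<lambda>x. y j x - c * w x)) \<le> (\<integral>\<^sup>+ s\<in>S. ennreal (Q (Y s)) \<partial>lebesgue)"
      using Q_integral_simple[OF Ys YD S] by (simp add: Yint)
    also have "\<dots> \<le> (\<integral>\<^sup>+ s. ennreal (indicator S s * Q (\<lambda>x. G j s x - h s x)) + ennreal (k s * b s) * indicator S s
        + ennreal (1 / Suc m * Q w) * indicator S s \<partial>lebesgue)"
    proof (rule nn_integral_mono_AE, use h hb in eventually_elim)
      fix s assume hs: "s \<in> S \<longrightarrow> h s \<in> D \<and> (\<lambda>j. Q (\<lambda>x. T j s x - h s x)) \<longlonglongrightarrow> 0"
        and hb: "s \<in> S \<longrightarrow> Q (\<lambda>x. h s x - k s * w x) \<le> k s * b s"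
      show "ennreal (Q (Y s)) * indicator S s \<le> ennreal (indicator S s * Q (\<lambda>x. G j s x - h s x)) + ennreal (k s * b s) * indicator S s
        + ennreal (1 / Suc m * Q w) * indicator S s"
      proof (cases "s \<in> S")
        case True
        then have hD: "h s \<in> D" using hs by auto
        have "Q (Y s) \<le> Q (\<lambda>x. G j s x - h s x) + Q (\<lambda>x. h s x - \<kappa> s * w x)"
          unfolding Y_def[abs_def] by (intro Q_triangle G hD D_cmult w)
        also have "Q (\<lambda>x. h s x - \<kappa> s * w x) \<le> Q (\<lambda>x. h s x - k s * w x) + Q (\<lambda>x. k s * w x - \<kappa> s * w x)"
          by (intro Q_triangle hD D_cmult w)
        also have "(\<lambda>x. k s * w x - \<kappa> s * w x) = (\<lambda>x. (k s - \<kappa> s) * w x)" by (simp add: left_diff_distrib)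
        also have "Q (\<lambda>x. (k s - \<kappa> s) * w x) \<le> \<bar>k s - \<kappa> s\<bar> * Q w" by (rule Q_cmult[OF w])
        also have "\<dots> \<le> 1 / Suc m * Q w" using \<kappa>(2,3)[of s] Q_nonneg by (intro mult_right_mono) auto
        also have "Q (\<lambda>x. h s x - k s * w x) \<le> k s * b s" using hb True by simp
        finally have "Q (Y s) \<le> Q (\<lambda>x. G j s x - h s x) + k s * b s + 1 / Suc m * Q w" by simp
        then have "ennreal (Q (Y s)) \<le> ennreal (Q (\<lambda>x. G j s x - h s x) + k s * b s + 1 / Suc m * Q w)"
          by (rule ennreal_leI)
        also have "\<dots> = ennreal (Q (\<lambda>x. G j s x - h s x)) + ennreal (k s * b s) + ennreal (1 / Suc m * Q w)"
          using Q_nonneg kb b0 by (subst ennreal_plus; auto)+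
        finally show ?thesis using True by simp
      qed auto
    qed
    also have "\<dots> = (\<integral>\<^sup>+ s. ennreal (indicator S s * Q (\<lambda>x. G j s x - h s x)) \<partial>lebesgue) + L + (\<integral>\<^sup>+ s. ennreal (1 / Suc m * Q w) * indicator S s \<partial>lebesgue)"
      unfolding L_def by (subst nn_integral_add, measurable)+
    also have "(\<integral>\<^sup>+ s. ennreal (indicator S s * Q (\<lambda>x. G j s x - h s x)) \<partial>lebesgue) = \<alpha> j"
      unfolding \<alpha>_def by (intro nn_integral_cong) (auto split: split_indicator)
    also have "(\<integral>\<^sup>+ s. ennreal (1 / Suc m * Q w) * indicator S s \<partial>lebesgue) = ennreal (1 / Suc m * Q w) * emeasure lebesgue S"
      by (rule nn_integral_cmult_indicator) simp
    also have "\<dots> = ennreal (l * Q w * (1 / Suc m))"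
      using S Q_nonneg[of w] by (simp add: emeasure_eq_measure2 l_def ennreal_mult[symmetric] ac_simps)
    finally have mid: "ennreal (Q (\<lambda>x. y j x - c * w x)) \<le> \<alpha> j + L + ennreal (l * Q w * (1 / Suc m))" .
    have "Q (\<lambda>x. v x - w x) \<le> Q (\<lambda>x. v x - y j x) + Q (\<lambda>x. y j x - w x)" by (rule Q_triangle[OF v y w])
    also have "Q (\<lambda>x. v x - y j x) = Q (\<lambda>x. y j x - v x)" by (rule Q_minus_commute[OF v y])
    also have "Q (\<lambda>x. y j x - w x) \<le> Q (\<lambda>x. y j x - c * w x) + Q (\<lambda>x. c * w x - w x)"
      by (intro Q_triangle y D_cmult w)
    also have "(\<lambda>x. c * w x - w x) = (\<lambda>x. (c - 1) * w x)" by (simp add: left_diff_distrib)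
    also have "Q (\<lambda>x. (c - 1) * w x) \<le> \<bar>c - 1\<bar> * Q w" by (rule Q_cmult[OF w])
    also have "\<dots> \<le> (l * (1 / Suc m)) * Q w" using c Q_nonneg by (rule mult_right_mono)
    finally have "Q (\<lambda>x. v x - w x) \<le> Q (\<lambda>x. y j x - v x) + Q (\<lambda>x. y j x - c * w x) + l * Q w * (1 / Suc m)"
      by (simp add: ac_simps)
    then have "ennreal (Q (\<lambda>x. v x - w x)) \<le> ennreal (Q (\<lambda>x. y j x - v x) + Q (\<lambda>x. y j x - c * w x) + l * Q w * (1 / Suc m))"
      by (rule ennreal_leI)
    also have "\<dots> = ennreal (Q (\<lambda>x. y j x - v x)) + ennreal (Q (\<lambda>x. y j x - c * w x)) + ennreal (l * Q w * (1 / Suc m))"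
      using Q_nonneg by (subst ennreal_plus; auto simp: l_def)+
    also have "\<dots> \<le> ennreal (Q (\<lambda>x. y j x - v x)) + (\<alpha> j + L + ennreal (l * Q w * (1 / Suc m))) + ennreal (l * Q w * (1 / Suc m))"
      using mid by (intro add_mono) auto
    finally show ?thesis .
  qed
  \<comment> \<open>First \<open>j\<close> tends to infinity at fixed \<open>m\<close>, which
    removes the errors of the Bochner approximation; then \<open>m\<close> does.\<close>
  have "ennreal (Q (\<lambda>x. v x - w x)) \<le> L + ennreal (l * Q w * (1 / Suc m)) + ennreal (l * Q w * (1 / Suc m))" for m
  proof -
    have "(\<lambda>j. ennreal (Q (\<lambda>x. y j x - v x)) + (\<alpha> j + L + ennreal (l * Q w * (1 / Suc m))) + ennreal (l * Q w * (1 / Suc m)))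
       \<longlonglongrightarrow> ennreal 0 + (0 + L + ennreal (l * Q w * (1 / Suc m))) + ennreal (l * Q w * (1 / Suc m))"
      using lim1 lim2 unfolding \<alpha>_def G_def y_def by (intro tendsto_intros tendsto_ennrealI)
    then show ?thesis
      using main[of _ m] by (intro LIMSEQ_le_const[where X = "\<lambda>j. ennreal (Q (\<lambda>x. y j x - v x)) + (\<alpha> j + L + ennreal (l * Q w * (1 / Suc m))) + ennreal (l * Q w * (1 / Suc m))"]) auto
  qed
  moreover have "(\<lambda>m. L + ennreal (l * Q w * (1 / Suc m)) + ennreal (l * Q w * (1 / Suc m))) \<longlonglongrightarrow> L + ennreal (l * Q w * 0) + ennreal (l * Q w * 0)"
    by (intro tendsto_intros tendsto_ennrealI LIMSEQ_Suc[OF lim_1_over_n])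
  ultimately show ?thesis unfolding L_def[symmetric]
    using LIMSEQ_le_const[of "\<lambda>m. L + ennreal (l * Q w * (1 / Suc m)) + ennreal (l * Q w * (1 / Suc m))"] by auto
qed

end

section \<open>Translations and mollifications\<close>

sublocale borel_domain \<subseteq> function_seminorm dirichlet seminorm
  by unfold_locales
    (auto intro: dirichlet_0 dirichlet_add dirichlet_cmult seminorm_nonneg seminorm_add seminorm_cmult)

lemma tendsto_0_ennrealI:
  fixes g :: "'b \<Rightarrow> ennreal"
  assumes "\<And>e::real. 0 < e \<Longrightarrow> \<forall>\<^sub>F x in F. g x \<le> ennreal e"
  shows "(g \<longlongrightarrow> 0) F"
proof (rule order_tendstoI)
  fix c :: ennreal assume "0 < c"
  then obtain z where z: "0 < z" "z < c" using dense by blast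
  then obtain r where r: "z = ennreal r" "0 \<le> r" by (cases z) auto
  then have "0 < r" using z by (simp add: ennreal_less_zero_iff)
  from assms[OF this] show "\<forall>\<^sub>F x in F. g x < c"
    by (rule eventually_mono) (use r z in auto)
qed simp

lemma moll_kernel:
  assumes eta: "std_mollifier \<eta>" and \<epsilon>: "0 < \<epsilon>"
  shows "moll_kernel \<eta> \<epsilon> \<in> borel_measurable borel" "0 \<le> moll_kernel \<eta> \<epsilon> s"
    "\<exists>M. \<forall>s. moll_kernel \<eta> \<epsilon> s \<le> M" "s \<notin> {-\<epsilon>..\<epsilon>} \<Longrightarrow> moll_kernel \<eta> \<epsilon> s = 0"
    "(\<integral>\<^sup>+ s. ennreal (moll_kernel \<eta> \<epsilon> s) \<partial>lborel) = 1"
proof -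
  have "((deriv ^^ 0) \<eta>) differentiable (at x)" for x
    using eta unfolding std_mollifier_def by blast
  then have "continuous_on UNIV \<eta>"
    by (auto intro!: differentiable_imp_continuous_on simp: differentiable_on_def)
  moreover from this have [measurable]: "\<eta> \<in> borel_measurable borel" by (rule borel_measurable_continuous_onI)
  ultimately have cont: "continuous_on UNIV \<eta>" and m: "\<eta> \<in> borel_measurable borel" by auto
  have \<eta>: "0 \<le> \<eta> x" "1 < \<bar>x\<bar> \<Longrightarrow> \<eta> x = 0" "(\<eta> has_integral 1) UNIV" for x
    using eta unfolding std_mollifier_def by auto
  show "moll_kernel \<eta> \<epsilon> \<in> borel_measurable borel" unfolding moll_kernel_def[abs_def] by measurable
  show "0 \<le> moll_kernel \<eta> \<epsilon> s" unfolding moll_kernel_def using \<eta> \<epsilon> by simp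
  show "moll_kernel \<eta> \<epsilon> s = 0" if "s \<notin> {-\<epsilon>..\<epsilon>}"
  proof -
    have "1 < \<bar>s / \<epsilon>\<bar>" using that \<epsilon> by (auto simp: abs_if field_simps)
    then show ?thesis unfolding moll_kernel_def using \<eta>(2) by simp
  qed
  have "bounded (\<eta> ` {-1..1})"
    by (intro compact_imp_bounded compact_continuous_image continuous_on_subset[OF cont]) auto
  then obtain M where M: "\<And>x. x \<in> {-1..1} \<Longrightarrow> \<bar>\<eta> x\<bar> \<le> M"
    unfolding bounded_iff by (auto simp del: atLeastAtMost_iff)
  have "\<eta> x \<le> max M 0" for x
  proof (cases "x \<in> {-1..1}")
    case True
    then show ?thesis using M[OF True] by auto
  next
    case False
    then have "1 < \<bar>x\<bar>" by auto
    then show ?thesis using \<eta>(2) by simp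
  qed
  then show "\<exists>M. \<forall>s. moll_kernel \<eta> \<epsilon> s \<le> M"
    unfolding moll_kernel_def using \<epsilon> by (auto intro!: exI[of _ "max M 0 / \<epsilon>"] divide_right_mono)
  have "(\<integral>\<^sup>+ s. ennreal (\<eta> s) \<partial>lborel) = ennreal 1"
    by (rule nn_integral_has_integral_lborel[OF m \<eta>(1,3)])
  moreover have "(\<integral>\<^sup>+ s. ennreal (\<eta> s) \<partial>lborel) = ennreal (1 / \<epsilon>) * (\<integral>\<^sup>+ s. ennreal (\<eta> (s / \<epsilon>)) \<partial>lborel)"
    using nn_integral_real_affine[of "\<lambda>s. ennreal (\<eta> s)" "1 / \<epsilon>" 0] \<epsilon> by simp
  moreover have "\<dots> = (\<integral>\<^sup>+ s. ennreal (moll_kernel \<eta> \<epsilon> s) \<partial>lborel)"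
    using \<epsilon> \<eta> by (subst nn_integral_cmult[symmetric]) (auto simp: moll_kernel_def simp flip: ennreal_mult)
  ultimately show "(\<integral>\<^sup>+ s. ennreal (moll_kernel \<eta> \<epsilon> s) \<partial>lborel) = 1" by simp
qed

section \<open>Convergence of translations and mollifications on a fixed domain\<close>

context borel_domain
begin

lemma N1p_strongly_measurable_simple:
  assumes "N1p_strongly_measurable \<mu> U p S h"
  obtains n E V where "\<And>k i. i < n k \<Longrightarrow> E k i \<in> sets lebesgue \<and> V k i \<in> dirichlet"
    "AE s in lebesgue. s \<in> S \<longrightarrow> h s \<in> dirichlet \<and> (\<lambda>k. seminorm (\<lambda>x. simple_fn (n k) (E k) (V k) s x - h s x)) \<longlonglongrightarrow> 0"
proof -
  from assms obtain n E V where EV: "\<And>k i. i < n k \<Longrightarrow> E k i \<in> sets lebesgue \<and> in_N1p \<mu> U p (V k i)"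
    and h: "AE s in lebesgue. s \<in> S \<longrightarrow> in_N1p \<mu> U p (h s)"
    and lim: "AE s in lebesgue. s \<in> S \<longrightarrow> (\<lambda>k. N1p_norm \<mu> U p (\<lambda>x. simple_fn (n k) (E k) (V k) s x - h s x)) \<longlonglongrightarrow> 0"
    unfolding N1p_strongly_measurable_def by blast
  show thesis
  proof (rule that)
    show EV': "E k i \<in> sets lebesgue \<and> V k i \<in> dirichlet" if "i < n k" for k i
      using EV[OF that] in_N1p_dirichlet by auto
    show "AE s in lebesgue. s \<in> S \<longrightarrow> h s \<in> dirichlet \<and> (\<lambda>k. seminorm (\<lambda>x. simple_fn (n k) (E k) (V k) s x - h s x)) \<longlonglongrightarrow> 0"
      using h lim
    proof eventually_elim
      case (elim s)
      show ?case
      proof (intro impI conjI)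
        assume s: "s \<in> S"
        then show hD: "h s \<in> dirichlet" using elim in_N1p_dirichlet by auto
        have "(\<lambda>k. ennreal (seminorm (\<lambda>x. simple_fn (n k) (E k) (V k) s x - h s x))) \<longlonglongrightarrow> 0"
        proof (rule tendsto_sandwich[OF _ _ tendsto_const])
          show "\<forall>\<^sub>F k in sequentially. ennreal (seminorm (\<lambda>x. simple_fn (n k) (E k) (V k) s x - h s x))
              \<le> N1p_norm \<mu> U p (\<lambda>x. simple_fn (n k) (E k) (V k) s x - h s x)"
            using EV' by (intro always_eventually allI seminorm_le_N1p_norm D_diff hD simple_fn_in_D) auto
          show "(\<lambda>k. N1p_norm \<mu> U p (\<lambda>x. simple_fn (n k) (E k) (V k) s x - h s x)) \<longlonglongrightarrow> 0"
            using elim s by auto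
        qed auto
        then show "(\<lambda>k. seminorm (\<lambda>x. simple_fn (n k) (E k) (V k) s x - h s x)) \<longlonglongrightarrow> 0"
          using seminorm_nonneg by (simp add: ennreal_tendsto_0_iff)
      qed
    qed
  qed
qed

lemma in_Lp_N1p_seminorm_finite:
  assumes "in_Lp_N1p \<mu> U p S f"
  shows "(\<integral>\<^sup>+ s\<in>S. ennreal (seminorm (f s) powr p) \<partial>lebesgue) < \<infinity>"
proof -
  from assms have f: "AE s in lebesgue. s \<in> S \<longrightarrow> in_N1p \<mu> U p (f s)"
    and fin: "(\<integral>\<^sup>+ s\<in>S. epow (N1p_norm \<mu> U p (f s)) p \<partial>lebesgue) < \<infinity>"
    unfolding in_Lp_N1p_def N1p_strongly_measurable_def by auto
  have "(\<integral>\<^sup>+ s\<in>S. ennreal (seminorm (f s) powr p) \<partial>lebesgue) \<le> (\<integral>\<^sup>+ s\<in>S. epow (N1p_norm \<mu> U p (f s)) p \<partial>lebesgue)"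
  proof (rule nn_integral_mono_AE, use f in eventually_elim)
    fix s assume s: "s \<in> S \<longrightarrow> in_N1p \<mu> U p (f s)"
    show "ennreal (seminorm (f s) powr p) * indicator S s \<le> epow (N1p_norm \<mu> U p (f s)) p * indicator S s"
    proof (cases "s \<in> S")
      case True
      then have "ennreal (seminorm (f s)) \<le> N1p_norm \<mu> U p (f s)"
        using s in_N1p_dirichlet by (intro seminorm_le_N1p_norm) auto
      then have "epow (ennreal (seminorm (f s))) p \<le> epow (N1p_norm \<mu> U p (f s)) p"
        by (rule epow_mono) (use p_pos in simp)
      then show ?thesis using True seminorm_nonneg by (simp add: epow_ennreal)
    qed auto
  qed
  also note fin
  finally show ?thesis .
qed

lemma seminorm_bochner_le:
  fixes h :: "real \<Rightarrow> 'a \<Rightarrow> real"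
  assumes bi: "N1p_bochner_integral \<mu> U p S h v" and S: "S \<in> lmeasurable" and w: "w \<in> dirichlet"
    and k: "k \<in> borel_measurable borel" "\<And>s. 0 \<le> k s" "\<And>s. k s \<le> M"
    and k1: "(\<integral>\<^sup>+ s\<in>S. ennreal (k s) \<partial>lebesgue) = 1"
    and b: "b \<in> borel_measurable borel" "\<And>s. 0 \<le> b s"
    and hb: "AE s in lebesgue. s \<in> S \<longrightarrow> seminorm (\<lambda>x. h s x - k s * w x) \<le> k s * b s"
  shows "ennreal (seminorm (\<lambda>x. v x - w x)) \<le> (\<integral>\<^sup>+ s\<in>S. ennreal (k s * b s) \<partial>lebesgue)"
proof -
  from bi have v: "v \<in> dirichlet" and sm: "N1p_strongly_measurable \<mu> U p S h"
    unfolding N1p_bochner_integral_def using in_N1p_dirichlet by auto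
  from bi obtain n E V where EV: "\<And>j i. i < n j \<Longrightarrow> E j i \<in> sets lebesgue \<and> E j i \<subseteq> S \<and> in_N1p \<mu> U p (V j i)"
    and l1: "(\<lambda>j. \<integral>\<^sup>+ s\<in>S. N1p_norm \<mu> U p (\<lambda>x. simple_fn (n j) (E j) (V j) s x - h s x) \<partial>lebesgue) \<longlonglongrightarrow> 0"
    and l2: "(\<lambda>j. N1p_norm \<mu> U p (\<lambda>x. (\<Sum>i<n j. measure lebesgue (E j i) * V j i x) - v x)) \<longlonglongrightarrow> 0"
    unfolding N1p_bochner_integral_def by blast
  have EV': "E j i \<in> sets lebesgue \<and> E j i \<subseteq> S \<and> V j i \<in> dirichlet" if "i < n j" for i j
    using EV[OF that] in_N1p_dirichlet by auto
  obtain n' E' V' where T: "\<And>k i. i < n' k \<Longrightarrow> E' k i \<in> sets lebesgue \<and> V' k i \<in> dirichlet"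
    and h: "AE s in lebesgue. s \<in> S \<longrightarrow> h s \<in> dirichlet \<and> (\<lambda>k. seminorm (\<lambda>x. simple_fn (n' k) (E' k) (V' k) s x - h s x)) \<longlonglongrightarrow> 0"
    using N1p_strongly_measurable_simple[OF sm] by blast
  show ?thesis
  proof (rule Q_bochner_le[OF S w v k k1 _ _ h EV' _ _ b hb])
    show "simple_function lebesgue (simple_fn (n' j) (E' j) (V' j))" for j
      using T by (intro simple_function_simple_fn) auto
    show "simple_fn (n' j) (E' j) (V' j) s \<in> dirichlet" for j s
      using T by (intro simple_fn_in_D) auto
    show "(\<lambda>j. \<integral>\<^sup>+ s\<in>S. ennreal (seminorm (\<lambda>x. simple_fn (n j) (E j) (V j) s x - h s x)) \<partial>lebesgue) \<longlonglongrightarrow> 0"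
    proof (rule tendsto_sandwich[OF _ _ tendsto_const l1])
      show "\<forall>\<^sub>F j in sequentially. (\<integral>\<^sup>+ s\<in>S. ennreal (seminorm (\<lambda>x. simple_fn (n j) (E j) (V j) s x - h s x)) \<partial>lebesgue)
         \<le> (\<integral>\<^sup>+ s\<in>S. N1p_norm \<mu> U p (\<lambda>x. simple_fn (n j) (E j) (V j) s x - h s x) \<partial>lebesgue)"
      proof (rule always_eventually, rule allI, rule nn_integral_mono_AE, use h in eventually_elim)
        fix j s assume "s \<in> S \<longrightarrow> h s \<in> dirichlet \<and> (\<lambda>k. seminorm (\<lambda>x. simple_fn (n' k) (E' k) (V' k) s x - h s x)) \<longlonglongrightarrow> 0"
        then show "ennreal (seminorm (\<lambda>x. simple_fn (n j) (E j) (V j) s x - h s x)) * indicator S s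
           \<le> N1p_norm \<mu> U p (\<lambda>x. simple_fn (n j) (E j) (V j) s x - h s x) * indicator S s"
          using EV' by (cases "s \<in> S") (auto intro!: seminorm_le_N1p_norm D_diff simple_fn_in_D)
      qed
    qed auto
    have "(\<lambda>j. ennreal (seminorm (\<lambda>x. (\<Sum>i<n j. measure lebesgue (E j i) * V j i x) - v x))) \<longlonglongrightarrow> 0"
    proof (rule tendsto_sandwich[OF _ _ tendsto_const l2])
      show "\<forall>\<^sub>F j in sequentially. ennreal (seminorm (\<lambda>x. (\<Sum>i<n j. measure lebesgue (E j i) * V j i x) - v x))
         \<le> N1p_norm \<mu> U p (\<lambda>x. (\<Sum>i<n j. measure lebesgue (E j i) * V j i x) - v x)"
        using EV' v by (intro always_eventually allI seminorm_le_N1p_norm D_diff D_sum) auto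
    qed auto
    then show "(\<lambda>j. seminorm (\<lambda>x. (\<Sum>i<n j. measure lebesgue (E j i) * V j i x) - v x)) \<longlonglongrightarrow> 0"
      using seminorm_nonneg by (simp add: ennreal_tendsto_0_iff)
  qed
qed

lemma in_Lp_N1p_translation_bound:
  assumes f: "in_Lp_N1p \<mu> U p {a..b} f" and e: "0 < e"
  obtains d :: real and Z :: "real set" and \<beta> :: "real \<Rightarrow> real \<Rightarrow> real" where
    "0 < d" "Z \<in> null_sets lborel" "(\<lambda>(t, s). \<beta> t s) \<in> borel_measurable (borel \<Otimes>\<^sub>M borel)" "\<And>t s. 0 \<le> \<beta> t s"
    "\<And>s. \<bar>s\<bar> < d \<Longrightarrow> (\<integral>\<^sup>+ t. ennreal (\<beta> t s powr p) \<partial>lborel) \<le> ennreal e"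
    "\<And>t. t \<in> {a..b} \<Longrightarrow> t \<notin> Z \<Longrightarrow> f t \<in> dirichlet"
    "\<And>t s. t \<in> {a..b} \<Longrightarrow> t \<notin> Z \<Longrightarrow> t - s \<in> {a..b} \<Longrightarrow> t - s \<notin> Z \<Longrightarrow> seminorm (\<lambda>x. f (t - s) x - f t x) \<le> \<beta> t s"
proof -
  have "N1p_strongly_measurable \<mu> U p {a..b} f" using f by (simp add: in_Lp_N1p_def)
  then obtain n E V where EV: "\<And>k i. i < n k \<Longrightarrow> E k i \<in> sets lebesgue \<and> V k i \<in> dirichlet"
    "AE s in lebesgue. s \<in> {a..b} \<longrightarrow> f s \<in> dirichlet \<and> (\<lambda>k. seminorm (\<lambda>x. simple_fn (n k) (E k) (V k) s x - f s x)) \<longlonglongrightarrow> 0"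
    using N1p_strongly_measurable_simple by blast
  show thesis
  proof (rule translation_bound[OF p_ge_1 EV in_Lp_N1p_seminorm_finite[OF f] e])
    fix d :: real and Z and \<beta> :: "real \<Rightarrow> real \<Rightarrow> real"
    assume "0 < d" "Z \<in> null_sets lborel" "(\<lambda>(t, s). \<beta> t s) \<in> borel_measurable (borel \<Otimes>\<^sub>M borel)" "\<And>t s. 0 \<le> \<beta> t s"
      "\<And>s. \<bar>s\<bar> < d \<Longrightarrow> (\<integral>\<^sup>+ t. ennreal (\<beta> t s powr p) \<partial>lborel) \<le> ennreal e"
      "\<And>t. t \<in> {a..b} \<Longrightarrow> t \<notin> Z \<Longrightarrow> f t \<in> dirichlet"
      "\<And>t s. t \<in> {a..b} \<Longrightarrow> t \<notin> Z \<Longrightarrow> t - s \<in> {a..b} \<Longrightarrow> t - s \<notin> Z \<Longrightarrow> seminorm (\<lambda>x. f (t - s) x - f t x) \<le> \<beta> t s"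
    then show thesis by (rule that)
  qed
qed

lemma translation_limit:
  assumes f: "in_Lp_N1p \<mu> U p {a'..b'} f" and ab: "a' < a" "a \<le> b" "b < b'"
  shows "((\<lambda>s. \<integral>\<^sup>+ t\<in>{a..b}. (\<integral>\<^sup>+ x\<in>U. epow (min_wug \<mu> U p (\<lambda>y. f (t - s) y - f t y) x) p \<partial>\<mu>) \<partial>lebesgue) \<longlongrightarrow> 0) (at 0)"
proof (rule tendsto_0_ennrealI)
  fix e :: real assume e: "0 < e"
  obtain d Z \<beta> where d: "0 < d" and Z: "Z \<in> null_sets lborel"
    and \<beta>m: "(\<lambda>(t, s). \<beta> t s) \<in> borel_measurable (borel \<Otimes>\<^sub>M borel)" and \<beta>0: "\<And>t s. 0 \<le> \<beta> t s"
    and \<beta>: "\<And>s. \<bar>s\<bar> < d \<Longrightarrow> (\<integral>\<^sup>+ t. ennreal (\<beta> t s powr p) \<partial>lborel) \<le> ennreal e"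
    and fD: "\<And>t. t \<in> {a'..b'} \<Longrightarrow> t \<notin> Z \<Longrightarrow> f t \<in> dirichlet"
    and le: "\<And>t s. t \<in> {a'..b'} \<Longrightarrow> t \<notin> Z \<Longrightarrow> t - s \<in> {a'..b'} \<Longrightarrow> t - s \<notin> Z \<Longrightarrow> seminorm (\<lambda>x. f (t - s) x - f t x) \<le> \<beta> t s"
    by (rule in_Lp_N1p_translation_bound[OF f e]) blast
  \<comment> \<open>Below \<open>d\<close> the majorant is small; below the two margins
    \<open>t - s\<close> stays in \<open>{a'..b'}\<close> for every \<open>t\<close> in
    \<open>{a..b}\<close>.\<close>
  define r where "r = min d (min (a - a') (b' - b))"
  have r: "0 < r" using d ab by (auto simp: r_def)
  have "(\<integral>\<^sup>+ t\<in>{a..b}. (\<integral>\<^sup>+ x\<in>U. epow (min_wug \<mu> U p (\<lambda>y. f (t - s) y - f t y) x) p \<partial>\<mu>) \<partial>lebesgue) \<le> ennreal e"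
    if s: "\<bar>s\<bar> < r" for s
  proof -
    have "(\<integral>\<^sup>+ t\<in>{a..b}. (\<integral>\<^sup>+ x\<in>U. epow (min_wug \<mu> U p (\<lambda>y. f (t - s) y - f t y) x) p \<partial>\<mu>) \<partial>lborel)
       \<le> (\<integral>\<^sup>+ t. ennreal (\<beta> t s powr p) \<partial>lborel)"
    proof (rule nn_integral_mono_AE, use AE_not_in[OF Z] lborel_null_reflect_translate(2)[OF Z, of s] in eventually_elim)
      fix t assume tZ: "t \<notin> Z" "t - s \<notin> Z"
      show "(\<integral>\<^sup>+ x\<in>U. epow (min_wug \<mu> U p (\<lambda>y. f (t - s) y - f t y) x) p \<partial>\<mu>) * indicator {a..b} t \<le> ennreal (\<beta> t s powr p)"
      proof (cases "t \<in> {a..b}")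
        case True
        then have t: "t \<in> {a'..b'}" "t - s \<in> {a'..b'}" using s ab by (auto simp: r_def)
        have "(\<lambda>y. f (t - s) y - f t y) \<in> dirichlet" using fD t tZ by (intro D_diff) auto
        then have "(\<integral>\<^sup>+ x\<in>U. epow (min_wug \<mu> U p (\<lambda>y. f (t - s) y - f t y) x) p \<partial>\<mu>) = ennreal (seminorm (\<lambda>y. f (t - s) y - f t y) powr p)"
          by (rule integral_min_wug)
        also have "\<dots> \<le> ennreal (\<beta> t s powr p)"
          using le[OF t(1) tZ(1) t(2) tZ(2)] p_pos seminorm_nonneg by (intro ennreal_leI powr_mono2) auto
        finally show ?thesis using True by simp
      qed auto
    qed
    also have "\<dots> \<le> ennreal e" using s by (intro \<beta>) (auto simp: r_def)
    finally show ?thesis by (simp add: nn_integral_completion)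
  qed
  then show "\<forall>\<^sub>F s in at 0. (\<integral>\<^sup>+ t\<in>{a..b}. (\<integral>\<^sup>+ x\<in>U. epow (min_wug \<mu> U p (\<lambda>y. f (t - s) y - f t y) x) p \<partial>\<mu>) \<partial>lebesgue) \<le> ennreal e"
    using r unfolding eventually_at by (intro exI[of _ r]) (auto simp: dist_real_def)
qed

text \<open>\<open>F \<epsilon> t\<close> is prescribed separately for each \<open>t\<close>, so
  nothing is assumed about its dependence on \<open>t\<close>. The bound is therefore made at fixed
  \<open>t\<close>, in terms of the jointly Borel \<beta>, before integrating in time.\<close>

lemma mollification_limit:
  assumes f: "in_Lp_N1p \<mu> U p {a'..b'} f" and ab: "a' < a" "a \<le> b" "b < b'"
    and eta: "std_mollifier \<eta>"
    and F: "\<And>\<epsilon> t. 0 < \<epsilon> \<Longrightarrow> a' \<le> t - \<epsilon> \<Longrightarrow> t + \<epsilon> \<le> b' \<Longrightarrow>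
        N1p_bochner_integral \<mu> U p {-\<epsilon>..\<epsilon>} (\<lambda>s x. moll_kernel \<eta> \<epsilon> s * f (t - s) x) (F \<epsilon> t)"
  shows "((\<lambda>\<epsilon>. \<integral>\<^sup>+ t\<in>{a..b}. (\<integral>\<^sup>+ x\<in>U. epow (min_wug \<mu> U p (\<lambda>y. F \<epsilon> t y - f t y) x) p \<partial>\<mu>) \<partial>lebesgue) \<longlongrightarrow> 0) (at_right 0)"
proof (rule tendsto_0_ennrealI)
  fix e :: real assume e: "0 < e"
  obtain d Z \<beta> where d: "0 < d" and Z: "Z \<in> null_sets lborel"
    and \<beta>m: "(\<lambda>(t, s). \<beta> t s) \<in> borel_measurable (borel \<Otimes>\<^sub>M borel)" and \<beta>0: "\<And>t s. 0 \<le> \<beta> t s"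
    and \<beta>: "\<And>s. \<bar>s\<bar> < d \<Longrightarrow> (\<integral>\<^sup>+ t. ennreal (\<beta> t s powr p) \<partial>lborel) \<le> ennreal e"
    and fD: "\<And>t. t \<in> {a'..b'} \<Longrightarrow> t \<notin> Z \<Longrightarrow> f t \<in> dirichlet"
    and le: "\<And>t s. t \<in> {a'..b'} \<Longrightarrow> t \<notin> Z \<Longrightarrow> t - s \<in> {a'..b'} \<Longrightarrow> t - s \<notin> Z \<Longrightarrow> seminorm (\<lambda>x. f (t - s) x - f t x) \<le> \<beta> t s"
    by (rule in_Lp_N1p_translation_bound[OF f e]) blast
  have [measurable]: "(\<lambda>x. \<beta> (fst x) (snd x)) \<in> borel_measurable (borel \<Otimes>\<^sub>M borel)"
    using \<beta>m by (simp add: case_prod_unfold)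
  have \<beta>t[measurable]: "\<beta> t \<in> borel_measurable borel" for t
    using measurable_compose[OF measurable_Pair1'[of t borel borel] \<beta>m] by simp
  have \<beta>s[measurable]: "(\<lambda>t. \<beta> t s) \<in> borel_measurable borel" for s
    using measurable_compose[OF measurable_Pair2'[of s borel borel] \<beta>m] by simp
  define r where "r = min d (min (a - a') (b' - b))"
  have r: "0 < r" using d ab by (auto simp: r_def)
  have "(\<integral>\<^sup>+ t\<in>{a..b}. (\<integral>\<^sup>+ x\<in>U. epow (min_wug \<mu> U p (\<lambda>y. F \<epsilon> t y - f t y) x) p \<partial>\<mu>) \<partial>lebesgue) \<le> ennreal e"
    if \<epsilon>: "0 < \<epsilon>" "\<epsilon> < r" for \<epsilon>
  proof -
    let ?k = "moll_kernel \<eta> \<epsilon>" and ?S = "{-\<epsilon>..\<epsilon>}"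
    note k = moll_kernel[OF eta \<epsilon>(1)]
    note [measurable] = k(1)
    obtain M where M: "\<And>s. ?k s \<le> M" using k(3) by blast
    \<comment> \<open>The kernel vanishes off the window, so integrals over the window are integrals
      over the line; this puts them in the form required for Jensen and Tonelli.\<close>
    have k_ind: "ennreal (?k s * c) * indicator ?S s = ennreal (?k s * c)" "ennreal (?k s) * indicator ?S s = ennreal (?k s)" for s c
      using k(4)[of s] by (auto split: split_indicator)
    have pt: "ennreal (seminorm (\<lambda>y. F \<epsilon> t y - f t y) powr p) \<le> (\<integral>\<^sup>+ s. ennreal (?k s * \<beta> t s powr p) \<partial>lborel)
       \<and> (\<lambda>y. F \<epsilon> t y - f t y) \<in> dirichlet" if t: "t \<in> {a..b}" "t \<notin> Z" for t
    proof
      have t': "t \<in> {a'..b'}" and ts: "\<And>s. s \<in> ?S \<Longrightarrow> t - s \<in> {a'..b'}" using t ab \<epsilon> by (auto simp: r_def)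
      have w: "f t \<in> dirichlet" by (rule fD[OF t' t(2)])
      have bi: "N1p_bochner_integral \<mu> U p ?S (\<lambda>s x. ?k s * f (t - s) x) (F \<epsilon> t)"
        using t \<epsilon> by (intro F) (auto simp: r_def)
      then have "F \<epsilon> t \<in> dirichlet" unfolding N1p_bochner_integral_def using in_N1p_dirichlet by auto
      then show "(\<lambda>y. F \<epsilon> t y - f t y) \<in> dirichlet" by (rule D_diff[OF _ w])
      have "ennreal (seminorm (\<lambda>x. F \<epsilon> t x - f t x)) \<le> (\<integral>\<^sup>+ s\<in>?S. ennreal (?k s * \<beta> t s) \<partial>lebesgue)"
      \<comment> \<open>Here \<open>w\<close> is \<open>f t\<close>, constant in \<open>s\<close>.
        The times \<open>s\<close> with \<open>t - s\<close> in \<open>Z\<close> form a null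
        set.\<close>
      proof (rule seminorm_bochner_le[OF bi _ w k(1,2) M _ \<beta>t \<beta>0])
        show "?S \<in> lmeasurable" by simp
        show "(\<integral>\<^sup>+ s\<in>?S. ennreal (?k s) \<partial>lebesgue) = 1"
          unfolding k_ind using k(5) by (simp add: nn_integral_completion)
        show "AE s in lebesgue. s \<in> ?S \<longrightarrow> seminorm (\<lambda>x. ?k s * f (t - s) x - ?k s * f t x) \<le> ?k s * \<beta> t s"
          unfolding AE_completion_iff
        proof (use lborel_null_reflect_translate(1)[OF Z, of t] in eventually_elim, rule impI)
          fix s assume sZ: "t - s \<notin> Z" and s: "s \<in> ?S"
          have "seminorm (\<lambda>x. ?k s * (f (t - s) x - f t x)) \<le> \<bar>?k s\<bar> * seminorm (\<lambda>x. f (t - s) x - f t x)"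
            using fD[OF ts[OF s] sZ] w by (intro Q_cmult D_diff)
          also have "\<dots> \<le> ?k s * \<beta> t s"
            using k(2)[of s] le[OF t' t(2) ts[OF s] sZ] by (simp add: mult_left_mono)
          finally show "seminorm (\<lambda>x. ?k s * f (t - s) x - ?k s * f t x) \<le> ?k s * \<beta> t s"
            by (simp add: right_diff_distrib)
        qed
      qed
      also have "\<dots> = (\<integral>\<^sup>+ s. ennreal (?k s * \<beta> t s) \<partial>lborel)"
        unfolding k_ind by (simp add: nn_integral_completion)
      finally show "ennreal (seminorm (\<lambda>y. F \<epsilon> t y - f t y) powr p) \<le> (\<integral>\<^sup>+ s. ennreal (?k s * \<beta> t s powr p) \<partial>lborel)"
        using k(2,5) \<beta>0 seminorm_nonneg by (intro powr_nn_integral_le p_ge_1) auto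
    qed
    have "(\<integral>\<^sup>+ t\<in>{a..b}. (\<integral>\<^sup>+ x\<in>U. epow (min_wug \<mu> U p (\<lambda>y. F \<epsilon> t y - f t y) x) p \<partial>\<mu>) \<partial>lborel)
       \<le> (\<integral>\<^sup>+ t. \<integral>\<^sup>+ s. ennreal (?k s * \<beta> t s powr p) \<partial>lborel \<partial>lborel)"
    proof (rule nn_integral_mono_AE, use AE_not_in[OF Z] in eventually_elim)
      fix t assume "t \<notin> Z"
      then show "(\<integral>\<^sup>+ x\<in>U. epow (min_wug \<mu> U p (\<lambda>y. F \<epsilon> t y - f t y) x) p \<partial>\<mu>) * indicator {a..b} t
        \<le> (\<integral>\<^sup>+ s. ennreal (?k s * \<beta> t s powr p) \<partial>lborel)"
        using pt[of t] by (cases "t \<in> {a..b}") (auto simp: integral_min_wug)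
    qed
    also have "\<dots> = (\<integral>\<^sup>+ s. \<integral>\<^sup>+ t. ennreal (?k s * \<beta> t s powr p) \<partial>lborel \<partial>lborel)"
      by (rule lborel_pair.Fubini'[symmetric]) (simp add: case_prod_unfold)
    also have "\<dots> \<le> (\<integral>\<^sup>+ s. ennreal (?k s) * ennreal e \<partial>lborel)"
    proof (rule nn_integral_mono)
      fix s
      have "(\<integral>\<^sup>+ t. ennreal (?k s * \<beta> t s powr p) \<partial>lborel) = ennreal (?k s) * (\<integral>\<^sup>+ t. ennreal (\<beta> t s powr p) \<partial>lborel)"
        using k(2) by (subst nn_integral_cmult[symmetric]) (auto simp: ennreal_mult)
      also have "\<dots> \<le> ennreal (?k s) * ennreal e"
      \<comment> \<open>The bound on \<beta> is available only for short shifts; beyond the window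
        the kernel is 0 and both sides vanish.\<close>
      proof (cases "s \<in> ?S")
        case True
        then show ?thesis using \<epsilon> by (intro mult_left_mono \<beta>) (auto simp: r_def)
      qed (simp add: k(4))
      finally show "(\<integral>\<^sup>+ t. ennreal (?k s * \<beta> t s powr p) \<partial>lborel) \<le> ennreal (?k s) * ennreal e" .
    qed
    also have "\<dots> = ennreal e" by (subst nn_integral_multc) (auto simp: k(5))
    finally show ?thesis by (simp add: nn_integral_completion)
  qed
  then show "\<forall>\<^sub>F \<epsilon> in at_right 0. (\<integral>\<^sup>+ t\<in>{a..b}. (\<integral>\<^sup>+ x\<in>U. epow (min_wug \<mu> U p (\<lambda>y. F \<epsilon> t y - f t y) x) p \<partial>\<mu>) \<partial>lebesgue) \<le> ennreal e"
    using r unfolding eventually_at_right_field by (intro exI[of _ r]) auto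
qed

end

theorem theorem3p8:
  fixes \<mu> :: "'a::polish_space measure" and \<Omega> :: "'a set" and \<tau> p :: real
    and f :: "real \<Rightarrow> 'a \<Rightarrow> real" and \<eta> :: "real \<Rightarrow> real"
    and F :: "real \<Rightarrow> real \<Rightarrow> 'a \<Rightarrow> real"
  assumes borel_meas: "sets \<mu> = sets borel"
    and radon: "\<forall>x. \<exists>r>0. emeasure \<mu> (ball x r) < \<infinity>"
    and open_\<Omega>: "open \<Omega>"
    and tau: "0 < \<tau>"
    and p: "1 \<le> p"
    and f_loc: "in_Lp_N1p_loc \<mu> \<Omega> p \<tau> f"
    and eta: "std_mollifier \<eta>"
    and F_moll: "\<forall>U \<epsilon> t. open U \<and> compactly_in U \<Omega> \<and> 0 < \<epsilon> \<and> 0 < t - \<epsilon> \<and> t + \<epsilon> < \<tau> \<longrightarrow>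
        N1p_bochner_integral \<mu> U p {-\<epsilon>..\<epsilon>} (\<lambda>s x. moll_kernel \<eta> \<epsilon> s * f (t - s) x) (F \<epsilon> t)"
  shows "(\<forall>U a b. open U \<and> compactly_in U \<Omega> \<and> 0 < a \<and> a \<le> b \<and> b < \<tau> \<longrightarrow>
            ((\<lambda>\<epsilon>. \<integral>\<^sup>+ t\<in>{a..b}. (\<integral>\<^sup>+ x\<in>U. epow (min_wug \<mu> U p (\<lambda>y. F \<epsilon> t y - f t y) x) p \<partial>\<mu>) \<partial>lebesgue)
               \<longlongrightarrow> 0) (at_right 0))
       \<and> (\<forall>U a b. open U \<and> compactly_in U \<Omega> \<and> 0 < a \<and> a \<le> b \<and> b < \<tau> \<longrightarrow>
            ((\<lambda>s. \<integral>\<^sup>+ t\<in>{a..b}. (\<integral>\<^sup>+ x\<in>U. epow (min_wug \<mu> U p (\<lambda>y. f (t - s) y - f t y) x) p \<partial>\<mu>) \<partial>lebesgue)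
               \<longlongrightarrow> 0) (at 0))"
proof -
  have "((\<lambda>\<epsilon>. \<integral>\<^sup>+ t\<in>{a..b}. (\<integral>\<^sup>+ x\<in>U. epow (min_wug \<mu> U p (\<lambda>y. F \<epsilon> t y - f t y) x) p \<partial>\<mu>) \<partial>lebesgue) \<longlongrightarrow> 0) (at_right 0)
      \<and> ((\<lambda>s. \<integral>\<^sup>+ t\<in>{a..b}. (\<integral>\<^sup>+ x\<in>U. epow (min_wug \<mu> U p (\<lambda>y. f (t - s) y - f t y) x) p \<partial>\<mu>) \<partial>lebesgue) \<longlongrightarrow> 0) (at 0)"
    if U: "open U" "compactly_in U \<Omega>" and ab: "0 < a" "a \<le> b" "b < \<tau>" for U a b
  proof -
    interpret borel_domain \<mu> U p
      using borel_meas U p by unfold_locales auto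
    \<comment> \<open>The midpoints between \<open>a\<close> and 0 and between \<open>b\<close> and
      \<tau> leave room for short shifts on both sides while staying inside the open time
      interval.\<close>
    have f: "in_Lp_N1p \<mu> U p {a / 2..(b + \<tau>) / 2} f"
      using f_loc U ab unfolding in_Lp_N1p_loc_def by (simp add: field_simps)
    have ab': "a / 2 < a" "b < (b + \<tau>) / 2" using ab by auto
    have "N1p_bochner_integral \<mu> U p {-\<epsilon>..\<epsilon>} (\<lambda>s x. moll_kernel \<eta> \<epsilon> s * f (t - s) x) (F \<epsilon> t)"
      if "0 < \<epsilon>" "a / 2 \<le> t - \<epsilon>" "t + \<epsilon> \<le> (b + \<tau>) / 2" for \<epsilon> t
      using F_moll U ab that by auto
    then show ?thesis
      using mollification_limit[OF f ab'(1) ab(2) ab'(2) eta] translation_limit[OF f ab'(1) ab(2) ab'(2)] by blast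
  qed
  then show ?thesis by blast
qed

end
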